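(* Let $n,m,t,k,s\in\mathbb{N}$ and let $\mathcal{F}=\{f_1,\dots,f_m\}$ be a $t$-sparse family of coverage functions on $[n]$ whose dual sets satisfy $|S|\le s$ for all $S\in\mathcal{S}$. There is a randomized polynomial-time algorithm computing a $k$-coloring $\chi:[n]\to[k]$ such that, with high probability, $$\operatorname{disc}(\mathcal{F},\chi) < \sqrt{2\,m\,t^3\,k\,s\cdot(1+\ln(2mk))}.$$
   Context: A $t$-sparse family of coverage functions: for each $i\in[m]$ let $\mathcal{S}_i$ be a collection of subsets $S\subseteq[n]$ such that every $j\in[n]$ lies in at most $t$ different sets of $\mathcal{S}:=\bigcup_{i}\mathcal{S}_i$; then $f_i(T)=\sum_{S\in\mathcal{S}_i}\min\{|S\cap T|,1\}$ for $T\subseteq[n]$. For a $k$-coloring $\chi:[n]\to[k]$, $\operatorname{disc}(\mathcal{F},\chi)=\max_{i\in[m]}\max_{\ell,\ell'\in[k]}|f_i(\chi^{-1}(\ell))-f_i(\chi^{-1}(\ell'))|$. *)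

theory Defs
  imports
    "HOL-Probability.SPMF"
    "HOL-Library.Log_Nat"
    "HOL-Computational_Algebra.Polynomial"
begin

section \<open>Coverage functions and discrepancy\<close>

definition coverage :: "nat set set \<Rightarrow> nat set \<Rightarrow> real" where
  "coverage \<C> T = (\<Sum>S\<in>\<C>. min (real (card (S \<inter> T))) 1)"

text \<open>\<open>\<S> i\<close> is the collection of dual sets of the \<open>i\<close>-th function, \<open>i \<in> {1..m}\<close>.
  A set belonging to several \<open>\<S> i\<close> is counted only once in the sparsity condition.\<close>

definition sparse_coverage_family :: "nat \<Rightarrow> nat \<Rightarrow> nat \<Rightarrow> (nat \<Rightarrow> nat set set) \<Rightarrow> bool" where
  "sparse_coverage_family n m t \<S> \<longleftrightarrow>
     (\<forall>i\<in>{1..m}. \<S> i \<subseteq> Pow {1..n}) \<and>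
     (\<forall>j\<in>{1..n}. card {S \<in> (\<Union>i\<in>{1..m}. \<S> i). j \<in> S} \<le> t)"

definition colour_class :: "nat \<Rightarrow> (nat \<Rightarrow> nat) \<Rightarrow> nat \<Rightarrow> nat set" where
  "colour_class n \<kappa> l = {j \<in> {1..n}. \<kappa> j = l}"

definition disc :: "nat \<Rightarrow> nat \<Rightarrow> nat \<Rightarrow> (nat \<Rightarrow> nat set \<Rightarrow> real) \<Rightarrow> (nat \<Rightarrow> nat) \<Rightarrow> real" where
  "disc n m k f \<kappa> =
     (MAX i\<in>{1..m}. MAX (l, l')\<in>{1..k} \<times> {1..k}.
        \<bar>f i (colour_class n \<kappa> l) - f i (colour_class n \<kappa> l')\<bar>)"

section \<open>Randomized algorithms and their running time\<close>

text \<open>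
  The machine model is a WHILE language over binary trees with integer leaves and a fair coin.
  Each variable holds a pointer to an immutable tree, so copying, pairing and projecting take
  constant time. Arithmetic on integers is charged by the bit lengths of the operands (the
  logarithmic cost criterion), so that polynomial time in this model is the usual notion of
  polynomial time.
\<close>

datatype data = Leaf int | Node data data

definition bits :: "int \<Rightarrow> nat" where
  "bits a = floorlog 2 (nat \<bar>a\<bar>)"

primrec bit_size :: "data \<Rightarrow> nat" where
  "bit_size (Leaf a) = 1 + bits a"
| "bit_size (Node x y) = 1 + bit_size x + bit_size y"

primrec to_int :: "data \<Rightarrow> int" where
  "to_int (Leaf a) = a"
| "to_int (Node x y) = 0"

primrec left :: "data \<Rightarrow> data" where
  "left (Leaf a) = Leaf 0"
| "left (Node x y) = x"

primrec right :: "data \<Rightarrow> data" where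
  "right (Leaf a) = Leaf 0"
| "right (Node x y) = y"

primrec is_node :: "data \<Rightarrow> bool" where
  "is_node (Leaf a) = False"
| "is_node (Node x y) = True"

definition truthy :: "data \<Rightarrow> bool" where
  "truthy x \<longleftrightarrow> x \<noteq> Leaf 0"

datatype arith_op = Add | Sub | Mul | Div | Less

primrec apply_op :: "arith_op \<Rightarrow> int \<Rightarrow> int \<Rightarrow> int" where
  "apply_op Add a b = a + b"
| "apply_op Sub a b = a - b"
| "apply_op Mul a b = a * b"
| "apply_op Div a b = a div b"
| "apply_op Less a b = of_bool (a < b)"

datatype expr =
    Var nat
  | Const int
  | Arith arith_op expr expr
  | MkNode expr expr
  | LeftOf expr
  | RightOf expr
  | IsNode expr

type_synonym store = "nat \<Rightarrow> data"

primrec value_of :: "expr \<Rightarrow> store \<Rightarrow> data" where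
  "value_of (Var v) \<sigma> = \<sigma> v"
| "value_of (Const a) \<sigma> = Leaf a"
| "value_of (Arith f e1 e2) \<sigma> =
     Leaf (apply_op f (to_int (value_of e1 \<sigma>)) (to_int (value_of e2 \<sigma>)))"
| "value_of (MkNode e1 e2) \<sigma> = Node (value_of e1 \<sigma>) (value_of e2 \<sigma>)"
| "value_of (LeftOf e) \<sigma> = left (value_of e \<sigma>)"
| "value_of (RightOf e) \<sigma> = right (value_of e \<sigma>)"
| "value_of (IsNode e) \<sigma> = Leaf (of_bool (is_node (value_of e \<sigma>)))"

primrec expr_cost :: "expr \<Rightarrow> store \<Rightarrow> nat" where
  "expr_cost (Var v) \<sigma> = 1"
| "expr_cost (Const a) \<sigma> = 1 + bits a"
| "expr_cost (Arith f e1 e2) \<sigma> =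
     1 + expr_cost e1 \<sigma> + expr_cost e2 \<sigma>
       + bits (to_int (value_of e1 \<sigma>)) + bits (to_int (value_of e2 \<sigma>))"
| "expr_cost (MkNode e1 e2) \<sigma> = 1 + expr_cost e1 \<sigma> + expr_cost e2 \<sigma>"
| "expr_cost (LeftOf e) \<sigma> = 1 + expr_cost e \<sigma>"
| "expr_cost (RightOf e) \<sigma> = 1 + expr_cost e \<sigma>"
| "expr_cost (IsNode e) \<sigma> = 1 + expr_cost e \<sigma>"

datatype com =
    Skip
  | Assign nat expr
  | Flip nat
  | Seq com com
  | If expr com com
  | While expr com

text \<open>Divergence is missing probability mass.\<close>

partial_function (spmf) while_spmf :: "('s \<Rightarrow> bool) \<Rightarrow> ('s \<Rightarrow> 's spmf) \<Rightarrow> 's \<Rightarrow> 's spmf" where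
  "while_spmf g body s =
     (if g s then bind_spmf (body s) (while_spmf g body) else return_spmf s)"

text \<open>\<open>exec c \<sigma>\<close> is the joint distribution of the final store and the time used. The loop state
  carries the time spent so far, including that of evaluating the guard the current and all
  previous times.\<close>

primrec exec :: "com \<Rightarrow> store \<Rightarrow> (store \<times> nat) spmf" where
  "exec Skip \<sigma> = return_spmf (\<sigma>, 1)"
| "exec (Assign v e) \<sigma> = return_spmf (\<sigma>(v := value_of e \<sigma>), 1 + expr_cost e \<sigma>)"
| "exec (Flip v) \<sigma> = map_spmf (\<lambda>b. (\<sigma>(v := Leaf (of_bool b)), 1)) coin_spmf"
| "exec (Seq c1 c2) \<sigma> =
     bind_spmf (exec c1 \<sigma>) (\<lambda>(\<sigma>', T). map_spmf (\<lambda>(\<sigma>'', T'). (\<sigma>'', T + T')) (exec c2 \<sigma>'))"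
| "exec (If e c1 c2) \<sigma> =
     map_spmf (\<lambda>(\<sigma>', T). (\<sigma>', 1 + expr_cost e \<sigma> + T))
       (if truthy (value_of e \<sigma>) then exec c1 \<sigma> else exec c2 \<sigma>)"
| "exec (While e c) \<sigma> =
     while_spmf (\<lambda>(\<sigma>', T). truthy (value_of e \<sigma>'))
       (\<lambda>(\<sigma>', T). map_spmf (\<lambda>(\<sigma>'', T'). (\<sigma>'', T + T' + 1 + expr_cost e \<sigma>'')) (exec c \<sigma>'))
       (\<sigma>, 1 + expr_cost e \<sigma>)"

text \<open>Input and output are held in variable 0.\<close>

definition run :: "com \<Rightarrow> data \<Rightarrow> (data \<times> nat) spmf" where
  "run A x = map_spmf (\<lambda>(\<sigma>, T). (\<sigma> 0, T)) (exec A ((\<lambda>_. Leaf 0)(0 := x)))"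

definition result_of :: "com \<Rightarrow> data \<Rightarrow> data spmf" where
  "result_of A x = map_spmf fst (run A x)"

text \<open>Worst-case time over all coin outcomes, for inputs in \<open>X\<close>.\<close>

definition randomized_poly_time_on :: "data set \<Rightarrow> com \<Rightarrow> bool" where
  "randomized_poly_time_on X A \<longleftrightarrow>
     (\<exists>p :: nat poly. \<forall>x\<in>X.
        lossless_spmf (run A x) \<and> (\<forall>(y, T)\<in>set_spmf (run A x). T \<le> poly p (bit_size x)))"

section \<open>Encoding of inputs and outputs\<close>

fun encode_list :: "('a \<Rightarrow> data) \<Rightarrow> 'a list \<Rightarrow> data" where
  "encode_list enc [] = Leaf 0"
| "encode_list enc (x # xs) = Node (enc x) (encode_list enc xs)"

definition encode_nat :: "nat \<Rightarrow> data" where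
  "encode_nat a = Leaf (int a)"

text \<open>\<open>Fs\<close> lists the collections \<open>\<S> 1, \<dots>, \<S> m\<close>, each as a list of duplicate-free lists of
  elements, in any order and without repetition.\<close>

definition lists_family :: "nat \<Rightarrow> nat \<Rightarrow> (nat \<Rightarrow> nat set set) \<Rightarrow> nat list list list \<Rightarrow> bool" where
  "lists_family n m \<S> Fs \<longleftrightarrow>
     length Fs = m \<and>
     (\<forall>i<m. (\<forall>xs\<in>set (Fs ! i). distinct xs \<and> set xs \<subseteq> {1..n}) \<and>
             distinct (map set (Fs ! i)) \<and> set ` set (Fs ! i) = \<S> (Suc i))"

text \<open>The ground set is written out, so the input size is at least \<open>n\<close>; \<open>k\<close> is given in binary.
  The algorithm is not told \<open>t\<close> and \<open>s\<close>.\<close>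

definition encode_instance :: "nat \<Rightarrow> nat \<Rightarrow> nat list list list \<Rightarrow> data" where
  "encode_instance n k Fs =
     Node (encode_list encode_nat [1..<n + 1])
       (Node (encode_nat k) (encode_list (encode_list (encode_list encode_nat)) Fs))"

definition instances :: "data set" where
  "instances = {encode_instance n k Fs | n m k \<S> Fs.
     n \<ge> 1 \<and> m \<ge> 1 \<and> k \<ge> 1 \<and> lists_family n m \<S> Fs}"

definition encode_colouring :: "nat \<Rightarrow> (nat \<Rightarrow> nat) \<Rightarrow> data" where
  "encode_colouring n \<kappa> = encode_list encode_nat (map \<kappa> [1..<n + 1])"

end

theory Submission
  imports Defs "HOL-Probability.Hoeffding"
begin

text \<open>
  If \<open>k \<ge> n\<close>, give every element its own colour. Otherwise start from the (nearly) uniform fractional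
  \<open>k\<close>-colouring, under which the multilinear extensions \<open>F i\<close> of the coverage functions agree on all
  colours. Among the elements that are still fractional choose greedily a set no two of which share a
  dual set: on its coordinates every \<open>F i\<close> is affine. If it has more than \<open>m k\<close> elements, a kernel vector
  of the \<open>m k\<close> linear forms leads to a proper face of the product of simplices without changing any
  value. Such a point is found approximately without linear algebra: for every candidate face, repeatedly
  pick for each element the colour least correlated with the accumulated residual. The residual after
  \<open>T\<close> rounds is \<open>O(sqrt T)\<close>, so averaging the picks gives a fractional colouring with denominator \<open>T\<close>
  and polynomially small error, and no numbers grow along the iteration. When no face works any more,
  at most \<open>m k\<close> elements are independent, hence at most \<open>m k t s\<close> are fractional. Rounding them
  independently moves a value of \<open>F i\<close> by at most \<open>t\<close> per element, and the bound
  of Hoeffding and McDiarmid with a union bound over \<open>m k\<close> values makes one rounding succeed with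
  probability at least \<open>1 / 2\<close>; the best of sufficiently many independent roundings is returned.

  All of this except the coin flips is a functional program composed from polynomial-time functions
  on encodable types, so the running time comes from closure properties of such functions.
\<close>

section \<open>A calculus of polynomial-time functions\<close>

text \<open>The constants interlock. With \<open>N = m k t s\<close> rounded elements of influence
  at most \<open>t\<close>, a value deviates by \<open>\<mu>\<close> with probability at most
  \<open>2 * exp (- 2 * \<mu>\<^sup>2 / (N * t\<^sup>2))\<close>. At
  \<open>\<mu> = \<Lambda> / 2\<close>, where \<open>\<Lambda>\<close> is the claimed bound, the
  exponent is \<open>- (1 + ln (2 m k))\<close>, and the union bound over \<open>m k\<close> values
  gives \<open>1 / e\<close>. The gap between \<open>1 / e\<close> and \<open>1 / 2\<close> is the
  whole budget for numerical error: it pays for \<open>\<mu> = \<Lambda> / 2 - 1 / 16\<close>, that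
  is, for values that agree across colours only up to \<open>1 / 8\<close> before rounding. This is
  why approximate kernel steps suffice. The case \<open>k \<ge> n\<close> is split off because
  \<open>k\<close> is written in binary: a list of all colours could be exponentially long, whereas
  for \<open>k < n\<close> the colours are a prefix of the ground set. Knowing neither
  \<open>t\<close> nor \<open>s\<close>, the algorithm cannot test whether a rounding meets the
  bound; it keeps the trial of least discrepancy. The kernel vector lives in the analysis alone: the
  program tries every face and tests the residual it has reached.\<close>

class enc =
  fixes enc :: "'a \<Rightarrow> data"

instantiation nat :: enc
begin
definition enc_nat :: "nat \<Rightarrow> data" where "enc_nat = encode_nat"
instance ..
end

instantiation int :: enc
begin
definition enc_int :: "int \<Rightarrow> data" where "enc_int = Leaf"
instance ..
end

instantiation bool :: enc
begin
definition enc_bool :: "bool \<Rightarrow> data" where "enc_bool b = Leaf (of_bool b)"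
instance ..
end

instantiation prod :: (enc, enc) enc
begin
definition enc_prod :: "'a \<times> 'b \<Rightarrow> data" where "enc_prod p = Node (enc (fst p)) (enc (snd p))"
instance ..
end

instantiation list :: (enc) enc
begin
definition enc_list :: "'a list \<Rightarrow> data" where "enc_list = encode_list enc"
instance ..
end

definition sz :: "'a::enc \<Rightarrow> nat" where "sz x = bit_size (enc x)"

lemma enc_simps [simp]:
  "enc (n::nat) = Leaf (int n)" "enc (z::int) = Leaf z" "enc (b::bool) = Leaf (of_bool b)"
  "enc (x, y) = Node (enc x) (enc y)"
  "enc ([]::'a::enc list) = Leaf 0" "enc (a # as) = Node (enc a) (enc as)"
  by (auto simp: enc_nat_def encode_nat_def enc_int_def enc_bool_def enc_prod_def enc_list_def)

lemma enc_prod_eq: "enc p = Node (enc (fst p)) (enc (snd p))"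
  by (simp add: enc_prod_def)

lemma truthy_enc [simp]: "truthy (enc b) \<longleftrightarrow> b" "truthy (Leaf (of_bool b)) \<longleftrightarrow> b"
  by (auto simp: truthy_def)

lemma is_node_enc_list [simp]: "is_node (enc xs) \<longleftrightarrow> xs \<noteq> []" for xs :: "'a::enc list"
  by (cases xs) auto

section \<open>Bit lengths of integers and sizes of encodings\<close>

lemma bits_0 [simp]: "bits 0 = 0"
  by (simp add: bits_def floorlog_def)

lemma bits_1 [simp]: "bits 1 = 1"
  by (simp add: bits_def floorlog_def)

lemma bits_le_iff: "bits a \<le> w \<longleftrightarrow> \<bar>a\<bar> < 2 ^ w"
proof -
  have "bits a \<le> w \<longleftrightarrow> nat \<bar>a\<bar> < 2 ^ w"
    unfolding bits_def by (subst floorlog_le_iff) auto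
  also have "\<dots> \<longleftrightarrow> \<bar>a\<bar> < 2 ^ w"
    by (simp add: nat_less_iff)
  finally show ?thesis .
qed

lemma less_two_power_bits: "\<bar>a\<bar> < 2 ^ bits a"
  using bits_le_iff by blast

lemma bits_mono: "\<bar>a\<bar> \<le> \<bar>b\<bar> \<Longrightarrow> bits a \<le> bits b"
  using bits_le_iff[of a "bits b"] less_two_power_bits[of b] by linarith

lemma bits_add_le: "bits (a + b) \<le> bits a + bits b + 1"
proof -
  have "\<bar>a + b\<bar> < 2 ^ bits a + 2 ^ bits b"
    using less_two_power_bits[of a] less_two_power_bits[of b] by linarith
  also have "\<dots> \<le> (2::int) ^ (bits a + bits b) + 2 ^ (bits a + bits b)"
    by (intro add_mono power_increasing) auto
  finally show ?thesis by (simp add: bits_le_iff)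
qed

lemma bits_minus [simp]: "bits (- a) = bits a"
  by (simp add: bits_def)

lemma bits_diff_le: "bits (a - b) \<le> bits a + bits b + 1"
  using bits_add_le[of a "- b"] by simp

lemma bits_mult_le: "bits (a * b) \<le> bits a + bits b"
proof -
  have "\<bar>a\<bar> * \<bar>b\<bar> < 2 ^ bits a * 2 ^ bits b"
    by (intro mult_strict_mono less_two_power_bits) auto
  then show ?thesis by (simp add: bits_le_iff abs_mult power_add)
qed

text \<open>Rounding down keeps \<open>a \<le> a div b < 0\<close> for negative \<open>a\<close> and
  positive \<open>b\<close>; negating both arguments turns a negative divisor into a positive one,
  and division by \<open>0\<close> gives \<open>0\<close>.\<close>

lemma abs_div_le: "\<bar>a div b\<bar> \<le> \<bar>a\<bar>" for a b :: int
proof (cases "b = 0")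
  case False
  have "\<bar>a div b\<bar> \<le> \<bar>a\<bar>" if "b > 0" for a b :: int
  proof (cases "a \<ge> 0")
    case True
    then show ?thesis using that
      using zdiv_mono2[of a 1 b] by (simp add: pos_imp_zdiv_nonneg_iff)
  next
    case False
    have "a \<le> a div b"
      using that False zdiv_mono2_neg[of a 1 b] by simp
    moreover have "a div b < 0" using that False by (simp add: div_neg_pos_less0)
    ultimately show ?thesis by linarith
  qed
  from this[of b a] this[of "-b" "-a"] show ?thesis
    using False by (cases "b > 0") auto
qed auto

lemma bits_div_le: "bits (a div b) \<le> bits a"
  by (intro bits_mono abs_div_le)

lemma bits_int_le: "bits (int n) \<le> n"
  by (simp add: bits_le_iff)

lemma sz_pos [simp]: "sz x \<ge> 1" "sz x > 0"
proof -
  have "bit_size d \<ge> 1" for d by (cases d) auto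
  then show "sz x \<ge> 1" by (simp add: sz_def)
  then show "sz x > 0" by simp
qed

lemma sz_simps [simp]:
  "sz (n::nat) = Suc (bits (int n))" "sz (z::int) = Suc (bits z)"
  "sz (x, y) = Suc (sz x + sz y)"
  "sz ([]::'a::enc list) = 1" "sz (a # as) = Suc (sz a + sz as)"
  by (auto simp: sz_def)

lemma sz_bool_le: "sz (b::bool) \<le> 2"
  by (cases b) (simp_all add: sz_def)

lemma sz_prod_eq: "sz p = Suc (sz (fst p) + sz (snd p))"
  by (cases p) simp

text \<open>The leaf that ends \<open>xs\<close> disappears in the concatenation, whence the
  \<open>+ 1\<close>.\<close>

lemma sz_append [simp]: "sz (xs @ ys) + 1 = sz xs + sz ys"
  by (induction xs) auto

lemma sz_append_le: "sz (xs @ ys) \<le> sz xs + sz ys"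
  using sz_append[of xs ys] by linarith

lemma sz_list: "sz xs = 1 + length xs + sum_list (map sz xs)"
  by (induction xs) auto

lemma length_le_sz: "length xs \<le> sz xs"
  by (simp add: sz_list)

lemma sz_member: "x \<in> set xs \<Longrightarrow> sz x \<le> sz xs"
  by (induction xs) auto

lemma sz_list_le: "(\<And>x. x \<in> set xs \<Longrightarrow> sz x \<le> B) \<Longrightarrow> sz xs \<le> 1 + length xs * (1 + B)"
proof (induction xs)
  case (Cons x xs)
  have "sz x \<le> B" "sz xs \<le> 1 + length xs * (1 + B)" using Cons by auto
  then show ?case by simp
qed simp

section \<open>Polynomial bounds in the size of the encoding\<close>

definition pb :: "('a::enc \<Rightarrow> nat) \<Rightarrow> bool" where
  "pb g \<longleftrightarrow> (\<exists>p :: nat poly. \<forall>x. g x \<le> poly p (sz x))"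

text \<open>Coefficients in \<open>nat\<close> make every bounding polynomial monotone, so upper
  bounds on sizes can be substituted into it.\<close>

lemma poly_nat_mono: "a \<le> b \<Longrightarrow> poly p a \<le> poly p b" for p :: "nat poly"
  by (induction p) (auto intro!: add_mono mult_mono)

named_theorems pb_intros

lemma pb_mono: "pb g \<Longrightarrow> (\<And>x. h x \<le> g x) \<Longrightarrow> pb h"
  unfolding pb_def by (meson order_trans)

lemma pb_const [pb_intros]: "pb (\<lambda>_. c)"
  unfolding pb_def by (intro exI[of _ "[:c:]"]) auto

lemma pb_sz [pb_intros]: "pb sz" "pb (\<lambda>x. sz x)"
  unfolding pb_def by (auto intro!: exI[of _ "[:0, 1:]"])

lemma pb_add [pb_intros]: "pb f \<Longrightarrow> pb g \<Longrightarrow> pb (\<lambda>x. f x + g x)"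
  unfolding pb_def
proof (elim exE)
  fix p q assume "\<forall>x. f x \<le> poly p (sz x)" "\<forall>x. g x \<le> poly q (sz x)"
  then show "\<exists>p. \<forall>x. f x + g x \<le> poly p (sz x)"
    by (intro exI[of _ "p + q"]) (auto intro: add_mono)
qed

lemma pb_Suc [pb_intros]: "pb f \<Longrightarrow> pb (\<lambda>x. Suc (f x))"
proof -
  assume "pb f"
  then have "pb (\<lambda>x. f x + 1)" by (intro pb_add pb_const)
  then show ?thesis by simp
qed

lemma pb_mult [pb_intros]: "pb f \<Longrightarrow> pb g \<Longrightarrow> pb (\<lambda>x. f x * g x)"
  unfolding pb_def
proof (elim exE)
  fix p q assume "\<forall>x. f x \<le> poly p (sz x)" "\<forall>x. g x \<le> poly q (sz x)"
  then show "\<exists>p. \<forall>x. f x * g x \<le> poly p (sz x)"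
    by (intro exI[of _ "p * q"]) (auto intro: mult_mono)
qed

lemma pb_poly [pb_intros]: "pb f \<Longrightarrow> pb (\<lambda>x. poly p (f x))"
  by (induction p) (auto intro!: pb_const pb_add pb_mult)

lemma pb_comp:
  assumes "pb g" "pb (\<lambda>x. sz (f x))"
  shows "pb (\<lambda>x. g (f x))"
proof -
  from assms(1) obtain p where "\<And>y. g y \<le> poly p (sz y)" unfolding pb_def by blast
  then show ?thesis
    by (intro pb_mono[OF pb_poly[OF assms(2), of p]]) auto
qed

section \<open>Program families and their closure under composition, pairing and branching\<close>

definition computes :: "(nat \<Rightarrow> com) \<Rightarrow> ('a::enc \<Rightarrow> 'b::enc) \<Rightarrow> ('a \<Rightarrow> nat) \<Rightarrow> bool" where
  "computes C f g \<longleftrightarrow> (\<forall>v \<sigma> x. \<sigma> v = enc x \<longrightarrow>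
     (\<exists>\<sigma>' T. exec (C v) \<sigma> = return_spmf (\<sigma>', T) \<and> \<sigma>' v = enc (f x) \<and>
             (\<forall>w<v. \<sigma>' w = \<sigma> w) \<and> T \<le> g x))"

text \<open>A program family is parametrised by the variable that holds its argument and its result;
  leaving the smaller variables untouched is what makes programs composable. Sharing lets a
  program build trees that are exponentially larger than its running time, hence the separate
  bound on the size of the result.\<close>

definition polyt :: "('a::enc \<Rightarrow> 'b::enc) \<Rightarrow> bool" where
  "polyt f \<longleftrightarrow> pb (\<lambda>x. sz (f x)) \<and> (\<exists>C g. pb g \<and> computes C f g)"

lemma polyt_pb: "polyt f \<Longrightarrow> pb (\<lambda>x. sz (f x))"
  by (simp add: polyt_def)

lemma polytI: "pb (\<lambda>x. sz (f x)) \<Longrightarrow> pb g \<Longrightarrow> computes C f g \<Longrightarrow> polyt f"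
  unfolding polyt_def by blast

lemma polytE:
  assumes "polyt f"
  obtains C g where "pb g" "computes C f g"
  using assms unfolding polyt_def by blast

lemma computesE:
  assumes "computes C f g" "\<sigma> v = enc x"
  obtains \<sigma>' T where "exec (C v) \<sigma> = return_spmf (\<sigma>', T)" "\<sigma>' v = enc (f x)"
    "\<And>w. w < v \<Longrightarrow> \<sigma>' w = \<sigma> w" "T \<le> g x"
  using assms unfolding computes_def by blast

lemma exec_Seq_return:
  assumes "exec c1 \<sigma> = return_spmf (\<sigma>1, T1)" "exec c2 \<sigma>1 = return_spmf (\<sigma>2, T2)"
  shows "exec (Seq c1 c2) \<sigma> = return_spmf (\<sigma>2, T1 + T2)"
  using assms by simp

lemma polyt_expr:
  fixes f :: "'a::enc \<Rightarrow> 'b::enc" and g :: "'a \<Rightarrow> nat"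
  assumes val: "\<And>v \<sigma> x. \<sigma> v = enc x \<Longrightarrow> value_of (E v) \<sigma> = enc (f x)"
    and cost: "\<And>v \<sigma> x. \<sigma> v = enc x \<Longrightarrow> expr_cost (E v) \<sigma> \<le> g x"
    and "pb g" and "pb (\<lambda>x. sz (f x))"
  shows "polyt f"
proof (rule polytI)
  show "computes (\<lambda>v. Assign v (E v)) f (\<lambda>x. 1 + g x)"
    unfolding computes_def by (auto simp: val cost)
qed (use assms in \<open>auto intro!: pb_intros\<close>)

named_theorems polyt_intros

lemma polyt_ident [polyt_intros]: "polyt (\<lambda>x. x)"
  by (rule polyt_expr[where E = Var and g = "\<lambda>_. 1"]) (auto intro!: pb_intros)

lemma polyt_comp:
  assumes "polyt f" "polyt h"
  shows "polyt (\<lambda>x. h (f x))"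
proof -
  obtain C1 g1 where 1: "pb g1" "computes C1 f g1" using assms(1) by (rule polytE)
  obtain C2 g2 where 2: "pb g2" "computes C2 h g2" using assms(2) by (rule polytE)
  show ?thesis
  proof (rule polytI)
    show "pb (\<lambda>x. sz (h (f x)))"
      by (rule pb_comp[OF polyt_pb polyt_pb]) fact+
    show "pb (\<lambda>x. g1 x + g2 (f x))"
      by (intro pb_add 1 pb_comp[OF 2(1) polyt_pb] assms)
    show "computes (\<lambda>v. Seq (C1 v) (C2 v)) (\<lambda>x. h (f x)) (\<lambda>x. g1 x + g2 (f x))"
      unfolding computes_def
    proof (intro allI impI)
      fix v :: nat and \<sigma> :: store and x :: 'a assume "\<sigma> v = enc x"
      then obtain \<sigma>1 T1 where s1: "exec (C1 v) \<sigma> = return_spmf (\<sigma>1, T1)" "\<sigma>1 v = enc (f x)"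
        "\<And>w. w < v \<Longrightarrow> \<sigma>1 w = \<sigma> w" "T1 \<le> g1 x"
        by - (erule computesE[OF 1(2), where \<sigma> = \<sigma> and v = v], blast)
      obtain \<sigma>2 T2 where s2: "exec (C2 v) \<sigma>1 = return_spmf (\<sigma>2, T2)" "\<sigma>2 v = enc (h (f x))"
        "\<And>w. w < v \<Longrightarrow> \<sigma>2 w = \<sigma>1 w" "T2 \<le> g2 (f x)"
        using s1(2) by - (erule computesE[OF 2(2), where \<sigma> = \<sigma>1 and v = v], blast)
      show "\<exists>\<sigma>' T. exec (Seq (C1 v) (C2 v)) \<sigma> = return_spmf (\<sigma>', T) \<and> \<sigma>' v = enc (h (f x)) \<and>
          (\<forall>w<v. \<sigma>' w = \<sigma> w) \<and> T \<le> g1 x + g2 (f x)"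
        using s1 s2 by (intro exI[of _ \<sigma>2] exI[of _ "T1 + T2"]) auto
    qed
  qed
qed

text \<open>The first program runs on a copy at \<open>v + 1\<close> and spares the argument at
  \<open>v\<close>; the second runs on a copy at \<open>v + 2\<close> and spares the first result at
  \<open>v + 1\<close>. The three assignments cost \<open>2 + 2 + 4 = 8\<close>.\<close>

lemma polyt_Pair [polyt_intros]:
  assumes "polyt f" "polyt h"
  shows "polyt (\<lambda>x. (f x, h x))"
proof -
  obtain C1 g1 where 1: "pb g1" "computes C1 f g1" using assms(1) by (rule polytE)
  obtain C2 g2 where 2: "pb g2" "computes C2 h g2" using assms(2) by (rule polytE)
  define C where "C = (\<lambda>v. Seq (Assign (v + 1) (Var v)) (Seq (C1 (v + 1))
    (Seq (Assign (v + 2) (Var v)) (Seq (C2 (v + 2)) (Assign v (MkNode (Var (v + 1)) (Var (v + 2))))))))"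
  show ?thesis
  proof (rule polytI)
    show "pb (\<lambda>x. sz (f x, h x))"
      using assms by (auto intro!: pb_intros dest: polyt_pb)
    show "pb (\<lambda>x. 8 + g1 x + g2 x)"
      by (intro pb_intros 1 2)
    show "computes C (\<lambda>x. (f x, h x)) (\<lambda>x. 8 + g1 x + g2 x)"
      unfolding computes_def
    proof (intro allI impI)
      fix v :: nat and \<sigma> :: store and x :: 'a assume v: "\<sigma> v = enc x"
      then have "(\<sigma>(v + 1 := \<sigma> v)) (v + 1) = enc x" by simp
      then obtain \<sigma>1 T1 where s1: "exec (C1 (v + 1)) (\<sigma>(v + 1 := \<sigma> v)) = return_spmf (\<sigma>1, T1)"
        "\<sigma>1 (v + 1) = enc (f x)" "\<And>w. w < v + 1 \<Longrightarrow> \<sigma>1 w = (\<sigma>(v + 1 := \<sigma> v)) w" "T1 \<le> g1 x"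
        by - (erule computesE[OF 1(2), where \<sigma> = "\<sigma>(v + 1 := \<sigma> v)" and v = "v + 1"], blast)
      have "(\<sigma>1(v + 2 := \<sigma>1 v)) (v + 2) = enc x" using s1(3)[of v] v by simp
      then obtain \<sigma>2 T2 where s2: "exec (C2 (v + 2)) (\<sigma>1(v + 2 := \<sigma>1 v)) = return_spmf (\<sigma>2, T2)"
        "\<sigma>2 (v + 2) = enc (h x)" "\<And>w. w < v + 2 \<Longrightarrow> \<sigma>2 w = (\<sigma>1(v + 2 := \<sigma>1 v)) w" "T2 \<le> g2 x"
        by - (erule computesE[OF 2(2), where \<sigma> = "\<sigma>1(v + 2 := \<sigma>1 v)" and v = "v + 2"], blast)
      have "exec (C v) \<sigma> = return_spmf (\<sigma>2(v := Node (enc (f x)) (enc (h x))), 2 + (T1 + (2 + (T2 + 4))))"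
        unfolding C_def using s1 s2 by simp
      moreover have "\<sigma>2 w = \<sigma> w" if "w < v" for w
        using that s1(3)[of w] s2(3)[of w] by simp
      ultimately show "\<exists>\<sigma>' T. exec (C v) \<sigma> = return_spmf (\<sigma>', T) \<and> \<sigma>' v = enc (f x, h x) \<and>
          (\<forall>w<v. \<sigma>' w = \<sigma> w) \<and> T \<le> 8 + g1 x + g2 x"
        using s1 s2 by (intro exI) auto
    qed
  qed
qed

text \<open>A curried function is treated as a function of nested pairs; rules of this kind plug
  argument functions into it, so that closure rules hold for arbitrary arguments.\<close>

lemma polyt_comp2:
  assumes "polyt (\<lambda>p. h (fst p) (snd p))" "polyt f" "polyt g"
  shows "polyt (\<lambda>x. h (f x) (g x))"
  using polyt_comp[OF polyt_Pair[OF assms(2,3)] assms(1)] by simp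

lemma polyt_comp3:
  assumes "polyt (\<lambda>p. h (fst p) (fst (snd p)) (snd (snd p)))" "polyt f" "polyt g" "polyt k"
  shows "polyt (\<lambda>x. h (f x) (g x) (k x))"
  using polyt_comp[OF polyt_Pair[OF assms(2) polyt_Pair[OF assms(3,4)]] assms(1)] by simp

lemma polyt_comp4:
  assumes "polyt (\<lambda>p. h (fst p) (fst (snd p)) (fst (snd (snd p))) (snd (snd (snd p))))"
    "polyt f" "polyt g" "polyt k" "polyt l"
  shows "polyt (\<lambda>x. h (f x) (g x) (k x) (l x))"
  using polyt_comp[OF polyt_Pair[OF assms(2) polyt_Pair[OF assms(3) polyt_Pair[OF assms(4,5)]]] assms(1)]
  by simp

lemma polyt_fst [polyt_intros]: "polyt f \<Longrightarrow> polyt (\<lambda>x. fst (f x))"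
proof (erule polyt_comp)
  show "polyt (fst :: 'b \<times> 'c \<Rightarrow> 'b)"
  proof (rule polyt_expr[where E = "\<lambda>v. LeftOf (Var v)" and g = "\<lambda>_. 2"])
    show "pb (\<lambda>x. sz (fst (x :: 'b \<times> 'c)))"
      by (rule pb_mono[OF pb_sz(1)]) (auto simp: sz_prod_eq)
  qed (auto simp: enc_prod_eq intro!: pb_intros)
qed

lemma polyt_snd [polyt_intros]: "polyt f \<Longrightarrow> polyt (\<lambda>x. snd (f x))"
proof (erule polyt_comp)
  show "polyt (snd :: 'b \<times> 'c \<Rightarrow> 'c)"
  proof (rule polyt_expr[where E = "\<lambda>v. RightOf (Var v)" and g = "\<lambda>_. 2"])
    show "pb (\<lambda>x. sz (snd (x :: 'b \<times> 'c)))"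
      by (rule pb_mono[OF pb_sz(1)]) (auto simp: sz_prod_eq)
  qed (auto simp: enc_prod_eq intro!: pb_intros)
qed

lemma polyt_const_leaf:
  assumes "enc c = Leaf a"
  shows "polyt (\<lambda>_. c)"
  by (rule polyt_expr[where E = "\<lambda>_. Const a" and g = "\<lambda>_. 1 + bits a"])
     (auto simp: assms intro!: pb_intros)

lemma polyt_consts [polyt_intros]:
  "polyt (\<lambda>_. n :: nat)" "polyt (\<lambda>_. z :: int)" "polyt (\<lambda>_. b :: bool)" "polyt (\<lambda>_. [] :: 'a::enc list)"
  by (rule polyt_const_leaf, simp)+

text \<open>A cons cell has the same encoding as the pair of its parts, so once the pair is built a
  mere copy remains.\<close>

lemma polyt_Cons [polyt_intros]:
  assumes "polyt f" "polyt h"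
  shows "polyt (\<lambda>x. f x # h x)"
proof (rule polyt_comp2[OF _ assms])
  show "polyt (\<lambda>p :: 'b \<times> 'b list. fst p # snd p)"
    by (rule polyt_expr[where E = Var and g = "\<lambda>_. 1"])
       (auto simp: enc_prod_eq sz_prod_eq intro!: pb_intros intro: pb_mono[OF pb_sz(1)])
qed

lemma polyt_arith:
  fixes h :: "'a::enc \<Rightarrow> 'b::enc \<Rightarrow> 'c::enc"
  assumes "\<And>a b. enc (h a b) = Leaf (apply_op f (to_int (enc a)) (to_int (enc b)))"
    and "\<And>a b. sz (h a b) \<le> sz a + sz b" "polyt u" "polyt w"
  shows "polyt (\<lambda>x. h (u x) (w x))"
proof (rule polyt_comp2[OF _ assms(3,4)])
  have b: "bits (to_int d) \<le> bit_size d" for d by (cases d) auto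
  show "polyt (\<lambda>p. h (fst p) (snd p))"
  proof (rule polyt_expr[where E = "\<lambda>v. Arith f (LeftOf (Var v)) (RightOf (Var v))"
        and g = "\<lambda>x. 5 + sz x"])
    show "pb (\<lambda>x. sz (h (fst x) (snd x)))"
      by (rule pb_mono[OF pb_sz(1)]) (auto simp: sz_prod_eq intro: order_trans[OF assms(2)])
    show "pb (\<lambda>x. 5 + sz x)" by (intro pb_intros)
    fix v :: nat and \<sigma> :: store and x :: "'a \<times> 'b" assume "\<sigma> v = enc x"
    then show "expr_cost (Arith f (LeftOf (Var v)) (RightOf (Var v))) \<sigma> \<le> 5 + sz x"
      using b[of "enc (fst x)"] b[of "enc (snd x)"]
      by (simp add: enc_prod_eq sz_prod_eq sz_def)
  qed (simp add: assms enc_prod_eq)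
qed

lemma polyt_arith_intros [polyt_intros]:
  fixes a b :: "'a::enc \<Rightarrow> int" and i j :: "'a::enc \<Rightarrow> nat"
  shows "polyt a \<Longrightarrow> polyt b \<Longrightarrow> polyt (\<lambda>x. a x + b x)"
    "polyt a \<Longrightarrow> polyt b \<Longrightarrow> polyt (\<lambda>x. a x - b x)"
    "polyt a \<Longrightarrow> polyt b \<Longrightarrow> polyt (\<lambda>x. a x * b x)"
    "polyt a \<Longrightarrow> polyt b \<Longrightarrow> polyt (\<lambda>x. a x div b x)"
    "polyt a \<Longrightarrow> polyt b \<Longrightarrow> polyt (\<lambda>x. a x < b x)"
    "polyt i \<Longrightarrow> polyt j \<Longrightarrow> polyt (\<lambda>x. i x + j x)"
    "polyt i \<Longrightarrow> polyt j \<Longrightarrow> polyt (\<lambda>x. i x * j x)"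
    "polyt i \<Longrightarrow> polyt j \<Longrightarrow> polyt (\<lambda>x. i x < j x)"
proof -
  have S: "sz (a + b) \<le> sz a + sz b" "sz (a - b) \<le> sz a + sz b" for a b :: int
    using bits_add_le[of a b] bits_diff_le[of a b] by simp_all
  have M: "sz (a * b) \<le> sz a + sz b" "sz (a div b) \<le> sz a + sz b" for a b :: int
    using bits_mult_le[of a b] bits_div_le[of a b] by simp_all
  have L: "sz (b :: bool) \<le> sz x + sz y" for b and x :: "'b::enc" and y :: "'c::enc"
    using sz_bool_le[of b] sz_pos(1)[of x] sz_pos(1)[of y] by linarith
  have N: "sz (a + b) \<le> sz a + sz b" "sz (a * b) \<le> sz a + sz b" for a b :: nat
    using S[of "int a" "int b"] M[of "int a" "int b"] by simp_all
  show "polyt a \<Longrightarrow> polyt b \<Longrightarrow> polyt (\<lambda>x. a x + b x)"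
    by (rule polyt_arith[where f = Add]) (use S in auto)
  show "polyt a \<Longrightarrow> polyt b \<Longrightarrow> polyt (\<lambda>x. a x - b x)"
    by (rule polyt_arith[where f = Sub]) (use S in auto)
  show "polyt a \<Longrightarrow> polyt b \<Longrightarrow> polyt (\<lambda>x. a x * b x)"
    by (rule polyt_arith[where f = Mul]) (use M in auto)
  show "polyt a \<Longrightarrow> polyt b \<Longrightarrow> polyt (\<lambda>x. a x div b x)"
    by (rule polyt_arith[where f = Div]) (use M in auto)
  show "polyt a \<Longrightarrow> polyt b \<Longrightarrow> polyt (\<lambda>x. a x < b x)"
    by (rule polyt_arith[where f = Less and h = "(<)"]) (auto intro: L simp del: sz_simps)
  show "polyt i \<Longrightarrow> polyt j \<Longrightarrow> polyt (\<lambda>x. i x + j x)"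
    by (rule polyt_arith[where f = Add]) (use N in auto)
  show "polyt i \<Longrightarrow> polyt j \<Longrightarrow> polyt (\<lambda>x. i x * j x)"
    by (rule polyt_arith[where f = Mul]) (use N in auto)
  show "polyt i \<Longrightarrow> polyt j \<Longrightarrow> polyt (\<lambda>x. i x < j x)"
    by (rule polyt_arith[where f = Less and h = "(<)"]) (auto intro: L simp del: sz_simps)
qed

lemma polyt_int [polyt_intros]: "polyt f \<Longrightarrow> polyt (\<lambda>x. int (f x))"
  by (erule polyt_comp, rule polyt_expr[where E = Var and g = "\<lambda>_. 1"])
     (auto intro!: pb_intros intro: pb_mono[OF pb_sz(1)])

text \<open>The machine computes the remainder as \<open>i - (i div j) * j\<close>; for
  \<open>j = 0\<close> both sides are \<open>i\<close>.\<close>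

lemma polyt_mod [polyt_intros]:
  assumes "polyt i" "polyt j"
  shows "polyt (\<lambda>x. i x mod j x :: nat)"
proof (rule polyt_comp[where h = "\<lambda>p. fst p mod snd p", OF polyt_Pair[OF assms], simplified])
  let ?E = "\<lambda>v. Arith Sub (LeftOf (Var v)) (Arith Mul (Arith Div (LeftOf (Var v)) (RightOf (Var v)))
    (RightOf (Var v)))"
  show "polyt (\<lambda>p. fst p mod snd p :: nat)"
  proof (rule polyt_expr[where E = ?E and g = "\<lambda>x. 20 + 6 * sz x"])
    fix v :: nat and \<sigma> :: store and x :: "nat \<times> nat" assume "\<sigma> v = enc x"
    then show "value_of (?E v) \<sigma> = enc (fst x mod snd x)"
      by (simp add: enc_prod_eq minus_div_mult_eq_mod zmod_int)
  next
    fix v :: nat and \<sigma> :: store and x :: "nat \<times> nat" assume "\<sigma> v = enc x"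
    then show "expr_cost (?E v) \<sigma> \<le> 20 + 6 * sz x"
      using bits_mult_le[of "int (fst x) div int (snd x)" "int (snd x)"]
        bits_div_le[of "int (fst x)" "int (snd x)"]
      by (simp add: enc_prod_eq sz_prod_eq)
  next
    show "pb (\<lambda>x :: nat \<times> nat. sz (fst x mod snd x))"
    proof (rule pb_mono[OF pb_sz(1)])
      fix x :: "nat \<times> nat"
      show "sz (fst x mod snd x) \<le> sz x"
        using bits_mono[of "int (fst x mod snd x)" "int (fst x)"] by (simp add: sz_prod_eq)
    qed
  qed (intro pb_intros)
qed

text \<open>The condition is evaluated on a copy at \<open>v + 1\<close>, so the argument is still
  at \<open>v\<close> when the chosen branch starts there.\<close>

lemma polyt_If [polyt_intros]:
  assumes "polyt b" "polyt f" "polyt h"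
  shows "polyt (\<lambda>x. if b x then f x else h x)"
proof -
  obtain C0 g0 where 0: "pb g0" "computes C0 b g0" using assms(1) by (rule polytE)
  obtain C1 g1 where 1: "pb g1" "computes C1 f g1" using assms(2) by (rule polytE)
  obtain C2 g2 where 2: "pb g2" "computes C2 h g2" using assms(3) by (rule polytE)
  define C where "C = (\<lambda>v. Seq (Assign (v + 1) (Var v)) (Seq (C0 (v + 1))
    (If (Var (v + 1)) (C1 v) (C2 v))))"
  show ?thesis
  proof (rule polytI)
    have "pb (\<lambda>x. sz (f x) + sz (h x))"
      using assms by (auto intro!: pb_intros dest: polyt_pb)
    then show "pb (\<lambda>x. sz (if b x then f x else h x))"
      by (rule pb_mono) auto
    show "pb (\<lambda>x. 4 + g0 x + g1 x + g2 x)"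
      by (intro pb_intros 0 1 2)
    show "computes C (\<lambda>x. if b x then f x else h x) (\<lambda>x. 4 + g0 x + g1 x + g2 x)"
      unfolding computes_def
    proof (intro allI impI)
      fix v :: nat and \<sigma> :: store and x :: 'a assume v: "\<sigma> v = enc x"
      then have "(\<sigma>(v + 1 := \<sigma> v)) (v + 1) = enc x" by simp
      then obtain \<sigma>1 T1 where s1: "exec (C0 (v + 1)) (\<sigma>(v + 1 := \<sigma> v)) = return_spmf (\<sigma>1, T1)"
        "\<sigma>1 (v + 1) = enc (b x)" "\<And>w. w < v + 1 \<Longrightarrow> \<sigma>1 w = (\<sigma>(v + 1 := \<sigma> v)) w" "T1 \<le> g0 x"
        by - (erule computesE[OF 0(2), where \<sigma> = "\<sigma>(v + 1 := \<sigma> v)" and v = "v + 1"], blast)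
      have v1: "\<sigma>1 v = enc x" using s1(3)[of v] v by simp
      obtain \<sigma>2 T2 where s2: "exec (if b x then C1 v else C2 v) \<sigma>1 = return_spmf (\<sigma>2, T2)"
        "\<sigma>2 v = enc (if b x then f x else h x)" "\<And>w. w < v \<Longrightarrow> \<sigma>2 w = \<sigma>1 w" "T2 \<le> g1 x + g2 x"
      proof (cases "b x")
        case True
        obtain \<sigma>' T where "exec (C1 v) \<sigma>1 = return_spmf (\<sigma>', T)" "\<sigma>' v = enc (f x)"
          "\<And>w. w < v \<Longrightarrow> \<sigma>' w = \<sigma>1 w" "T \<le> g1 x"
          using v1 by - (erule computesE[OF 1(2), where \<sigma> = \<sigma>1 and v = v], blast)
        then show ?thesis using True by (intro that[of \<sigma>' T]) auto
      next
        case False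
        obtain \<sigma>' T where "exec (C2 v) \<sigma>1 = return_spmf (\<sigma>', T)" "\<sigma>' v = enc (h x)"
          "\<And>w. w < v \<Longrightarrow> \<sigma>' w = \<sigma>1 w" "T \<le> g2 x"
          using v1 by - (erule computesE[OF 2(2), where \<sigma> = \<sigma>1 and v = v], blast)
        then show ?thesis using False by (intro that[of \<sigma>' T]) auto
      qed
      have "exec (C v) \<sigma> = return_spmf (\<sigma>2, 2 + (T1 + (2 + T2)))"
        unfolding C_def using s1 s2 by (cases "b x") (simp_all add: truthy_def)
      moreover have "\<sigma>2 w = \<sigma> w" if "w < v" for w
        using that s1(3)[of w] s2(3)[of w] by simp
      ultimately show "\<exists>\<sigma>' T. exec (C v) \<sigma> = return_spmf (\<sigma>', T) \<and>
          \<sigma>' v = enc (if b x then f x else h x) \<and> (\<forall>w<v. \<sigma>' w = \<sigma> w) \<and> T \<le> 4 + g0 x + g1 x + g2 x"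
        using s1 s2 by (intro exI) auto
    qed
  qed
qed

lemma polyt_not [polyt_intros]: "polyt b \<Longrightarrow> polyt (\<lambda>x. \<not> b x)"
  using polyt_If[of b, OF _ polyt_consts(3)[of False] polyt_consts(3)[of True]] by (simp add: if_bool_eq_conj)

lemma polyt_conj [polyt_intros]:
  assumes "polyt b" "polyt c"
  shows "polyt (\<lambda>x. b x \<and> c x)"
proof -
  have "(\<lambda>x. b x \<and> c x) = (\<lambda>x. if b x then c x else False)" by auto
  with polyt_If[OF assms polyt_consts(3)[of False]] show ?thesis by simp
qed

lemma polyt_nat_le [polyt_intros]:
  "polyt i \<Longrightarrow> polyt j \<Longrightarrow> polyt (\<lambda>x. i x \<le> (j x :: nat))"
  using polyt_not[OF polyt_arith_intros(8), of j i] by (simp add: not_less)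

lemma polyt_int_le [polyt_intros]:
  "polyt i \<Longrightarrow> polyt j \<Longrightarrow> polyt (\<lambda>x. i x \<le> (j x :: int))"
  using polyt_not[OF polyt_arith_intros(5), of j i] by (simp add: not_less)

lemma polyt_nat_eq [polyt_intros]:
  "polyt i \<Longrightarrow> polyt j \<Longrightarrow> polyt (\<lambda>x. i x = (j x :: nat))"
  using polyt_conj[OF polyt_nat_le polyt_nat_le, of i j j i] by (simp add: eq_iff)

lemma polyt_pair_eq [polyt_intros]:
  "polyt (\<lambda>x. fst (f x) = fst (h x)) \<Longrightarrow> polyt (\<lambda>x. snd (f x) = snd (h x)) \<Longrightarrow> polyt (\<lambda>x. f x = h x)"
  using polyt_conj[of "\<lambda>x. fst (f x) = fst (h x)" "\<lambda>x. snd (f x) = snd (h x)"]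
  by (simp add: prod_eq_iff)

lemma polyt_null [polyt_intros]: "polyt l \<Longrightarrow> polyt (\<lambda>x. l x = [])"
proof -
  assume "polyt l"
  then have "polyt (\<lambda>x. l x \<noteq> [])"
  proof (rule polyt_comp)
    show "polyt (\<lambda>l :: 'b list. l \<noteq> [])"
      by (rule polyt_expr[where E = "\<lambda>v. IsNode (Var v)" and g = "\<lambda>_. 2"])
         (auto intro!: pb_intros intro: pb_mono[OF pb_const[of 2]] sz_bool_le)
  qed
  from polyt_not[OF this] show ?thesis by simp
qed

text \<open>A total variant of \<open>hd\<close>: a program must agree with the function on every
  input, including the empty list.\<close>

definition head :: "'a \<Rightarrow> 'a list \<Rightarrow> 'a" where
  "head d xs = (case xs of [] \<Rightarrow> d | y # _ \<Rightarrow> y)"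

lemma head_simps [simp]: "head d [] = d" "head d (x # xs) = x"
  by (simp_all add: head_def)

text \<open>\<open>polyt_If\<close> would require both branches to be polynomial-time on all inputs,
  which fails to make sense for \<open>hd []\<close>. Here the expression \<open>E\<close> has to be
  right only on nonempty lists.\<close>

lemma polyt_If_null:
  fixes l :: "'a::enc \<Rightarrow> 'b::enc list" and d :: "'a \<Rightarrow> 'c::enc"
  assumes l: "polyt l" and d: "polyt d"
    and r: "\<And>v \<sigma> xs. \<sigma> v = enc xs \<Longrightarrow> xs \<noteq> [] \<Longrightarrow> value_of (E v) \<sigma> = enc (r xs)"
    and c: "\<And>v \<sigma>. expr_cost (E v) \<sigma> \<le> c" and s: "\<And>xs. xs \<noteq> [] \<Longrightarrow> sz (r xs) \<le> sz xs"
  shows "polyt (\<lambda>x. if l x = [] then d x else r (l x))"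
proof -
  obtain C1 g1 where 1: "pb g1" "computes C1 l g1" using l by (rule polytE)
  obtain C2 g2 where 2: "pb g2" "computes C2 d g2" using d by (rule polytE)
  define C where "C = (\<lambda>v. Seq (Assign (v + 1) (Var v)) (Seq (C1 (v + 1))
    (If (IsNode (Var (v + 1))) (Assign v (E (v + 1))) (C2 v))))"
  show ?thesis
  proof (rule polytI)
    have "pb (\<lambda>x. sz (d x) + sz (l x))"
      using assms by (auto intro!: pb_intros dest: polyt_pb)
    then show "pb (\<lambda>x. sz (if l x = [] then d x else r (l x)))"
      by (rule pb_mono) (auto intro: trans_le_add2 s)
    show "pb (\<lambda>x. 9 + c + g1 x + g2 x)"
      by (intro pb_intros 1 2)
    show "computes C (\<lambda>x. if l x = [] then d x else r (l x)) (\<lambda>x. 9 + c + g1 x + g2 x)"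
      unfolding computes_def
    proof (intro allI impI)
      fix v :: nat and \<sigma> :: store and x :: 'a assume v: "\<sigma> v = enc x"
      then have "(\<sigma>(v + 1 := \<sigma> v)) (v + 1) = enc x" by simp
      then obtain \<sigma>1 T1 where s1: "exec (C1 (v + 1)) (\<sigma>(v + 1 := \<sigma> v)) = return_spmf (\<sigma>1, T1)"
        "\<sigma>1 (v + 1) = enc (l x)" "\<And>w. w < v + 1 \<Longrightarrow> \<sigma>1 w = (\<sigma>(v + 1 := \<sigma> v)) w" "T1 \<le> g1 x"
        by - (erule computesE[OF 1(2), where \<sigma> = "\<sigma>(v + 1 := \<sigma> v)" and v = "v + 1"], blast)
      have v1: "\<sigma>1 v = enc x" using s1(3)[of v] v by simp
      obtain \<sigma>2 T2 where s2:
        "exec (if l x = [] then C2 v else Assign v (E (v + 1))) \<sigma>1 = return_spmf (\<sigma>2, T2)"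
        "\<sigma>2 v = enc (if l x = [] then d x else r (l x))" "\<And>w. w < v \<Longrightarrow> \<sigma>2 w = \<sigma>1 w"
        "T2 \<le> g2 x + 1 + c"
      proof (cases "l x = []")
        case True
        obtain \<sigma>' T where "exec (C2 v) \<sigma>1 = return_spmf (\<sigma>', T)" "\<sigma>' v = enc (d x)"
          "\<And>w. w < v \<Longrightarrow> \<sigma>' w = \<sigma>1 w" "T \<le> g2 x"
          using v1 by - (erule computesE[OF 2(2), where \<sigma> = \<sigma>1 and v = v], blast)
        then show ?thesis using True by (intro that[of \<sigma>' T]) auto
      next
        case False
        show ?thesis using r[where \<sigma> = \<sigma>1 and v = "v + 1", OF s1(2) False] c[of "v + 1" \<sigma>1]
          by (intro that[of "\<sigma>1(v := enc (r (l x)))" "1 + expr_cost (E (v + 1)) \<sigma>1"]) (auto simp: False)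
      qed
      have "exec (C v) \<sigma> = return_spmf (\<sigma>2, 2 + (T1 + (3 + T2)))"
        unfolding C_def using s1 s2 by (cases "l x = []") simp_all
      moreover have "\<sigma>2 w = \<sigma> w" if "w < v" for w
        using that s1(3)[of w] s2(3)[of w] by simp
      ultimately show "\<exists>\<sigma>' T. exec (C v) \<sigma> = return_spmf (\<sigma>', T) \<and>
          \<sigma>' v = enc (if l x = [] then d x else r (l x)) \<and> (\<forall>w<v. \<sigma>' w = \<sigma> w) \<and> T \<le> 9 + c + g1 x + g2 x"
        using s1 s2 by (intro exI) auto
    qed
  qed
qed

lemma polyt_head [polyt_intros]:
  assumes "polyt d" "polyt l"
  shows "polyt (\<lambda>x. head (d x) (l x))"
proof -
  have "polyt (\<lambda>x. if l x = [] then d x else hd (l x))"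
  proof (rule polyt_If_null[where E = "\<lambda>v. LeftOf (Var v)" and c = 2, OF assms(2,1)])
    fix xs :: "'b list" assume "xs \<noteq> []"
    then show "sz (hd xs) \<le> sz xs" by (cases xs) auto
  next
    fix v :: nat and \<sigma> :: store and xs :: "'b list" assume "\<sigma> v = enc xs" "xs \<noteq> []"
    then show "value_of (LeftOf (Var v)) \<sigma> = enc (hd xs)" by (cases xs) auto
  qed auto
  moreover have "(if l x = [] then d x else hd (l x)) = head (d x) (l x)" for x
    by (cases "l x") auto
  ultimately show ?thesis by simp
qed

lemma polyt_tl [polyt_intros]:
  assumes "polyt l"
  shows "polyt (\<lambda>x. tl (l x))"
proof -
  have "polyt (\<lambda>x. if l x = [] then [] else tl (l x))"
  proof (rule polyt_If_null[where E = "\<lambda>v. RightOf (Var v)" and c = 2, OF assms polyt_consts(4)])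
    fix xs :: "'b list" assume "xs \<noteq> []"
    then show "sz (tl xs) \<le> sz xs" by (cases xs) auto
  next
    fix v :: nat and \<sigma> :: store and xs :: "'b list" assume "\<sigma> v = enc xs" "xs \<noteq> []"
    then show "value_of (RightOf (Var v)) \<sigma> = enc (tl xs)" by (cases xs) auto
  qed auto
  moreover have "(if l x = [] then [] else tl (l x)) = tl (l x)" for x
    by (cases "l x") auto
  ultimately show ?thesis by simp
qed

section \<open>Folds as loops, and the list functions built from them\<close>

lemma while_spmf_return_False: "\<not> g s \<Longrightarrow> while_spmf g b s = return_spmf s"
  by (subst while_spmf.simps) simp

lemma while_spmf_return_True: "g s \<Longrightarrow> b s = return_spmf s' \<Longrightarrow> while_spmf g b s = while_spmf g b s'"
  by (subst while_spmf.simps) simp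

text \<open>Loop invariant: \<open>v\<close> holds the parameter, \<open>v + 1\<close> the remaining
  list, \<open>v + 2\<close> the accumulator, and the step function runs at \<open>v + 3\<close>.
  The guard works because exactly the nonempty lists are encoded by nodes. The cost of a step may
  depend on the accumulator, so \<open>G\<close> need only cover accumulators that actually occur;
  one round adds \<open>15\<close> to it.\<close>

lemma foldl_loop:
  fixes s :: "'x::enc \<Rightarrow> 'a::enc \<Rightarrow> 'y::enc \<Rightarrow> 'a" and C :: "nat \<Rightarrow> com"
  defines "B \<equiv> \<lambda>v. Seq (Assign (v + 3) (MkNode (MkNode (Var v) (Var (v + 2))) (LeftOf (Var (v + 1)))))
    (Seq (C (v + 3)) (Seq (Assign (v + 2) (Var (v + 3))) (Assign (v + 1) (RightOf (Var (v + 1))))))"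
  assumes C: "computes C (\<lambda>p. s (fst (fst p)) (snd (fst p)) (snd p)) g"
  assumes "\<sigma> v = enc x" "\<sigma> (v + 1) = enc ys" "\<sigma> (v + 2) = enc a"
    and "\<And>zs y rest. ys = zs @ y # rest \<Longrightarrow> g ((x, foldl (s x) a zs), y) \<le> G"
  shows "\<exists>\<sigma>' T'. while_spmf (\<lambda>(\<sigma>', T). truthy (value_of (IsNode (Var (v + 1))) \<sigma>'))
       (\<lambda>(\<sigma>', T). map_spmf (\<lambda>(\<sigma>'', T'). (\<sigma>'', T + T' + 1 + expr_cost (IsNode (Var (v + 1))) \<sigma>'')) (exec (B v) \<sigma>'))
       (\<sigma>, T) = return_spmf (\<sigma>', T') \<and> \<sigma>' (v + 2) = enc (foldl (s x) a ys) \<and>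
       (\<forall>w\<le>v. \<sigma>' w = \<sigma> w) \<and> T' \<le> T + length ys * (G + 20)"
  using assms(3-)
proof (induction ys arbitrary: a \<sigma> T)
  case Nil
  then show ?case
    by (intro exI[of _ \<sigma>] exI[of _ T]) (simp add: while_spmf_return_False truthy_def)
next
  case (Cons y ys)
  define \<sigma>0 where "\<sigma>0 = \<sigma>(v + 3 := enc ((x, a), y))"
  have "\<sigma>0 (v + 3) = enc ((x, a), y)" by (simp add: \<sigma>0_def)
  then obtain \<sigma>1 T1 where s1: "exec (C (v + 3)) \<sigma>0 = return_spmf (\<sigma>1, T1)"
    "\<sigma>1 (v + 3) = enc (s x a y)" "\<And>w. w < v + 3 \<Longrightarrow> \<sigma>1 w = \<sigma>0 w" "T1 \<le> g ((x, a), y)"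
    using computesE[OF C] by (metis fst_conv snd_conv)
  define \<sigma>2 where "\<sigma>2 = \<sigma>1(v + 2 := enc (s x a y), v + 1 := enc ys)"
  have s1v: "\<sigma>1 (Suc v) = Node (enc y) (enc ys)" using s1(3)[of "v + 1"] Cons.prems by (simp add: \<sigma>0_def)
  have \<sigma>0: "\<sigma>(v + 3 := Node (Node (enc x) (enc a)) (enc y)) = \<sigma>0"
    by (simp add: \<sigma>0_def)
  have body: "exec (B v) \<sigma> = return_spmf (\<sigma>2, 7 + (T1 + (2 + 3)))"
    unfolding B_def \<sigma>2_def using Cons.prems(1-3) s1(1,2) s1v
    using \<sigma>0 by (simp add: eval_nat_numeral)
  have "\<sigma>2 v = enc x" "\<sigma>2 (v + 1) = enc ys" "\<sigma>2 (v + 2) = enc (s x a y)"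
    using s1(3)[of v] Cons.prems by (auto simp: \<sigma>2_def \<sigma>0_def)
  moreover have "g ((x, foldl (s x) (s x a y) zs), y') \<le> G" if "ys = zs @ y' # rest" for zs y' rest
    using Cons.prems(4)[of "y # zs" y' rest] that by simp
  ultimately obtain \<sigma>' T' where IH: "while_spmf (\<lambda>(\<sigma>', T). truthy (value_of (IsNode (Var (v + 1))) \<sigma>'))
       (\<lambda>(\<sigma>', T). map_spmf (\<lambda>(\<sigma>'', T'). (\<sigma>'', T + T' + 1 + expr_cost (IsNode (Var (v + 1))) \<sigma>'')) (exec (B v) \<sigma>'))
       (\<sigma>2, T + (7 + (T1 + (2 + 3))) + 1 + 2) = return_spmf (\<sigma>', T')"
      "\<sigma>' (v + 2) = enc (foldl (s x) (s x a y) ys)" "\<forall>w\<le>v. \<sigma>' w = \<sigma>2 w"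
      "T' \<le> T + (7 + (T1 + (2 + 3))) + 1 + 2 + length ys * (G + 20)"
    using Cons.IH[of \<sigma>2 "s x a y" "T + (7 + (T1 + (2 + 3))) + 1 + 2"] by blast
  have "T1 \<le> G" using s1(4) Cons.prems(4)[of "[]" y ys] by simp
  then have "T' \<le> T + length (y # ys) * (G + 20)" using IH(4) by simp
  moreover have "\<forall>w\<le>v. \<sigma>' w = \<sigma> w"
    using IH(3) s1(3) by (auto simp: \<sigma>2_def \<sigma>0_def)
  moreover have "while_spmf (\<lambda>(\<sigma>', T). truthy (value_of (IsNode (Var (v + 1))) \<sigma>'))
       (\<lambda>(\<sigma>', T). map_spmf (\<lambda>(\<sigma>'', T'). (\<sigma>'', T + T' + 1 + expr_cost (IsNode (Var (v + 1))) \<sigma>'')) (exec (B v) \<sigma>'))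
       (\<sigma>, T) = return_spmf (\<sigma>', T')"
    unfolding IH(1)[symmetric]
    by (rule while_spmf_return_True) (use Cons.prems body in \<open>simp_all add: truthy_def\<close>)
  ultimately show ?case using IH(2)[folded foldl_Cons]
    by - (rule exI[of _ \<sigma>'], rule exI[of _ T'], intro conjI, assumption+)
qed

text \<open>A polynomial step alone is not enough, since an accumulator that doubles in every step
  becomes exponentially large. Hence the bound \<open>D\<close> on the accumulator after every
  prefix.\<close>

lemma polyt_foldl:
  fixes l :: "'a::enc \<Rightarrow> 'y::enc list" and i :: "'a \<Rightarrow> 'b::enc"
  assumes l: "polyt l" and i: "polyt i"
    and s: "polyt (\<lambda>p. s (fst (fst p)) (snd (fst p)) (snd p))"
    and D: "pb D" and bound: "\<And>x zs rest. l x = zs @ rest \<Longrightarrow> sz (foldl (s x) (i x) zs) \<le> D x"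
  shows "polyt (\<lambda>x. foldl (s x) (i x) (l x))"
proof -
  obtain Cl gl where l': "pb gl" "computes Cl l gl" using l by (rule polytE)
  obtain Ci gi where i': "pb gi" "computes Ci i gi" using i by (rule polytE)
  obtain C g where s': "pb g" "computes C (\<lambda>p. s (fst (fst p)) (snd (fst p)) (snd p)) g"
    using s by (rule polytE)
  obtain p where p: "\<And>y. g y \<le> poly p (sz y)" using s'(1) unfolding pb_def by blast
  define G where "G = (\<lambda>x. poly p (2 + sz x + D x + sz (l x)))"
  define B where "B = (\<lambda>v. Seq (Assign (v + 3) (MkNode (MkNode (Var v) (Var (v + 2))) (LeftOf (Var (v + 1)))))
    (Seq (C (v + 3)) (Seq (Assign (v + 2) (Var (v + 3))) (Assign (v + 1) (RightOf (Var (v + 1)))))))"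
  define P where "P = (\<lambda>v. Seq (Assign (v + 1) (Var v)) (Seq (Cl (v + 1)) (Seq (Assign (v + 2) (Var v))
    (Seq (Ci (v + 2)) (Seq (While (IsNode (Var (v + 1))) (B v)) (Assign v (Var (v + 2))))))))"
  show ?thesis
  proof (rule polytI)
    show "pb (\<lambda>x. sz (foldl (s x) (i x) (l x)))"
      by (rule pb_mono[OF D]) (rule bound[of _ _ "[]"], simp)
    show "pb (\<lambda>x. 10 + gl x + gi x + sz (l x) * (G x + 20))"
      unfolding G_def by (intro pb_intros l' i' D polyt_pb[OF l])
    show "computes P (\<lambda>x. foldl (s x) (i x) (l x)) (\<lambda>x. 10 + gl x + gi x + sz (l x) * (G x + 20))"
      unfolding computes_def
    proof (intro allI impI)
      fix v :: nat and \<sigma> :: store and x :: 'a assume v: "\<sigma> v = enc x"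
      then have "(\<sigma>(v + 1 := \<sigma> v)) (v + 1) = enc x" by simp
      then obtain \<sigma>1 T1 where s1: "exec (Cl (v + 1)) (\<sigma>(v + 1 := \<sigma> v)) = return_spmf (\<sigma>1, T1)"
        "\<sigma>1 (v + 1) = enc (l x)" "\<And>w. w < v + 1 \<Longrightarrow> \<sigma>1 w = (\<sigma>(v + 1 := \<sigma> v)) w" "T1 \<le> gl x"
        by - (erule computesE[OF l'(2), where \<sigma> = "\<sigma>(v + 1 := \<sigma> v)" and v = "v + 1"], blast)
      have "(\<sigma>1(v + 2 := \<sigma>1 v)) (v + 2) = enc x" using s1(3)[of v] v by simp
      then obtain \<sigma>2 T2 where s2: "exec (Ci (v + 2)) (\<sigma>1(v + 2 := \<sigma>1 v)) = return_spmf (\<sigma>2, T2)"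
        "\<sigma>2 (v + 2) = enc (i x)" "\<And>w. w < v + 2 \<Longrightarrow> \<sigma>2 w = (\<sigma>1(v + 2 := \<sigma>1 v)) w" "T2 \<le> gi x"
        by - (erule computesE[OF i'(2), where \<sigma> = "\<sigma>1(v + 2 := \<sigma>1 v)" and v = "v + 2"], blast)
      have v2: "\<sigma>2 v = enc x" "\<sigma>2 (v + 1) = enc (l x)"
        using s2(3)[of v] s1(3)[of v] v s2(3)[of "v + 1"] s1(2) by simp_all
      have bd: "g ((x, foldl (s x) (i x) zs), y) \<le> G x" if "l x = zs @ y # rest" for zs y rest
      proof -
        have "sz y \<le> sz (l x)" using that by (intro sz_member) simp
        then show ?thesis unfolding G_def
          using bound[OF that] by (intro order_trans[OF p] poly_nat_mono) simp
      qed
      have "\<exists>\<sigma>' T'. exec (While (IsNode (Var (v + 1))) (B v)) \<sigma>2 = return_spmf (\<sigma>', T') \<and>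
        \<sigma>' (v + 2) = enc (foldl (s x) (i x) (l x)) \<and> (\<forall>w\<le>v. \<sigma>' w = \<sigma>2 w) \<and>
        T' \<le> 1 + expr_cost (IsNode (Var (v + 1))) \<sigma>2 + length (l x) * (G x + 20)"
        unfolding B_def exec.simps(6) by (rule foldl_loop[OF s'(2) v2 s2(2) bd])
      then obtain \<sigma>3 T3 where s3: "exec (While (IsNode (Var (v + 1))) (B v)) \<sigma>2 = return_spmf (\<sigma>3, T3)"
        "\<sigma>3 (v + 2) = enc (foldl (s x) (i x) (l x))" "\<forall>w\<le>v. \<sigma>3 w = \<sigma>2 w"
        "T3 \<le> 1 + expr_cost (IsNode (Var (v + 1))) \<sigma>2 + length (l x) * (G x + 20)"
        by blast
      have "exec (P v) \<sigma> = return_spmf (\<sigma>3(v := \<sigma>3 (v + 2)), 2 + (T1 + (2 + (T2 + (T3 + 2)))))"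
        unfolding P_def
        by (intro exec_Seq_return[OF _ exec_Seq_return[OF s1(1) exec_Seq_return[OF _ exec_Seq_return[OF s2(1)
              exec_Seq_return[OF s3(1)]]]]]) simp_all
      moreover have "(\<sigma>3(v := \<sigma>3 (v + 2))) v = enc (foldl (s x) (i x) (l x))"
        using s3(2) by simp
      moreover have "\<forall>w<v. (\<sigma>3(v := \<sigma>3 (v + 2))) w = \<sigma> w"
        using s1(3) s2(3) s3(3) by simp
      moreover have "length (l x) * (G x + 20) \<le> sz (l x) * (G x + 20)"
        by (intro mult_right_mono length_le_sz) simp
      then have "2 + (T1 + (2 + (T2 + (T3 + 2)))) \<le> 10 + gl x + gi x + sz (l x) * (G x + 20)"
        using s1(4) s2(4) s3(4) unfolding expr_cost.simps by linarith
      ultimately show "\<exists>\<sigma>' T. exec (P v) \<sigma> = return_spmf (\<sigma>', T) \<and>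
          \<sigma>' v = enc (foldl (s x) (i x) (l x)) \<and>
          (\<forall>w<v. \<sigma>' w = \<sigma> w) \<and> T \<le> 10 + gl x + gi x + sz (l x) * (G x + 20)"
        by blast
    qed
  qed
qed

text \<open>If each step adds an amount that depends only on the parameter and the current entry,
  the accumulator stays polynomial automatically.\<close>

lemma polyt_foldl_add:
  fixes l :: "'a::enc \<Rightarrow> 'y::enc list" and i :: "'a \<Rightarrow> 'b::enc"
  assumes l: "polyt l" and i: "polyt i"
    and s: "polyt (\<lambda>p. s (fst (fst p)) (snd (fst p)) (snd p))"
    and D: "pb D" and bound: "\<And>x a y. sz (s x a y) \<le> sz a + D (x, y)"
  shows "polyt (\<lambda>x. foldl (s x) (i x) (l x))"
proof -
  obtain p where p: "\<And>y. D y \<le> poly p (sz y)" using D unfolding pb_def by blast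
  show ?thesis
  proof (rule polyt_foldl[OF l i s])
    show "pb (\<lambda>x. sz (i x) + sz (l x) * poly p (Suc (sz x + sz (l x))))"
      by (intro pb_intros polyt_pb[OF i] polyt_pb[OF l])
    fix x zs rest assume lx: "l x = zs @ rest"
    have *: "sz (foldl (s x) a zs) \<le> sz a + length zs * poly p (Suc (sz x + sz (l x)))"
      if "set zs \<subseteq> set (l x)" for a zs
      using that
    proof (induction zs arbitrary: a)
      case (Cons z zs)
      have "sz (s x a z) \<le> sz a + poly p (Suc (sz x + sz (l x)))"
        by (rule order_trans[OF bound], rule add_left_mono, rule order_trans[OF p], rule poly_nat_mono)
           (use Cons.prems sz_member[of z "l x"] in auto)
      then show ?case using Cons.IH[of "s x a z"] Cons.prems by simp
    qed simp
    have "length zs * poly p (Suc (sz x + sz (l x))) \<le> sz (l x) * poly p (Suc (sz x + sz (l x)))"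
      using length_le_sz[of "l x"] lx by (intro mult_right_mono) simp_all
    moreover have "set zs \<subseteq> set (l x)" using lx by auto
    ultimately show "sz (foldl (s x) (i x) zs) \<le> sz (i x) + sz (l x) * poly p (Suc (sz x + sz (l x)))"
      using *[of zs "i x"] by linarith
  qed
qed

lemma polyt_rev [polyt_intros]: "polyt l \<Longrightarrow> polyt (\<lambda>x. rev (l x))"
proof -
  assume "polyt l"
  then have "polyt (\<lambda>x. foldl (\<lambda>a y. y # a) [] (l x))"
    by (rule polyt_foldl_add[where D = "\<lambda>p. Suc (sz p)"])
       (auto intro!: polyt_intros pb_intros)
  moreover have "foldl (\<lambda>a y. y # a) a xs = rev xs @ a" for xs a :: "'b list"
    by (induction xs arbitrary: a) auto
  ultimately show ?thesis by simp
qed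

lemma polyt_append [polyt_intros]:
  assumes "polyt l" "polyt k"
  shows "polyt (\<lambda>x. l x @ k x)"
proof -
  have "polyt (\<lambda>x. foldl (\<lambda>a y. y # a) (k x) (rev (l x)))"
    by (rule polyt_foldl_add[where D = "\<lambda>p. Suc (sz p)"])
       (auto intro!: polyt_intros pb_intros assms)
  moreover have "foldl (\<lambda>a y. y # a) a xs = rev xs @ a" for xs a :: "'b list"
    by (induction xs arbitrary: a) auto
  ultimately show ?thesis by simp
qed

lemma polyt_map [polyt_intros]:
  fixes l :: "'a::enc \<Rightarrow> 'y::enc list" and h :: "'a \<Rightarrow> 'y \<Rightarrow> 'b::enc"
  assumes "polyt l" and h: "polyt (\<lambda>p. h (fst p) (snd p))"
  shows "polyt (\<lambda>x. map (h x) (l x))"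
proof -
  have h': "polyt (\<lambda>p :: ('a \<times> 'b list) \<times> 'y. h (fst (fst p)) (snd p))"
    by (rule polyt_comp2[OF h]) (intro polyt_intros)+
  have "polyt (\<lambda>x. foldl (\<lambda>a y. h x y # a) [] (rev (l x)))"
  proof (rule polyt_foldl_add[where D = "\<lambda>p. Suc (sz (h (fst p) (snd p)))"])
    show "polyt (\<lambda>p :: ('a \<times> 'b list) \<times> 'y. h (fst (fst p)) (snd p) # snd (fst p))"
      by (intro polyt_intros h')
  qed (auto intro!: polyt_intros pb_intros assms polyt_pb[OF h])
  moreover have "foldl (\<lambda>a y. h x y # a) a xs = map (h x) (rev xs) @ a" for x xs a
    by (induction xs arbitrary: a) auto
  ultimately show ?thesis by simp
qed

lemma polyt_filter [polyt_intros]: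
  fixes l :: "'a::enc \<Rightarrow> 'y::enc list"
  assumes "polyt l" and h: "polyt (\<lambda>p. h (fst p) (snd p))"
  shows "polyt (\<lambda>x. filter (h x) (l x))"
proof -
  have h': "polyt (\<lambda>p :: ('a \<times> 'y list) \<times> 'y. h (fst (fst p)) (snd p))"
    by (rule polyt_comp2[OF h]) (intro polyt_intros)+
  have "polyt (\<lambda>x. foldl (\<lambda>a y. if h x y then y # a else a) [] (rev (l x)))"
  proof (rule polyt_foldl_add[where D = "\<lambda>p. Suc (sz p)"])
    show "polyt (\<lambda>p :: ('a \<times> 'y list) \<times> 'y. if h (fst (fst p)) (snd p) then snd p # snd (fst p) else snd (fst p))"
      by (intro polyt_intros h')
  qed (auto intro!: polyt_intros pb_intros assms)
  moreover have "foldl (\<lambda>a y. if h x y then y # a else a) a xs = filter (h x) (rev xs) @ a" for x xs a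
    by (induction xs arbitrary: a) auto
  ultimately show ?thesis by simp
qed

lemma polyt_concat [polyt_intros]:
  fixes l :: "'a::enc \<Rightarrow> 'y::enc list list"
  assumes "polyt l"
  shows "polyt (\<lambda>x. concat (l x))"
proof -
  have "polyt (\<lambda>x. foldl (\<lambda>a y. y @ a) [] (rev (l x)))"
  proof (rule polyt_foldl_add[where D = "\<lambda>p. sz p"])
    fix a y :: "'y list" and x :: 'a
    show "sz (y @ a) \<le> sz a + sz (x, y)" using sz_append_le[of y a] by simp
  qed (auto intro!: polyt_intros pb_intros assms)
  moreover have "foldl (\<lambda>a y. y @ a) a xs = concat (rev xs) @ a" for xs and a :: "'y list"
    by (induction xs arbitrary: a) auto
  ultimately show ?thesis by simp
qed

lemma polyt_sum_list_int [polyt_intros]: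
  fixes l :: "'a::enc \<Rightarrow> int list"
  assumes "polyt l"
  shows "polyt (\<lambda>x. sum_list (l x))"
proof -
  have "polyt (\<lambda>x. foldl (\<lambda>a y. a + y) 0 (l x))"
  proof (rule polyt_foldl_add[where D = "\<lambda>p. sz p"])
    fix a y :: int and x :: 'a
    show "sz (a + y) \<le> sz a + sz (x, y)" using bits_add_le[of a y] by simp
  qed (auto intro!: polyt_intros pb_intros assms)
  moreover have "foldl (\<lambda>a y. a + y) a xs = a + sum_list xs" for xs and a :: int
    by (induction xs arbitrary: a) auto
  ultimately show ?thesis by simp
qed

text \<open>Bit lengths add up under multiplication, so even a long product grows by at most the
  size of the next factor per step.\<close>

lemma polyt_prod_list_int [polyt_intros]:
  fixes l :: "'a::enc \<Rightarrow> int list"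
  assumes "polyt l"
  shows "polyt (\<lambda>x. prod_list (l x))"
proof -
  have "polyt (\<lambda>x. foldl (\<lambda>a y. a * y) 1 (l x))"
  proof (rule polyt_foldl_add[where D = "\<lambda>p. sz p"])
    fix a y :: int and x :: 'a
    show "sz (a * y) \<le> sz a + sz (x, y)" using bits_mult_le[of a y] by simp
  qed (auto intro!: polyt_intros pb_intros assms)
  moreover have "foldl (\<lambda>a y. a * y) a xs = a * prod_list xs" for xs and a :: int
    by (induction xs arbitrary: a) auto
  ultimately show ?thesis by simp
qed

lemma polyt_Suc [polyt_intros]: "polyt n \<Longrightarrow> polyt (\<lambda>x. Suc (n x))"
  using polyt_arith_intros(6)[OF polyt_consts(1)[of 1], of n] by simp

lemma polyt_length [polyt_intros]:
  fixes l :: "'a::enc \<Rightarrow> 'y::enc list"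
  assumes "polyt l"
  shows "polyt (\<lambda>x. length (l x))"
proof -
  have "polyt (\<lambda>x. foldl (\<lambda>a y. a + 1) (0 :: nat) (l x))"
  proof (rule polyt_foldl_add[where D = "\<lambda>_. 2"])
    fix a :: nat
    show "sz (a + 1) \<le> sz a + 2" using bits_add_le[of "int a" 1] by (simp add: add.commute)
  qed (auto intro!: polyt_intros pb_intros assms)
  moreover have "foldl (\<lambda>a y. a + 1) a xs = a + length xs" for xs :: "'y list" and a :: nat
    by (induction xs arbitrary: a) auto
  ultimately show ?thesis by simp
qed

lemma sz_upt_le: "sz [0..<n] \<le> 1 + n * (2 + n)"
proof -
  have "sz [0..<n] \<le> 1 + length [0..<n] * (1 + (1 + n))"
  proof (rule sz_list_le)
    fix i assume "i \<in> set [0..<n]"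
    then show "sz i \<le> 1 + n" using bits_int_le[of i] by simp
  qed
  then show ?thesis by simp
qed

text \<open>Ranges are available only up to the length of a list; up to a number in binary they
  would be exponentially long.\<close>

lemma polyt_upt_length [polyt_intros]:
  fixes l :: "'a::enc \<Rightarrow> 'y::enc list"
  assumes "polyt l"
  shows "polyt (\<lambda>x. [0..<length (l x)])"
proof -
  have foldl: "foldl (\<lambda>a y. a @ [length a]) [] xs = [0..<length xs]" for xs :: "'y list"
    by (induction xs rule: rev_induct) auto
  \<comment> \<open>The appended number depends on the accumulator, so the additive rule does not
    apply and the prefixes are bounded directly.\<close>
  have "polyt (\<lambda>x. foldl (\<lambda>a y. a @ [length a]) [] (l x))"
  proof (rule polyt_foldl[where D = "\<lambda>x. 1 + sz (l x) * (2 + sz (l x))"])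
    fix x zs rest assume lx: "l x = zs @ rest"
    have "length zs \<le> sz (l x)" using length_le_sz[of "l x"] lx by simp
    then have "length zs * (2 + length zs) \<le> sz (l x) * (2 + sz (l x))"
      by (intro mult_mono) auto
    with sz_upt_le[of "length zs"]
    show "sz (foldl (\<lambda>a y. a @ [length a]) [] zs) \<le> 1 + sz (l x) * (2 + sz (l x))"
      unfolding foldl by linarith
  qed (intro polyt_intros pb_intros polyt_pb assms)+
  then show ?thesis unfolding foldl .
qed

text \<open>The fold runs over the list and not over the binary number \<open>n\<close>: it counts
  the entries read and collects, in reverse, those from position \<open>n\<close> on.\<close>

lemma polyt_drop [polyt_intros]:
  fixes l :: "'a::enc \<Rightarrow> 'y::enc list"
  assumes "polyt l" and n: "polyt n"
  shows "polyt (\<lambda>x. drop (n x) (l x))"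
proof -
  define s :: "nat \<Rightarrow> nat \<times> 'y list \<Rightarrow> 'y \<Rightarrow> nat \<times> 'y list" where
    "s = (\<lambda>n a y. (fst a + 1, if fst a < n then snd a else y # snd a))"
  have foldl: "foldl (s n) (0, []) xs = (length xs, rev (drop n xs))" for xs :: "'y list" and n
    by (induction xs rule: rev_induct) (auto simp: s_def)
  have s: "polyt (\<lambda>p :: ('a \<times> nat \<times> 'y list) \<times> 'y. s (n (fst (fst p))) (snd (fst p)) (snd p))"
  proof -
    have "polyt (\<lambda>p :: ('a \<times> nat \<times> 'y list) \<times> 'y. n (fst (fst p)))"
      by (rule polyt_comp[OF _ n]) (intro polyt_intros)
    then show ?thesis unfolding s_def by (intro polyt_intros)
  qed
  have "polyt (\<lambda>x. foldl (s (n x)) (0, []) (l x))"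
  proof (rule polyt_foldl_add[where D = "\<lambda>x. 3 + sz x", OF assms(1) _ s])
    fix a :: "nat \<times> 'y list" and y and x :: 'a
    show "sz (s (n x) a y) \<le> sz a + (3 + sz (x, y))"
      using bits_add_le[of "int (fst a)" 1] by (cases a) (simp add: s_def add.commute)
  qed (intro polyt_intros pb_intros)+
  from polyt_rev[OF polyt_snd[OF this]] show ?thesis
    unfolding foldl by simp
qed

lemma polyt_count_list_nat_pair [polyt_intros]:
  fixes l :: "'a::enc \<Rightarrow> (nat \<times> nat) list"
  assumes "polyt l" "polyt f"
  shows "polyt (\<lambda>x. count_list (l x) (f x))"
proof -
  have f': "polyt (\<lambda>p :: 'a \<times> (nat \<times> nat). f (fst p))"
    by (rule polyt_comp[OF _ assms(2)]) (intro polyt_intros)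
  have "polyt (\<lambda>x. length (filter (\<lambda>y. f x = y) (l x)))"
    by (intro polyt_intros assms f')
  then show ?thesis by (simp add: count_list_eq_length_filter)
qed

lemma polyt_count_list_nat [polyt_intros]:
  fixes l :: "'a::enc \<Rightarrow> nat list"
  assumes "polyt l" "polyt f"
  shows "polyt (\<lambda>x. count_list (l x) (f x))"
proof -
  have f': "polyt (\<lambda>p :: 'a \<times> nat. f (fst p))"
    by (rule polyt_comp[OF _ assms(2)]) (intro polyt_intros)
  have "polyt (\<lambda>x. length (filter (\<lambda>y. f x = y) (l x)))"
    by (intro polyt_intros assms f')
  then show ?thesis by (simp add: count_list_eq_length_filter)
qed

lemma polyt_member_nat [polyt_intros]:
  fixes l :: "'a::enc \<Rightarrow> nat list"
  assumes "polyt f" "polyt l"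
  shows "polyt (\<lambda>x. f x \<in> set (l x))"
proof -
  have "polyt (\<lambda>x. \<not> count_list (l x) (f x) \<le> 0)"
    by (intro polyt_intros assms)
  then show ?thesis by (simp add: count_list_0_iff)
qed

lemma polyt_Bex_set [polyt_intros]:
  fixes l :: "'a::enc \<Rightarrow> 'y::enc list"
  assumes "polyt l" "polyt (\<lambda>p. h (fst p) (snd p))"
  shows "polyt (\<lambda>x. \<exists>y\<in>set (l x). h x y)"
proof -
  have "polyt (\<lambda>x. \<not> filter (h x) (l x) = [])"
    by (intro polyt_intros assms)
  then show ?thesis by (simp add: filter_empty_conv)
qed

text \<open>The program may depend on the fixed list; this provides the constant number of
  repetitions in \<open>trials\<close>.\<close>

lemma polyt_const_list: "(\<And>y. y \<in> set ys \<Longrightarrow> polyt (\<lambda>_ :: 'a::enc. y)) \<Longrightarrow> polyt (\<lambda>_ :: 'a. ys)"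
  by (induction ys) (auto intro!: polyt_intros)

fun argmin :: "('a \<Rightarrow> int) \<Rightarrow> 'a \<Rightarrow> 'a list \<Rightarrow> 'a" where
  "argmin g d [] = d"
| "argmin g d (y # ys) = foldl (\<lambda>a z. if g z < g a then z else a) y ys"

lemma foldl_argmin_in: "foldl (\<lambda>a z. if g z < g a then z else a) y ys \<in> insert y (set ys)"
proof (induction ys arbitrary: y)
  case (Cons a ys)
  then show ?case using Cons[of "if g a < g y then a else y"] by (auto split: if_splits)
qed simp

lemma argmin_in: "xs \<noteq> [] \<Longrightarrow> argmin g d xs \<in> set xs"
  by (cases xs) (use foldl_argmin_in in fastforce)+

lemma argmin_le: "y \<in> set xs \<Longrightarrow> g (argmin g d xs) \<le> g y"
proof (cases xs)
  case (Cons x ys)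
  have "g (foldl (\<lambda>a z. if g z < g a then z else a) x ys) \<le> g y" if "y \<in> insert x (set ys)" for x y
    using that
  proof (induction ys arbitrary: x y)
    case (Cons a ys)
    have "g (foldl (\<lambda>a z. if g z < g a then z else a) (if g a < g x then a else x) ys)
        \<le> min (g a) (min (g x) (if y \<in> set ys then g y else g x))"
      using Cons.IH[of "if g a < g x then a else x" "if g a < g x then a else x"]
        Cons.IH[of y "if g a < g x then a else x"] by auto
    with Cons.prems show ?case by (auto split: if_splits)
  qed simp
  then show "y \<in> set xs \<Longrightarrow> ?thesis" using Cons by auto
qed auto

lemma polyt_argmin [polyt_intros]:
  fixes l :: "'a::enc \<Rightarrow> 'y::enc list"
  assumes "polyt (\<lambda>p. g (fst p) (snd p))" and d: "polyt d" and l: "polyt l"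
  shows "polyt (\<lambda>x. argmin (g x) (d x) (l x))"
proof -
  have eq: "argmin (g x) (d x) (l x) =
      foldl (\<lambda>a z. if g x z < g x a then z else a) (head (d x) (l x)) (tl (l x))" for x
    by (cases "l x") auto
  have g1: "polyt (\<lambda>p :: ('a \<times> 'y) \<times> 'y. g (fst (fst p)) (snd p))"
    by (rule polyt_comp2[OF assms(1)]) (intro polyt_intros)+
  have g2: "polyt (\<lambda>p :: ('a \<times> 'y) \<times> 'y. g (fst (fst p)) (snd (fst p)))"
    by (rule polyt_comp2[OF assms(1)]) (intro polyt_intros)+
  show ?thesis unfolding eq
  proof (rule polyt_foldl[where D = "\<lambda>x. sz (d x) + sz (l x)"])
    show "polyt (\<lambda>p :: ('a \<times> 'y) \<times> 'y. if g (fst (fst p)) (snd p) < g (fst (fst p)) (snd (fst p))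
        then snd p else snd (fst p))"
      by (intro polyt_intros g1 g2)
    fix x zs rest assume tl: "tl (l x) = zs @ rest"
    have "foldl (\<lambda>a z. if g x z < g x a then z else a) (head (d x) (l x)) zs
        \<in> insert (head (d x) (l x)) (set zs)"
      by (rule foldl_argmin_in)
    also have "\<dots> \<subseteq> insert (d x) (set (l x))"
      using tl by (cases "l x") auto
    finally show "sz (foldl (\<lambda>a z. if g x z < g x a then z else a) (head (d x) (l x)) zs) \<le> sz (d x) + sz (l x)"
      using sz_member by fastforce
  qed (intro polyt_intros l d pb_intros polyt_pb)+
qed

section \<open>The algorithm\<close>

lemma polyt_comp5:
  assumes "polyt (\<lambda>p. h (fst p) (fst (snd p)) (fst (snd (snd p))) (fst (snd (snd (snd p)))) (snd (snd (snd (snd p)))))"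
    "polyt f" "polyt g" "polyt k" "polyt l" "polyt m"
  shows "polyt (\<lambda>x. h (f x) (g x) (k x) (l x) (m x))"
  using polyt_comp[OF polyt_Pair[OF assms(2) polyt_Pair[OF assms(3) polyt_Pair[OF assms(4)
    polyt_Pair[OF assms(5,6)]]]] assms(1)]
  by simp

type_synonym frac_col = "(nat \<times> nat list) list"

text \<open>A fractional colouring lists, for every element, \<open>T\<close> colours with repetition; the weight
  of a colour is its multiplicity divided by \<open>T\<close>. Everything below is scaled to integers:
  \<open>coef\<close> by \<open>T ^ n\<close> and \<open>resid\<close> by \<open>T ^ (n + 1)\<close>.\<close>

definition prodw :: "nat \<Rightarrow> frac_col \<Rightarrow> nat \<Rightarrow> nat list \<Rightarrow> int" where
  "prodw T x l S =
     prod_list (map (\<lambda>e. if fst e \<in> set S then int T - int (count_list (snd e) l) else int T) x)"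

lemma polyt_prodw [polyt_intros]:
  "polyt f \<Longrightarrow> polyt g \<Longrightarrow> polyt h \<Longrightarrow> polyt i \<Longrightarrow> polyt (\<lambda>x. prodw (f x) (g x) (h x) (i x))"
  by (erule (3) polyt_comp4[rotated]) (unfold prodw_def, intro polyt_intros)

text \<open>The scaled partial derivative, in the weight of colour \<open>l\<close> at element
  \<open>j\<close>, of the multilinear extension; see \<open>real_coef\<close>.\<close>

definition coef :: "nat \<Rightarrow> frac_col \<Rightarrow> nat list list \<Rightarrow> nat \<Rightarrow> nat \<Rightarrow> int" where
  "coef T x F j l =
     sum_list (map (\<lambda>S. prodw T x l (filter (\<lambda>i. \<not> i = j) S)) (filter (\<lambda>S. j \<in> set S) F))"

lemma polyt_coef [polyt_intros]:
  "polyt f \<Longrightarrow> polyt g \<Longrightarrow> polyt h \<Longrightarrow> polyt i \<Longrightarrow> polyt j \<Longrightarrow>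
    polyt (\<lambda>x. coef (f x) (g x) (h x) (i x) (j x))"
  by (erule (4) polyt_comp5[rotated]) (unfold coef_def, intro polyt_intros)

text \<open>The denominator, the current point, and for each free element its index, its present
  colours and the colours that the face still allows.\<close>

type_synonym problem = "nat \<times> frac_col \<times> (nat \<times> nat list \<times> nat list) list"

text \<open>The pair \<open>s\<close> holds the picks made so far and the number of rounds. The
  value is the scaled gap, in coordinate \<open>(F, l)\<close>, between the effect of these picks
  and the effect of as many rounds at the current weights.\<close>

definition resid :: "problem \<Rightarrow> (nat \<times> nat) list \<times> nat \<Rightarrow> nat list list \<Rightarrow> nat \<Rightarrow> int" where
  "resid q s F l = sum_list (map (\<lambda>e. coef (fst q) (fst (snd q)) F (fst e) l *
     (int (fst q) * int (count_list (fst s) (fst e, l)) - int (snd s) * int (count_list (fst (snd e)) l)))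
     (snd (snd q)))"

lemma polyt_resid [polyt_intros]:
  "polyt f \<Longrightarrow> polyt g \<Longrightarrow> polyt h \<Longrightarrow> polyt i \<Longrightarrow> polyt (\<lambda>x. resid (f x) (g x) (h x) (i x))"
  by (erule (3) polyt_comp4[rotated]) (unfold resid_def, intro polyt_intros)

text \<open>The inner product of the residual with the vector of the choice \<open>l\<close> for
  \<open>j\<close>; that vector is supported on the coordinates \<open>(F, l)\<close>, so one sum
  over \<open>Fs\<close> suffices.\<close>

definition score :: "problem \<Rightarrow> (nat \<times> nat) list \<times> nat \<Rightarrow> nat list list list \<Rightarrow> nat \<Rightarrow> nat \<Rightarrow> int" where
  "score q s Fs j l = sum_list (map (\<lambda>F. resid q s F l * coef (fst q) (fst (snd q)) F j l) Fs)"

lemma polyt_score [polyt_intros]: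
  "polyt f \<Longrightarrow> polyt g \<Longrightarrow> polyt h \<Longrightarrow> polyt i \<Longrightarrow> polyt j \<Longrightarrow>
    polyt (\<lambda>x. score (f x) (g x) (h x) (i x) (j x))"
  by (erule (4) polyt_comp5[rotated]) (unfold score_def, intro polyt_intros)

definition greedy_round :: "problem \<Rightarrow> nat list list list \<Rightarrow> (nat \<times> nat) list \<times> nat \<Rightarrow> (nat \<times> nat) list" where
  "greedy_round q Fs s =
     map (\<lambda>e. (fst e, argmin (\<lambda>l. score q s Fs (fst e) l) 0 (snd (snd e)))) (snd (snd q))"

lemma polyt_greedy_round [polyt_intros]:
  "polyt f \<Longrightarrow> polyt g \<Longrightarrow> polyt h \<Longrightarrow> polyt (\<lambda>x. greedy_round (f x) (g x) (h x))"
  by (erule (2) polyt_comp3[rotated]) (unfold greedy_round_def, intro polyt_intros)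

lemma head_in_insert: "head d xs \<in> insert d (set xs)"
  by (cases xs) auto

lemma argmin_in_insert: "argmin g d xs \<in> insert d (set xs)"
  using argmin_in[of xs g d] by (cases "xs = []") auto

text \<open>The picks are copied from the problem, so their size does not depend on the history
  \<open>s\<close>. This makes the fold over all rounds additive.\<close>

lemma sz_greedy_round_le: "sz (greedy_round q Fs s) \<le> 1 + sz q * (3 + 2 * sz q)"
proof -
  let ?es = "snd (snd q)"
  have es: "sz ?es \<le> sz q" by (simp add: sz_prod_eq[of q] sz_prod_eq[of "snd q"])
  have "sz (greedy_round q Fs s) \<le> 1 + length (greedy_round q Fs s) * (1 + (2 + 2 * sz q))"
  proof (rule sz_list_le)
    fix d assume "d \<in> set (greedy_round q Fs s)"
    then obtain e where e: "e \<in> set ?es" and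
      d: "d = (fst e, argmin (\<lambda>l. score q s Fs (fst e) l) 0 (snd (snd e)))"
      unfolding greedy_round_def by auto
    have "sz e \<le> sz q" using sz_member[OF e] es by linarith
    then have "sz (fst e) \<le> sz q" "sz (snd (snd e)) \<le> sz q"
      by (simp_all add: sz_prod_eq[of e] sz_prod_eq[of "snd e"])
    moreover have "sz (snd d) \<le> 1 + sz (snd (snd e))"
      using argmin_in_insert[of "\<lambda>l. score q s Fs (fst e) l" 0 "snd (snd e)"]
        sz_member[of "snd d" "snd (snd e)"] d by auto
    ultimately show "sz d \<le> 2 + 2 * sz q" unfolding sz_prod_eq[of d] using d by simp
  qed
  also have "length (greedy_round q Fs s) * (1 + (2 + 2 * sz q)) \<le> sz q * (1 + (2 + 2 * sz q))"
    using length_le_sz[of ?es] es by (intro mult_right_mono) (simp_all add: greedy_round_def)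
  finally show ?thesis by (simp add: algebra_simps)
qed

definition greedy_rounds :: "problem \<Rightarrow> nat list list list \<Rightarrow> nat list \<Rightarrow> (nat \<times> nat) list" where
  "greedy_rounds q Fs ts = foldl (\<lambda>D t. greedy_round q Fs (D, t) @ D) [] ts"

lemma polyt_greedy_rounds [polyt_intros]:
  "polyt f \<Longrightarrow> polyt g \<Longrightarrow> polyt h \<Longrightarrow> polyt (\<lambda>x. greedy_rounds (f x) (g x) (h x))"
proof (erule (2) polyt_comp3[rotated])
  let ?P = "\<lambda>p :: problem \<times> nat list list list \<times> nat list.
    foldl (\<lambda>D t. greedy_round (fst p) (fst (snd p)) (D, t) @ D) [] (snd (snd p))"
  have "polyt ?P"
  proof (rule polyt_foldl_add[where D = "\<lambda>p. 1 + sz p * (3 + 2 * sz p)"])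
    fix p :: "problem \<times> nat list list list \<times> nat list" and D :: "(nat \<times> nat) list" and t :: nat
    have "sz (fst p) \<le> sz (p, t)" by (simp add: sz_prod_eq[of p])
    then have "sz (fst p) * (3 + 2 * sz (fst p)) \<le> sz (p, t) * (3 + 2 * sz (p, t))"
      by (intro mult_mono add_mono) simp_all
    then show "sz (greedy_round (fst p) (fst (snd p)) (D, t) @ D)
        \<le> sz D + (1 + sz (p, t) * (3 + 2 * sz (p, t)))"
      using sz_append_le[of "greedy_round (fst p) (fst (snd p)) (D, t)" D]
        sz_greedy_round_le[of "fst p" "fst (snd p)" "(D, t)"] by linarith
  qed (intro polyt_intros pb_intros)+
  then show "polyt (\<lambda>p :: problem \<times> nat list list list \<times> nat list.
      greedy_rounds (fst p) (fst (snd p)) (snd (snd p)))"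
    unfolding greedy_rounds_def .
qed

definition sq_resid :: "problem \<Rightarrow> (nat \<times> nat) list \<times> nat \<Rightarrow> nat list list list \<Rightarrow> nat list \<Rightarrow> int" where
  "sq_resid q s Fs cl = sum_list (map (\<lambda>F. sum_list (map (\<lambda>l. resid q s F l * resid q s F l) cl)) Fs)"

lemma polyt_sq_resid [polyt_intros]:
  "polyt f \<Longrightarrow> polyt g \<Longrightarrow> polyt h \<Longrightarrow> polyt i \<Longrightarrow> polyt (\<lambda>x. sq_resid (f x) (g x) (h x) (i x))"
  by (erule (3) polyt_comp4[rotated]) (unfold sq_resid_def, intro polyt_intros)

section \<open>Independent elements, candidate faces and one improvement\<close>

definition fractional :: "nat \<times> nat list \<Rightarrow> bool" where
  "fractional e \<longleftrightarrow> (\<exists>c\<in>set (snd e). \<not> c = head 0 (snd e))"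

lemma polyt_fractional [polyt_intros]: "polyt f \<Longrightarrow> polyt (\<lambda>x. fractional (f x))"
  by (erule polyt_comp) (unfold fractional_def, intro polyt_intros)

definition conflict :: "nat list list \<Rightarrow> nat list \<Rightarrow> nat \<Rightarrow> bool" where
  "conflict Ss I j \<longleftrightarrow> (\<exists>S\<in>set Ss. j \<in> set S \<and> (\<exists>i\<in>set I. i \<in> set S))"

lemma polyt_conflict [polyt_intros]:
  "polyt f \<Longrightarrow> polyt g \<Longrightarrow> polyt h \<Longrightarrow> polyt (\<lambda>x. conflict (f x) (g x) (h x))"
  by (erule (2) polyt_comp3[rotated]) (unfold conflict_def, intro polyt_intros)

definition indep_add :: "nat list list \<Rightarrow> nat list \<Rightarrow> nat \<times> nat list \<Rightarrow> nat list" where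
  "indep_add Ss I e = (if fractional e \<and> \<not> conflict Ss I (fst e) then fst e # I else I)"

definition indep :: "nat list list \<Rightarrow> frac_col \<Rightarrow> nat list" where
  "indep Ss x = foldl (indep_add Ss) [] x"

lemma polyt_indep [polyt_intros]: "polyt f \<Longrightarrow> polyt g \<Longrightarrow> polyt (\<lambda>x. indep (f x) (g x))"
proof (erule (1) polyt_comp2[rotated], unfold indep_def,
    rule polyt_foldl_add[where D = "\<lambda>p. Suc (sz p)"])
  fix x :: "nat list list \<times> frac_col" and a and y :: "nat \<times> nat list"
  show "sz (indep_add (fst x) a y) \<le> sz a + Suc (sz (x, y))"
    by (cases y) (simp add: indep_add_def)
qed (unfold indep_add_def, (intro polyt_intros pb_intros)+)

text \<open>The range \<open>[0..<T]\<close>, which gives the denominator in unary, the list of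
  colours, the number of size tokens, and the families.\<close>

type_synonym params = "nat list \<times> nat list \<times> nat \<times> nat list list list"

text \<open>A candidate \<open>c\<close> names an element and a colour. Forbidding that colour for
  that element describes a facet of the product of simplices.\<close>

definition entries :: "nat list \<Rightarrow> frac_col \<Rightarrow> nat \<times> nat \<Rightarrow> (nat \<times> nat list \<times> nat list) list" where
  "entries I x c =
     map (\<lambda>e. (fst e, snd e, filter (\<lambda>l. \<not> (fst e = fst c \<and> l = snd c)) (snd e)))
       (filter (\<lambda>e. fst e \<in> set I) x)"

lemma polyt_entries [polyt_intros]:
  "polyt f \<Longrightarrow> polyt g \<Longrightarrow> polyt h \<Longrightarrow> polyt (\<lambda>x. entries (f x) (g x) (h x))"
  by (erule (2) polyt_comp3[rotated]) (unfold entries_def, intro polyt_intros)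

text \<open>The unscaled test is that the squared residual is at most \<open>T * u ^ 4\<close>: by
  \<open>greedy_residual\<close> it is at most \<open>T\<close> times the number of coordinates, at
  most \<open>u ^ 2\<close>, times the square of a step of length at most \<open>u\<close>.\<close>

definition accept :: "params \<Rightarrow> problem \<Rightarrow> (nat \<times> nat) list \<Rightarrow> bool" where
  "accept w q D \<longleftrightarrow>
     sq_resid q (D, fst q) (snd (snd (snd w))) (fst (snd w)) \<le>
       prod_list (map (\<lambda>e. int (fst q) * int (fst q)) (fst (snd q))) * (int (fst q) * int (fst q)) * int (fst q) *
       (int (fst (snd (snd w))) * int (fst (snd (snd w))) * int (fst (snd (snd w))) * int (fst (snd (snd w))))"

lemma polyt_accept [polyt_intros]:
  "polyt f \<Longrightarrow> polyt g \<Longrightarrow> polyt h \<Longrightarrow> polyt (\<lambda>x. accept (f x) (g x) (h x))"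
  by (erule (2) polyt_comp3[rotated]) (unfold accept_def, intro polyt_intros)

text \<open>After \<open>T\<close> rounds every free element has received \<open>T\<close> picks,
  which are again a list of colours with denominator \<open>T\<close>.\<close>

definition replace :: "nat list \<Rightarrow> frac_col \<Rightarrow> (nat \<times> nat) list \<Rightarrow> frac_col" where
  "replace I x D =
     map (\<lambda>e. (fst e, if fst e \<in> set I then map snd (filter (\<lambda>d. fst d = fst e) D) else snd e)) x"

lemma polyt_replace [polyt_intros]:
  "polyt f \<Longrightarrow> polyt g \<Longrightarrow> polyt h \<Longrightarrow> polyt (\<lambda>x. replace (f x) (g x) (h x))"
  by (erule (2) polyt_comp3[rotated]) (unfold replace_def, intro polyt_intros)

definition problem_of :: "params \<Rightarrow> frac_col \<Rightarrow> nat \<times> nat \<Rightarrow> problem" where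
  "problem_of w x c = (length (fst w), x, entries (indep (concat (snd (snd (snd w)))) x) x c)"

lemma polyt_problem_of [polyt_intros]:
  "polyt f \<Longrightarrow> polyt g \<Longrightarrow> polyt h \<Longrightarrow> polyt (\<lambda>x. problem_of (f x) (g x) (h x))"
  by (erule (2) polyt_comp3[rotated]) (unfold problem_of_def, intro polyt_intros)

definition picks :: "params \<Rightarrow> frac_col \<Rightarrow> nat \<times> nat \<Rightarrow> (nat \<times> nat) list" where
  "picks w x c = greedy_rounds (problem_of w x c) (snd (snd (snd w))) (fst w)"

lemma polyt_picks [polyt_intros]:
  "polyt f \<Longrightarrow> polyt g \<Longrightarrow> polyt h \<Longrightarrow> polyt (\<lambda>x. picks (f x) (g x) (h x))"
  by (erule (2) polyt_comp3[rotated]) (unfold picks_def, intro polyt_intros)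

definition attempt :: "params \<Rightarrow> frac_col \<Rightarrow> nat \<times> nat \<Rightarrow> bool \<times> frac_col" where
  "attempt w x c =
     (accept w (problem_of w x c) (picks w x c),
      replace (indep (concat (snd (snd (snd w)))) x) x (picks w x c))"

lemma polyt_attempt [polyt_intros]:
  "polyt f \<Longrightarrow> polyt g \<Longrightarrow> polyt h \<Longrightarrow> polyt (\<lambda>x. attempt (f x) (g x) (h x))"
  by (erule (2) polyt_comp3[rotated]) (unfold attempt_def, intro polyt_intros)

definition candidates :: "nat list \<Rightarrow> frac_col \<Rightarrow> (nat \<times> nat) list" where
  "candidates I x = concat (map (\<lambda>e. map (\<lambda>l. (fst e, l)) (snd e)) (filter (\<lambda>e. fst e \<in> set I) x))"

lemma polyt_candidates [polyt_intros]:
  "polyt f \<Longrightarrow> polyt g \<Longrightarrow> polyt (\<lambda>x. candidates (f x) (g x))"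
  by (erule (1) polyt_comp2[rotated]) (unfold candidates_def, intro polyt_intros)

definition improve :: "params \<Rightarrow> frac_col \<Rightarrow> frac_col" where
  "improve w x = head x (map snd (filter fst
     (map (attempt w x) (candidates (indep (concat (snd (snd (snd w)))) x) x))))"

lemma polyt_improve [polyt_intros]:
  "polyt f \<Longrightarrow> polyt g \<Longrightarrow> polyt (\<lambda>x. improve (f x) (g x))"
  by (erule (1) polyt_comp2[rotated]) (unfold improve_def, intro polyt_intros)

text \<open>Cyclic assignment of the positions makes the multiplicities of any two colours differ by
  at most \<open>1\<close>, although \<open>k\<close> need not divide \<open>T\<close>.\<close>

definition initial :: "params \<Rightarrow> nat list \<Rightarrow> frac_col" where
  "initial w ns = map (\<lambda>j. (j, map (\<lambda>i. i mod length (fst (snd w)) + 1) (fst w))) ns"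

lemma polyt_initial [polyt_intros]:
  "polyt f \<Longrightarrow> polyt g \<Longrightarrow> polyt (\<lambda>x. initial (f x) (g x))"
  by (erule (1) polyt_comp2[rotated]) (unfold initial_def, intro polyt_intros)

text \<open>The list only counts iterations: \<open>n k + 1\<close> of them, one more than the
  number of element-colour pairs that can be removed.\<close>

definition relaxed :: "params \<Rightarrow> nat list \<Rightarrow> frac_col" where
  "relaxed w ns = foldl (\<lambda>x _. improve w x) (initial w ns) (0 # concat (map (\<lambda>_. fst (snd w)) ns))"

text \<open>A size invariant for arbitrary inputs, as running times are bounded on malformed ones
  too. Elements may be repeated there, so the length bound is the total number of picks and not
  \<open>T\<close>. The summand \<open>2\<close> leaves room for \<open>i mod k + 1\<close> and for
  the default colour \<open>0\<close>.\<close>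

definition bounded_frac_col :: "params \<Rightarrow> nat list \<Rightarrow> frac_col \<Rightarrow> bool" where
  "bounded_frac_col w ns x \<longleftrightarrow> map fst x = ns \<and>
     (\<forall>e\<in>set x. length (snd e) \<le> length (fst w) * length ns \<and>
        (\<forall>c\<in>set (snd e). sz c \<le> sz w + 2))"

lemma sz_bounded_frac_col:
  assumes "bounded_frac_col w ns x"
  shows "sz x \<le> 1 + sz ns * (1 + (2 + sz ns + sz w * sz ns * (3 + sz w)))"
proof -
  have T: "length (fst w) * length ns \<le> sz w * sz ns"
    using length_le_sz[of "fst w"] length_le_sz[of ns] by (intro mult_mono) (simp_all add: sz_prod_eq[of w])
  have "sz x \<le> 1 + length x * (1 + (2 + sz ns + sz w * sz ns * (3 + sz w)))"
  proof (rule sz_list_le)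
    fix e assume e: "e \<in> set x"
    then have "length (snd e) \<le> length (fst w) * length ns"
      and c: "\<And>c. c \<in> set (snd e) \<Longrightarrow> sz c \<le> sz w + 2"
      using assms unfolding bounded_frac_col_def by blast+
    then have len: "length (snd e) \<le> sz w * sz ns" using T by linarith
    have "fst e \<in> set (map fst x)" using e by simp
    then have "fst e \<in> set ns" using assms by (simp only: bounded_frac_col_def)
    then have "sz (fst e) \<le> sz ns" by (rule sz_member)
    moreover have "sz (snd e) \<le> 1 + length (snd e) * (1 + (sz w + 2))"
      by (rule sz_list_le) (rule c)
    moreover have "length (snd e) * (1 + (sz w + 2)) \<le> sz w * sz ns * (1 + (sz w + 2))"
      by (intro mult_right_mono len) simp
    ultimately show "sz e \<le> 2 + sz ns + sz w * sz ns * (3 + sz w)"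
      unfolding sz_prod_eq[of e] by (simp add: algebra_simps)
  qed
  also have "length x = length ns"
    using assms unfolding bounded_frac_col_def by (metis length_map)
  also have "length ns * (1 + (2 + sz ns + sz w * sz ns * (3 + sz w)))
      \<le> sz ns * (1 + (2 + sz ns + sz w * sz ns * (3 + sz w)))"
    by (intro mult_right_mono length_le_sz) simp
  finally show ?thesis by simp
qed

lemma greedy_rounds_Nil [simp]: "greedy_rounds q Fs [] = []"
  by (simp add: greedy_rounds_def)

lemma greedy_rounds_snoc [simp]:
  "greedy_rounds q Fs (ts @ [t]) = greedy_round q Fs (greedy_rounds q Fs ts, t) @ greedy_rounds q Fs ts"
  by (simp add: greedy_rounds_def)

lemma length_greedy_rounds: "length (greedy_rounds q Fs ts) = length ts * length (snd (snd q))"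
  by (induction ts rule: rev_induct) (auto simp: greedy_round_def)

lemma set_greedy_rounds:
  "d \<in> set (greedy_rounds q Fs ts) \<Longrightarrow>
    \<exists>e\<in>set (snd (snd q)). fst d = fst e \<and> snd d \<in> insert 0 (set (snd (snd e)))"
proof (induction ts rule: rev_induct)
  case (snoc t ts)
  show ?case
  proof (cases "d \<in> set (greedy_rounds q Fs ts)")
    case False
    then have "d \<in> set (greedy_round q Fs (greedy_rounds q Fs ts, t))" using snoc.prems by auto
    then obtain e where e: "e \<in> set (snd (snd q))"
      "d = (fst e, argmin (\<lambda>l. score q (greedy_rounds q Fs ts, t) Fs (fst e) l) 0 (snd (snd e)))"
      unfolding greedy_round_def by auto
    show ?thesis
      by (rule bexI[OF _ e(1)]) (simp only: e(2) fst_conv snd_conv argmin_in_insert simp_thms)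
  qed (use snoc in auto)
qed simp

lemma length_entries_le: "length (entries I x c) \<le> length x"
  by (simp add: entries_def)

lemma bounded_frac_col_initial: "bounded_frac_col w ns (initial w ns)"
proof -
  have "sz (i mod length (fst (snd w)) + 1) \<le> sz w + 2" if "i \<in> set (fst w)" for i
  proof -
    have "sz i \<le> sz w" using sz_member[OF that] by (simp add: sz_prod_eq[of w])
    moreover have "bits (int (i mod length (fst (snd w)))) \<le> bits (int i)"
      by (intro bits_mono) (simp add: zmod_int[symmetric])
    ultimately show ?thesis
      using bits_add_le[of "int (i mod length (fst (snd w)))" 1] by (simp add: add.commute)
  qed
  then show ?thesis by (auto simp: bounded_frac_col_def initial_def comp_def Suc_le_eq length_pos_if_in_set)
qed

lemma bounded_frac_col_improve:
  assumes "bounded_frac_col w ns x"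
  shows "bounded_frac_col w ns (improve w x)"
proof -
  have *: "bounded_frac_col w ns (snd (attempt w x c))" for c
  proof -
    let ?es = "entries (indep (concat (snd (snd (snd w)))) x) x c"
    have "length (picks w x c) \<le> length (fst w) * length ns"
      using length_entries_le[of "indep (concat (snd (snd (snd w)))) x" x c] assms
      by (auto simp: picks_def length_greedy_rounds problem_of_def bounded_frac_col_def)
    then have 1: "length (filter P (picks w x c)) \<le> length (fst w) * length ns" for P
      using length_filter_le[of P "picks w x c"] by linarith
    have "sz (snd d) \<le> sz w + 2" if d: "d \<in> set (picks w x c)" for d
    proof -
      obtain e where e: "e \<in> set ?es" "snd d \<in> insert 0 (set (snd (snd e)))"
        using set_greedy_rounds[OF d[unfolded picks_def]] by (auto simp: problem_of_def)
      then obtain e' where "e' \<in> set x" "snd d = 0 \<or> snd d \<in> set (snd e')"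
        by (auto simp: entries_def)
      then show ?thesis using assms unfolding bounded_frac_col_def by auto
    qed
    with 1 assms show ?thesis
      by (auto simp: attempt_def replace_def bounded_frac_col_def comp_def)
  qed
  have "bounded_frac_col w ns y" if y: "y \<in> set (map snd (filter fst (map (attempt w x) (candidates (indep (concat (snd (snd (snd w)))) x) x))))" for y
  proof -
    obtain c where "y = snd (attempt w x c)" using y by (auto intro: prod.exhaust)
    then show ?thesis using * by simp
  qed
  moreover have "improve w x \<in> insert x (set (map snd (filter fst
      (map (attempt w x) (candidates (indep (concat (snd (snd (snd w)))) x) x)))))"
    unfolding improve_def by (rule head_in_insert)
  ultimately show ?thesis using assms by (metis insertE)
qed

lemma bounded_frac_col_iterate:
  "bounded_frac_col w ns x \<Longrightarrow> bounded_frac_col w ns (foldl (\<lambda>x _. improve w x) x zs)"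
  by (induction zs arbitrary: x) (auto intro: bounded_frac_col_improve)

lemma polyt_relaxed [polyt_intros]:
  "polyt f \<Longrightarrow> polyt g \<Longrightarrow> polyt (\<lambda>x. relaxed (f x) (g x))"
proof (erule (1) polyt_comp2[rotated], unfold relaxed_def,
    rule polyt_foldl[where D = "\<lambda>p. 1 + sz (snd p) * (1 + (2 + sz (snd p) + sz (fst p) * sz (snd p) * (3 + sz (fst p))))"])
  fix p :: "params \<times> nat list" and zs :: "nat list"
  show "sz (foldl (\<lambda>x _. improve (fst p) x) (initial (fst p) (snd p)) zs)
      \<le> 1 + sz (snd p) * (1 + (2 + sz (snd p) + sz (fst p) * sz (snd p) * (3 + sz (fst p))))"
    by (intro sz_bounded_frac_col bounded_frac_col_iterate bounded_frac_col_initial)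
qed (intro polyt_intros pb_intros polyt_pb)+

section \<open>Rounding with fair coins and evaluating a colouring\<close>

definition split :: "nat list \<Rightarrow> nat list \<times> nat list" where
  "split cs = foldl (\<lambda>p y. (snd p, y # fst p)) ([], []) cs"

text \<open>One coin keeps one of two piles dealt alternately. Singletons are left alone, so surplus
  coins in a block have no effect.\<close>

definition halve :: "nat list \<Rightarrow> bool \<Rightarrow> nat list" where
  "halve cs b = (if length cs \<le> 1 then cs else if b then fst (split cs) else snd (split cs))"

lemma polyt_split [polyt_intros]: "polyt f \<Longrightarrow> polyt (\<lambda>x. split (f x))"
  by (erule polyt_comp, unfold split_def, rule polyt_foldl_add[where D = "\<lambda>p. Suc (sz p)"])
     ((intro polyt_intros pb_intros)+, simp add: sz_prod_eq)

lemma polyt_halve [polyt_intros]: "polyt f \<Longrightarrow> polyt g \<Longrightarrow> polyt (\<lambda>x. halve (f x) (g x))"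
  by (erule (1) polyt_comp2[rotated]) (unfold halve_def, intro polyt_intros)

lemma sz_split: "sz (fst (split cs)) + sz (snd (split cs)) = sz cs + 1"
proof (induction cs rule: rev_induct)
  case (snoc c cs)
  then show ?case using sz_append[of cs "[c]"] by (simp add: split_def)
qed (simp add: split_def)

lemma sz_halve_le: "sz (halve cs b) \<le> sz cs"
  using sz_split[of cs] sz_pos(1)[of "fst (split cs)"] sz_pos(1)[of "snd (split cs)"]
  by (auto simp: halve_def simp del: sz_pos)

definition pick :: "nat list \<Rightarrow> bool list \<Rightarrow> nat" where
  "pick cs bs = head 0 (foldl halve cs bs)"

lemma polyt_pick [polyt_intros]: "polyt f \<Longrightarrow> polyt g \<Longrightarrow> polyt (\<lambda>x. pick (f x) (g x))"
proof (erule (1) polyt_comp2[rotated])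
  have "polyt (\<lambda>p :: nat list \<times> bool list. foldl halve (fst p) (snd p))"
    by (rule polyt_foldl_add[where D = "\<lambda>_. 0"]) (use sz_halve_le in \<open>(intro polyt_intros pb_intros | simp)+\<close>)
  then show "polyt (\<lambda>p. pick (fst p) (snd p))"
    unfolding pick_def by (intro polyt_intros)
qed

definition sample :: "nat \<Rightarrow> frac_col \<Rightarrow> bool list \<Rightarrow> (nat \<times> nat) list" where
  "sample T x bs = map (\<lambda>e. (fst e, pick (snd e) (drop (fst e * T) bs))) x"

lemma polyt_sample [polyt_intros]:
  "polyt f \<Longrightarrow> polyt g \<Longrightarrow> polyt h \<Longrightarrow> polyt (\<lambda>x. sample (f x) (g x) (h x))"
  by (erule (2) polyt_comp3[rotated]) (unfold sample_def, intro polyt_intros)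

definition cov :: "(nat \<times> nat) list \<Rightarrow> nat list list \<Rightarrow> nat \<Rightarrow> nat" where
  "cov \<kappa> F l = length (filter (\<lambda>S. \<exists>j\<in>set S. \<exists>e\<in>set \<kappa>. e = (j, l)) F)"

lemma polyt_cov [polyt_intros]:
  "polyt f \<Longrightarrow> polyt g \<Longrightarrow> polyt h \<Longrightarrow> polyt (\<lambda>x. cov (f x) (g x) (h x))"
  by (erule (2) polyt_comp3[rotated]) (unfold cov_def, intro polyt_intros)

text \<open>Minimising \<open>0 - z\<close> maximises \<open>z\<close>; both orders of each colour
  pair occur, so the maximal signed difference is the maximal absolute one.\<close>

definition discr :: "nat list list list \<Rightarrow> nat list \<Rightarrow> (nat \<times> nat) list \<Rightarrow> int" where
  "discr Fs cl \<kappa> = argmin (\<lambda>z. 0 - z) 0 (concat (map (\<lambda>F. concat (map (\<lambda>l.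
     map (\<lambda>l'. int (cov \<kappa> F l) - int (cov \<kappa> F l')) cl) cl)) Fs))"

lemma polyt_discr [polyt_intros]:
  "polyt f \<Longrightarrow> polyt g \<Longrightarrow> polyt h \<Longrightarrow> polyt (\<lambda>x. discr (f x) (g x) (h x))"
  by (erule (2) polyt_comp3[rotated]) (unfold discr_def, intro polyt_intros)

type_synonym inst = "nat list \<times> nat \<times> nat list list list"

text \<open>Unary numbers are represented by lists of that length.\<close>

definition size_tokens :: "inst \<Rightarrow> nat list" where
  "size_tokens z = [0, 0, 0, 0] @ fst z @ map (\<lambda>_. 0) (snd (snd z)) @
     map (\<lambda>_. 0) (concat (snd (snd z))) @ concat (concat (snd (snd z)))"

lemma polyt_size_tokens [polyt_intros]: "polyt f \<Longrightarrow> polyt (\<lambda>x. size_tokens (f x))"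
  by (erule polyt_comp) (unfold size_tokens_def, intro polyt_intros)

text \<open>Produces a unary power of two between \<open>n\<close> and about \<open>2 * n\<close>.
  The test stops the doubling early, since doubling once per entry of \<open>us\<close> would be
  exponential.\<close>

definition double_until :: "nat \<Rightarrow> nat list \<Rightarrow> nat list" where
  "double_until n us = foldl (\<lambda>a _. if length a < n then a @ a else a) [0 :: nat] us"

lemma double_until_bound:
  "set a \<subseteq> {0::nat} \<Longrightarrow> length a \<le> 1 + 2 * n \<Longrightarrow>
    sz (foldl (\<lambda>a _. if length a < n then a @ a else a) a us) \<le> 1 + (1 + 2 * n) * 2"
proof (induction us arbitrary: a)
  case Nil
  have "sz a \<le> 1 + length a * (1 + 1)" using Nil(1) by (intro sz_list_le) (auto dest!: subsetD)
  also have "\<dots> \<le> 1 + (1 + 2 * n) * 2" using Nil(2) by simp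
  finally show ?case by simp
qed simp

lemma polyt_double_until [polyt_intros]:
  fixes f :: "'a::enc \<Rightarrow> nat list"
  assumes "polyt f"
  shows "polyt (\<lambda>x. double_until (length (f x)) (f x))"
proof -
  have "polyt (\<lambda>us. foldl (\<lambda>a _. if length a < length us then a @ a else a) [0 :: nat] (us :: nat list))"
  proof (rule polyt_foldl[where D = "\<lambda>us. 1 + (1 + 2 * sz us) * 2"])
    fix us zs rest :: "nat list"
    have "sz (foldl (\<lambda>a _. if length a < length us then a @ a else a) [0 :: nat] zs) \<le> 1 + (1 + 2 * length us) * 2"
      by (rule double_until_bound) auto
    then show "sz (foldl (\<lambda>a _. if length a < length us then a @ a else a) [0 :: nat] zs) \<le> 1 + (1 + 2 * sz us) * 2"
      by (rule order_trans) (simp add: length_le_sz)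
  qed (intro polyt_intros pb_intros)+
  from polyt_comp[OF assms this] show ?thesis unfolding double_until_def .
qed

definition sq_tokens :: "nat list \<Rightarrow> nat list" where
  "sq_tokens l = concat (map (\<lambda>_. l) l)"

lemma polyt_sq_tokens [polyt_intros]: "polyt f \<Longrightarrow> polyt (\<lambda>x. sq_tokens (f x))"
  by (erule polyt_comp) (unfold sq_tokens_def, intro polyt_intros)

text \<open>A denominator \<open>T \<ge> u ^ 16\<close>, where \<open>u\<close> is the number of size tokens, bounds the change of a
  coverage value in one accepted step by \<open>u ^ 2 / sqrt T \<le> u ^ (- 6)\<close>, and there are at most \<open>u ^ 2\<close>
  steps. It is a power of two so that a list of that length can be sampled with fair coins.\<close>

definition denominator :: "inst \<Rightarrow> nat list" where
  "denominator z = sq_tokens (sq_tokens (sq_tokens (sq_tokens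
     (double_until (length (size_tokens z)) (size_tokens z)))))"

lemma polyt_denominator [polyt_intros]: "polyt f \<Longrightarrow> polyt (\<lambda>x. denominator (f x))"
  by (erule polyt_comp) (unfold denominator_def, intro polyt_intros)

text \<open>For \<open>k < n\<close> the filter yields the colours \<open>1, ..., k\<close>; it
  avoids counting up to the binary number \<open>k\<close>.\<close>

definition params_of :: "inst \<Rightarrow> params" where
  "params_of z = ([0..<length (denominator z)], filter (\<lambda>j. j \<le> fst (snd z)) (fst z),
     length (size_tokens z), snd (snd z))"

lemma polyt_params_of [polyt_intros]: "polyt f \<Longrightarrow> polyt (\<lambda>x. params_of (f x))"
  by (erule polyt_comp) (unfold params_of_def, intro polyt_intros)

definition trials :: "nat \<Rightarrow> inst \<Rightarrow> nat list" where
  "trials c z = concat (map (\<lambda>_. size_tokens z) (replicate c 0 :: nat list))"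

lemma polyt_trials [polyt_intros]: "polyt f \<Longrightarrow> polyt (\<lambda>x. trials c (f x))"
  by (erule polyt_comp) (unfold trials_def, intro polyt_intros polyt_const_list)

text \<open>Element \<open>j\<close> is rounded with the \<open>j\<close>-th block of coins of a trial; block \<open>0\<close> is not used.\<close>

definition coin_tokens :: "nat \<Rightarrow> inst \<Rightarrow> nat list" where
  "coin_tokens c z = concat (map (\<lambda>_. concat (map (\<lambda>_. denominator z) (0 # fst z))) (trials c z))"

lemma polyt_coin_tokens [polyt_intros]: "polyt f \<Longrightarrow> polyt (\<lambda>x. coin_tokens c (f x))"
  by (erule polyt_comp) (unfold coin_tokens_def, intro polyt_intros)

text \<open>For \<open>k \<ge> n\<close> the ground set itself, read as a list of colours, gives
  every element its own colour. Otherwise trial \<open>q\<close> reads the segment of coins that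
  starts after \<open>q\<close> times \<open>n + 1\<close> blocks.\<close>

definition solve :: "nat \<Rightarrow> inst \<times> bool list \<Rightarrow> nat list" where
  "solve c zb = (if length (fst (fst zb)) \<le> fst (snd (fst zb)) then fst (fst zb) else
     map snd (argmin (discr (snd (snd (fst zb))) (fst (snd (params_of (fst zb))))) []
       (map (\<lambda>q. sample (length (denominator (fst zb))) (relaxed (params_of (fst zb)) (fst (fst zb)))
               (drop (q * (Suc (length (fst (fst zb))) * length (denominator (fst zb)))) (snd zb)))
         [0..<length (trials c (fst zb))])))"

lemma polyt_solve: "polyt (solve c)"
  unfolding solve_def[abs_def] by (intro polyt_intros)

section \<open>Running with random bits\<close>

primrec flips :: "nat \<Rightarrow> bool list \<Rightarrow> bool list spmf" where
  "flips 0 bs = return_spmf bs"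
| "flips (Suc n) bs = bind_spmf coin_spmf (\<lambda>b. flips n (b # bs))"

text \<open>The expectation over \<open>n\<close> fair bits as a finite recursion: independence of
  blocks becomes the equation \<open>avg_add\<close>, without product measures.\<close>

primrec avg :: "nat \<Rightarrow> (bool list \<Rightarrow> real) \<Rightarrow> real" where
  "avg 0 f = f []"
| "avg (Suc n) f = (avg n (\<lambda>bs. f (True # bs)) + avg n (\<lambda>bs. f (False # bs))) / 2"

lemma avg_snoc: "avg (Suc n) f = (avg n (\<lambda>bs. f (bs @ [True])) + avg n (\<lambda>bs. f (bs @ [False]))) / 2"
proof (induction n arbitrary: f)
  case (Suc n)
  show ?case
    unfolding avg.simps(2)[of "Suc n"] Suc.IH[of "\<lambda>bs. f (True # bs)"] Suc.IH[of "\<lambda>bs. f (False # bs)"]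
    by (simp add: field_simps)
qed simp

text \<open>The coin loop puts new bits in front, so the list arrives reversed; uniform bits do not
  notice.\<close>

lemma avg_rev: "avg n (\<lambda>bs. f (rev bs)) = avg n f"
proof (induction n arbitrary: f)
  case (Suc n)
  show ?case
    using Suc.IH[of "\<lambda>bs. f (bs @ [True])"] Suc.IH[of "\<lambda>bs. f (bs @ [False])"]
    by (subst avg_snoc[of _ f]) simp
qed simp

lemma avg_add: "avg (m + n) f = avg m (\<lambda>us. avg n (\<lambda>vs. f (us @ vs)))"
  by (induction m arbitrary: f) auto

lemma avg_cong: "(\<And>bs. length bs = n \<Longrightarrow> f bs = g bs) \<Longrightarrow> avg n f = avg n g"
proof (induction n arbitrary: f g)
  case (Suc n)
  have "avg n (\<lambda>bs. f (b # bs)) = avg n (\<lambda>bs. g (b # bs))" for b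
    by (rule Suc.IH) (use Suc.prems in auto)
  then show ?case by simp
qed simp

lemma avg_mono: "(\<And>bs. length bs = n \<Longrightarrow> f bs \<le> g bs) \<Longrightarrow> avg n f \<le> avg n g"
proof (induction n arbitrary: f g)
  case (Suc n)
  have "avg n (\<lambda>bs. f (b # bs)) \<le> avg n (\<lambda>bs. g (b # bs))" for b
    by (rule Suc.IH) (use Suc.prems in auto)
  from this[of True] this[of False] show ?case by simp
qed simp

lemma avg_const [simp]: "avg n (\<lambda>_. c) = c"
  by (induction n) auto

lemma avg_plus: "avg n (\<lambda>bs. f bs + g bs) = avg n f + avg n g"
  by (induction n arbitrary: f g) (auto simp: field_simps)

lemma avg_mult_left: "avg n (\<lambda>bs. c * f bs) = c * avg n f"
  by (induction n arbitrary: f) (auto simp: field_simps)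

lemma avg_mult_right: "avg n (\<lambda>bs. f bs * c) = avg n f * c"
  using avg_mult_left[of n c f] by (simp add: mult.commute)

lemma avg_diff_from: "avg n (\<lambda>bs. c - f bs) = c - avg n f"
  using avg_plus[of n "\<lambda>_. c" "\<lambda>bs. (- 1) * f bs"] avg_mult_left[of n "- 1" f] by simp

lemma avg_sum: "avg n (\<lambda>bs. \<Sum>i\<in>A. f i bs) = (\<Sum>i\<in>A. avg n (f i))"
  by (induction A rule: infinite_finite_induct) (auto simp: avg_plus)

lemma lossless_flips: "lossless_spmf (flips n bs)"
  by (induction n arbitrary: bs) auto

lemma length_flips: "bs' \<in> set_spmf (flips n bs) \<Longrightarrow> length bs' = n + length bs"
  by (induction n arbitrary: bs) (auto simp: set_bind_spmf)

lemma measure_flips: "measure (measure_spmf (flips n bs)) X = avg n (\<lambda>us. indicator X (rev us @ bs))"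
proof (induction n arbitrary: bs)
  case (Suc n)
  have "measure (measure_spmf (flips (Suc n) bs)) X
      = (\<integral>b. measure (measure_spmf (flips n (b # bs))) X \<partial>measure_spmf coin_spmf)"
    by (simp add: measure_spmf_bind o_def measure_spmf.measure_bind[where N = "count_space UNIV"])
  also have "\<dots> = (\<integral>b. avg n (\<lambda>us. indicator X (rev us @ b # bs)) \<partial>measure_spmf coin_spmf)"
    by (simp only: Suc.IH)
  also have "\<dots> = avg (Suc n) (\<lambda>us. indicator X (rev us @ bs))"
    by (subst integral_spmf_of_set) (simp add: UNIV_bool)
  finally show ?case .
qed (auto simp: measure_measure_spmf_conv_measure_pmf indicator_def)

lemma measure_flips_Nil: "measure (measure_spmf (flips n [])) X = avg n (indicator X)"
  using avg_rev[of n "indicator X"] by (simp add: measure_flips)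

section \<open>A program that flips all its coins before computing\<close>

definition flip_body :: com where
  "flip_body = Seq (Flip 3) (Seq (Assign 2 (MkNode (Var 3) (Var 2)))
     (Seq (Assign 1 (RightOf (Var 1))) (Assign 3 (Const 0))))"

lemma exec_flip_body:
  "exec flip_body \<sigma> = bind_spmf coin_spmf (\<lambda>b.
     return_spmf (\<sigma>(2 := Node (enc b) (\<sigma> 2), 1 := right (\<sigma> 1), 3 := Leaf 0), 10))"
  unfolding flip_body_def
  by (simp add: map_spmf_conv_bind_spmf eval_nat_numeral fun_upd_twist)

text \<open>The body clears variable \<open>3\<close>, so the final store depends on the coins
  through variable \<open>2\<close> alone and is an image of \<open>flips\<close>. One round costs
  \<open>10\<close> for the body and \<open>3\<close> for the guard.\<close>

lemma flip_loop:
  fixes ys :: "'y::enc list"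
  assumes "\<sigma> 1 = enc ys" "\<sigma> 2 = enc bs" "\<sigma> 3 = Leaf 0"
  shows "while_spmf (\<lambda>(\<sigma>', T). truthy (value_of (IsNode (Var 1)) \<sigma>'))
       (\<lambda>(\<sigma>', T). map_spmf (\<lambda>(\<sigma>'', T'). (\<sigma>'', T + T' + 1 + expr_cost (IsNode (Var 1)) \<sigma>''))
          (exec flip_body \<sigma>')) (\<sigma>, T)
     = map_spmf (\<lambda>bs'. (\<sigma>(1 := Leaf 0, 2 := enc bs'), T + 13 * length ys)) (flips (length ys) bs)"
  using assms
proof (induction ys arbitrary: \<sigma> bs T)
  case Nil
  then show ?case by (auto simp: while_spmf_return_False truthy_def fun_eq_iff)
next
  case (Cons y ys)
  let ?W = "while_spmf (\<lambda>(\<sigma>', T). truthy (value_of (IsNode (Var 1)) \<sigma>'))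
       (\<lambda>(\<sigma>', T). map_spmf (\<lambda>(\<sigma>'', T'). (\<sigma>'', T + T' + 1 + expr_cost (IsNode (Var 1)) \<sigma>''))
          (exec flip_body \<sigma>'))"
  define s where "s = (\<lambda>b :: bool. \<sigma>(2 := Node (enc b) (\<sigma> 2), 1 := right (\<sigma> 1), 3 := Leaf 0))"
  have "?W (\<sigma>, T) = bind_spmf (map_spmf (\<lambda>(\<sigma>'', T'). (\<sigma>'', T + T' + 1 + expr_cost (IsNode (Var 1)) \<sigma>''))
          (exec flip_body \<sigma>)) ?W"
    by (subst while_spmf.simps) (use Cons.prems in \<open>simp add: truthy_def\<close>)
  also have "\<dots> = bind_spmf coin_spmf (\<lambda>b. ?W (s b, T + 13))"
    unfolding exec_flip_body s_def by (simp add: map_spmf_conv_bind_spmf add.commute)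
  also have "\<dots> = bind_spmf coin_spmf (\<lambda>b. map_spmf (\<lambda>bs'. (\<sigma>(1 := Leaf 0, 2 := enc bs'),
      T + 13 * length (y # ys))) (flips (length ys) (b # bs)))"
  proof (intro arg_cong[where f = "bind_spmf coin_spmf"] ext)
    fix b
    have "s b 1 = enc ys" "s b 2 = enc (b # bs)" "s b 3 = Leaf 0"
      using Cons.prems by (simp_all add: s_def)
    then have IH: "?W (s b, T + 13) = map_spmf (\<lambda>bs'. ((s b)(1 := Leaf 0, 2 := enc bs'), T + 13 + 13 * length ys))
        (flips (length ys) (b # bs))"
      by (rule Cons.IH)
    have e: "(s b)(1 := Leaf 0, 2 := enc bs') = \<sigma>(1 := Leaf 0, 2 := enc bs')" for bs' :: "bool list"
      using Cons.prems(3) by (auto simp: s_def fun_eq_iff)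
    have n: "T + 13 + 13 * length ys = T + 13 * length (y # ys)" by simp
    show "?W (s b, T + 13) = map_spmf (\<lambda>bs'. (\<sigma>(1 := Leaf 0, 2 := enc bs'),
      T + 13 * length (y # ys))) (flips (length ys) (b # bs))"
      by (simp only: IH e n)
  qed
  also have "\<dots> = map_spmf (\<lambda>bs'. (\<sigma>(1 := Leaf 0, 2 := enc bs'), T + 13 * length (y # ys)))
      (flips (length (y # ys)) bs)"
    by (simp add: map_spmf_conv_bind_spmf)
  finally show ?case .
qed

lemma exec_Seq_map:
  assumes "exec c1 \<sigma> = return_spmf (\<sigma>1, T1)" "exec c2 \<sigma>1 = map_spmf (\<lambda>x. (f x, t x)) p"
  shows "exec (Seq c1 c2) \<sigma> = map_spmf (\<lambda>x. (f x, T1 + t x)) p"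
  using assms by (simp add: spmf.map_comp o_def)

lemma sz_bool_list_le: "sz (bs :: bool list) \<le> 1 + 3 * length bs"
proof -
  have "sz bs \<le> 1 + length bs * (1 + 2)" by (rule sz_list_le) (rule sz_bool_le)
  then show ?thesis by simp
qed

text \<open>Flipping as many coins as \<open>R z\<close> has entries and then running a
  deterministic program separates randomness from the calculus of \<open>polyt\<close>. The time
  bound is uniform because all coin lists have the same length.\<close>

lemma random_bits_program:
  fixes R :: "'a::enc \<Rightarrow> 'y::enc list" and S :: "'a \<times> bool list \<Rightarrow> 'b::enc"
  assumes "polyt R" "polyt S"
  shows "\<exists>A G. pb G \<and> (\<forall>z. \<exists>Tm. (\<forall>bs. length bs = length (R z) \<longrightarrow> Tm bs \<le> G z) \<and>
    run A (enc z) = map_spmf (\<lambda>bs. (enc (S (z, bs)), Tm bs)) (flips (length (R z)) []))"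
proof -
  obtain CR gR where R: "pb gR" "computes CR R gR" using assms(1) by (rule polytE)
  obtain CS gS where S: "pb gS" "computes CS S gS" using assms(2) by (rule polytE)
  obtain p where p: "\<And>y. gS y \<le> poly p (sz y)" using S(1) unfolding pb_def by blast
  define loop where "loop = While (IsNode (Var 1)) flip_body"
  define A where "A = Seq (Assign 1 (Var 0)) (Seq (CR 1) (Seq (Assign 2 (Const 0))
    (Seq (Assign 3 (Const 0)) (Seq loop (Seq (Assign 0 (MkNode (Var 0) (Var 2))) (CS 0))))))"
  define G where "G = (\<lambda>z. 13 + gR z + 13 * sz (R z) + poly p (2 + sz z + 3 * sz (R z)))"
  have "\<exists>Tm. (\<forall>bs. length bs = length (R z) \<longrightarrow> Tm bs \<le> G z) \<and>
    run A (enc z) = map_spmf (\<lambda>bs. (enc (S (z, bs)), Tm bs)) (flips (length (R z)) [])" for z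
  proof -
    define \<sigma>0 :: store where "\<sigma>0 = ((\<lambda>_. Leaf 0)(0 := enc z))"
    obtain \<sigma>1 T1 where s1: "exec (CR 1) (\<sigma>0(1 := enc z)) = return_spmf (\<sigma>1, T1)" "\<sigma>1 1 = enc (R z)"
      "\<And>w. w < 1 \<Longrightarrow> \<sigma>1 w = (\<sigma>0(1 := enc z)) w" "T1 \<le> gR z"
      by (rule computesE[OF R(2), where \<sigma> = "\<sigma>0(1 := enc z)" and v = 1 and x = z]) auto
    define \<sigma>2 where "\<sigma>2 = \<sigma>1(2 := Leaf 0, 3 := Leaf 0)"
    define \<tau> where "\<tau> = (\<lambda>bs :: bool list. \<sigma>2(1 := Leaf 0, 2 := enc bs, 0 := enc (z, bs)))"
    have "\<sigma>1 0 = enc z" using s1(3)[of 0] by (simp add: \<sigma>0_def)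
    then have \<sigma>2: "\<sigma>2 0 = enc z" "\<sigma>2 1 = enc (R z)" "\<sigma>2 2 = enc ([] :: bool list)" "\<sigma>2 3 = Leaf 0"
      using s1(2) by (simp_all add: \<sigma>2_def)
    have loop: "exec loop \<sigma>2 = map_spmf (\<lambda>bs. (\<sigma>2(1 := Leaf 0, 2 := enc bs), 3 + 13 * length (R z)))
        (flips (length (R z)) [])"
      unfolding loop_def exec.simps(6) by (subst flip_loop[OF \<sigma>2(2-4)]) (simp add: numeral_3_eq_3)
    have "\<forall>bs. \<exists>r. exec (CS 0) (\<tau> bs) = return_spmf r \<and> fst r 0 = enc (S (z, bs)) \<and> snd r \<le> gS (z, bs)"
    proof
      fix bs
      have "\<tau> bs 0 = enc (z, bs)" by (simp add: \<tau>_def)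
      then show "\<exists>r. exec (CS 0) (\<tau> bs) = return_spmf r \<and> fst r 0 = enc (S (z, bs)) \<and> snd r \<le> gS (z, bs)"
        by - (erule computesE[OF S(2), where \<sigma> = "\<tau> bs" and v = 0], auto)
    qed
    then obtain r where r: "\<And>bs. exec (CS 0) (\<tau> bs) = return_spmf (r bs)"
        "\<And>bs. fst (r bs) 0 = enc (S (z, bs))" "\<And>bs. snd (r bs) \<le> gS (z, bs)"
      by metis
    define Tm where "Tm = (\<lambda>bs. 2 + (T1 + (2 + (2 + (3 + 13 * length (R z) + (4 + snd (r bs)))))))"
    have last: "exec (Seq (Assign 0 (MkNode (Var 0) (Var 2))) (CS 0)) (\<sigma>2(1 := Leaf 0, 2 := enc bs))
        = return_spmf (fst (r bs), 4 + snd (r bs))" for bs :: "bool list"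
    proof -
      have "(\<sigma>2(1 := Leaf 0, 2 := enc bs))(0 := Node (\<sigma>2 0) (enc bs)) = \<tau> bs"
        using \<sigma>2(1) by (simp add: \<tau>_def)
      then show ?thesis using r(1)[of bs] by (cases "r bs") (simp add: \<sigma>2(1))
    qed
    define L where "L = Seq (Assign 0 (MkNode (Var 0) (Var 2))) (CS 0)"
    have "exec (Seq loop L) \<sigma>2 = bind_spmf (flips (length (R z)) []) (\<lambda>bs.
        map_spmf (\<lambda>(\<sigma>'', T'). (\<sigma>'', 3 + 13 * length (R z) + T')) (exec L (\<sigma>2(1 := Leaf 0, 2 := enc bs))))"
      by (simp only: exec.simps(4) loop bind_map_spmf o_def case_prod_conv)
    also have "\<dots> = map_spmf (\<lambda>bs. (fst (r bs), 3 + 13 * length (R z) + (4 + snd (r bs)))) (flips (length (R z)) [])"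
      by (simp only: last[folded L_def]) (simp add: map_spmf_conv_bind_spmf)
    finally have seq: "exec (Seq loop L) \<sigma>2
        = map_spmf (\<lambda>bs. (fst (r bs), 3 + 13 * length (R z) + (4 + snd (r bs)))) (flips (length (R z)) [])" .
    have "exec A ((\<lambda>_. Leaf 0)(0 := enc z)) = map_spmf (\<lambda>bs. (fst (r bs), Tm bs)) (flips (length (R z)) [])"
    proof -
      have a1: "exec (Assign 1 (Var 0)) \<sigma>0 = return_spmf (\<sigma>0(1 := enc z), 2)" by (simp add: \<sigma>0_def)
      have a2: "exec (Assign 2 (Const 0)) \<sigma>1 = return_spmf (\<sigma>1(2 := Leaf 0), 2)" by simp
      have a3: "exec (Assign 3 (Const 0)) (\<sigma>1(2 := Leaf 0)) = return_spmf (\<sigma>2, 2)" by (simp add: \<sigma>2_def)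
      show ?thesis
        unfolding A_def L_def[symmetric] \<sigma>0_def[symmetric] Tm_def
        by (intro exec_Seq_map[OF a1] exec_Seq_map[OF s1(1)] exec_Seq_map[OF a2] exec_Seq_map[OF a3] seq)
    qed
    then have "run A (enc z) = map_spmf (\<lambda>bs. (enc (S (z, bs)), Tm bs)) (flips (length (R z)) [])"
      by (simp add: run_def spmf.map_comp o_def r(2))
    moreover have "Tm bs \<le> G z" if "length bs = length (R z)" for bs
    proof -
      have "sz bs \<le> 1 + 3 * sz (R z)" using sz_bool_list_le[of bs] that length_le_sz[of "R z"] by linarith
      then have "gS (z, bs) \<le> poly p (2 + sz z + 3 * sz (R z))"
        by (intro order_trans[OF p] poly_nat_mono) simp
      then show ?thesis
        using r(3)[of bs] s1(4) length_le_sz[of "R z"] unfolding Tm_def G_def by linarith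
    qed
    ultimately show ?thesis by blast
  qed
  moreover have "pb G" unfolding G_def by (intro pb_intros R polyt_pb assms)
  ultimately show ?thesis by blast
qed

section \<open>Approximate kernel steps by greedy rounds\<close>

text \<open>Gaussian elimination: a homogeneous system with fewer equations \<open>E\<close> than
  unknowns \<open>J\<close> has a nonzero solution. Each equation uses up at most one
  unknown.\<close>

lemma linear_dependence:
  fixes w :: "'j \<Rightarrow> 'e \<Rightarrow> real"
  assumes "finite E" "finite J" "card E < card J"
  shows "\<exists>c. (\<exists>j\<in>J. c j \<noteq> 0) \<and> (\<forall>e\<in>E. (\<Sum>j\<in>J. c j * w j e) = 0)"
  using assms
proof (induction E arbitrary: J w rule: finite_induct)
  case empty
  then show ?case by (intro exI[of _ "\<lambda>_. 1"]) (auto simp: card_gt_0_iff)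
next
  case (insert e E)
  show ?case
  proof (cases "\<forall>j\<in>J. w j e = 0")
    case True
    have "card E < card J" using insert by simp
    then obtain c where "\<exists>j\<in>J. c j \<noteq> 0" "\<forall>e\<in>E. (\<Sum>j\<in>J. c j * w j e) = 0"
      using insert.IH[OF insert.prems(1)] by blast
    then show ?thesis using True by (intro exI[of _ c]) auto
  next
    case False
    then obtain j0 where j0: "j0 \<in> J" "w j0 e \<noteq> 0" by blast
    define J' where "J' = J - {j0}"
    have J': "finite J'" "card E < card J'" "j0 \<notin> J'" "J = insert j0 J'"
      using insert.prems insert.hyps j0 by (auto simp: J'_def)
    \<comment> \<open>Equation \<open>e\<close> is solved for the unknown \<open>j0\<close> and
      substituted into the others.\<close>
    define w' where "w' = (\<lambda>j f. w j f - w j e / w j0 e * w j0 f)"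
    obtain c where c: "\<exists>j\<in>J'. c j \<noteq> 0" "\<forall>f\<in>E. (\<Sum>j\<in>J'. c j * w' j f) = 0"
      using insert.IH[OF J'(1,2), of w'] by blast
    define a where "a = - (\<Sum>j\<in>J'. c j * w j e) / w j0 e"
    define d where "d = c(j0 := a)"
    have d: "(\<Sum>j\<in>J. d j * w j f) = a * w j0 f + (\<Sum>j\<in>J'. c j * w j f)" for f
    proof -
      have "(\<Sum>j\<in>J'. d j * w j f) = (\<Sum>j\<in>J'. c j * w j f)"
        by (rule sum.cong) (use J'(3) in \<open>auto simp: d_def\<close>)
      then show ?thesis using J' by (simp add: d_def)
    qed
    have "(\<Sum>j\<in>J. d j * w j f) = 0" if "f \<in> insert e E" for f
    proof (cases "f = e")
      case True
      then show ?thesis unfolding d by (simp add: a_def j0)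
    next
      case False
      then have "0 = (\<Sum>j\<in>J'. c j * w' j f)" using c(2) that by simp
      also have "\<dots> = (\<Sum>j\<in>J'. c j * w j f) - (\<Sum>j\<in>J'. c j * w j e) / w j0 e * w j0 f"
        by (simp add: w'_def algebra_simps sum_subtractf sum_distrib_left sum_divide_distrib)
      finally show ?thesis unfolding d by (simp add: a_def)
    qed
    moreover have "\<exists>j\<in>J. d j \<noteq> 0" using c(1) J' by (auto simp: d_def)
    ultimately show ?thesis by blast
  qed
qed

text \<open>For each \<open>j\<close> pick two colours of positive weight and allow mass to move
  only between them. This leaves one unknown per element against \<open>card E\<close> equations, so
  some nonzero motion preserves all values; follow it until the first weight vanishes.\<close>

lemma face_point:
  fixes x :: "'j \<Rightarrow> 'l \<Rightarrow> real" and v :: "'j \<Rightarrow> 'l \<Rightarrow> 'e \<Rightarrow> real"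
  assumes "finite E" "finite J" "card E < card J" and L: "finite L"
    and nonneg: "\<And>j l. j \<in> J \<Longrightarrow> l \<in> L \<Longrightarrow> x j l \<ge> 0"
    and sum1: "\<And>j. j \<in> J \<Longrightarrow> (\<Sum>l\<in>L. x j l) = 1"
    and two: "\<And>j. j \<in> J \<Longrightarrow> \<exists>a\<in>L. \<exists>b\<in>L. a \<noteq> b \<and> x j a > 0 \<and> x j b > 0"
  obtains w j0 l0 where "j0 \<in> J" "l0 \<in> L" "x j0 l0 > 0" "w j0 l0 = 0"
    "\<And>j l. j \<in> J \<Longrightarrow> l \<in> L \<Longrightarrow> w j l \<ge> 0"
    "\<And>j l. j \<in> J \<Longrightarrow> l \<in> L \<Longrightarrow> x j l = 0 \<Longrightarrow> w j l = 0"
    "\<And>j. j \<in> J \<Longrightarrow> (\<Sum>l\<in>L. w j l) = 1"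
    "\<And>e. e \<in> E \<Longrightarrow> (\<Sum>j\<in>J. \<Sum>l\<in>L. w j l * v j l e) = (\<Sum>j\<in>J. \<Sum>l\<in>L. x j l * v j l e)"
proof -
  obtain \<alpha> \<beta> where \<alpha>\<beta>: "\<And>j. j \<in> J \<Longrightarrow> \<alpha> j \<in> L \<and> \<beta> j \<in> L \<and> \<alpha> j \<noteq> \<beta> j \<and> x j (\<alpha> j) > 0 \<and> x j (\<beta> j) > 0"
    using two by metis
  obtain c where c: "\<exists>j\<in>J. c j \<noteq> 0" "\<And>e. e \<in> E \<Longrightarrow> (\<Sum>j\<in>J. c j * (v j (\<alpha> j) e - v j (\<beta> j) e)) = 0"
    using linear_dependence[OF assms(1-3), of "\<lambda>j e. v j (\<alpha> j) e - v j (\<beta> j) e"] by blast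
  \<comment> \<open>The colour of \<open>j\<close> whose weight shrinks along the motion.\<close>
  define lose where "lose = (\<lambda>j. if c j > 0 then \<beta> j else \<alpha> j)"
  define K where "K = {j \<in> J. c j \<noteq> 0}"
  define R where "R = (\<lambda>j. x j (lose j) / \<bar>c j\<bar>)"
  have K: "finite K" "K \<noteq> {}" using c(1) assms(2) by (auto simp: K_def)
  obtain j0 where j0: "j0 \<in> K" "\<And>j. j \<in> K \<Longrightarrow> R j0 \<le> R j"
    using arg_min_if_finite[OF K, of R] by (metis not_le_imp_less)
  \<comment> \<open>The longest admissible step, by a minimum ratio test; the minimiser
    \<open>j0\<close> loses its colour completely.\<close>
  define s where "s = R j0"
  have s: "s \<ge> 0" using j0(1) \<alpha>\<beta>[of j0] by (auto simp: s_def R_def lose_def K_def)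
  have step: "s * \<bar>c j\<bar> \<le> x j (lose j)" if "j \<in> J" for j
  proof (cases "c j = 0")
    case True
    then show ?thesis using \<alpha>\<beta>[OF that] by (simp add: lose_def)
  next
    case False
    then have "s \<le> R j" using j0(2) that by (simp add: s_def K_def)
    then show ?thesis using False by (simp add: R_def field_simps)
  qed
  define w where "w = (\<lambda>j l. x j l + s * c j * (of_bool (l = \<alpha> j) - of_bool (l = \<beta> j)))"
  have sums: "(\<Sum>l\<in>L. w j l * g l) = (\<Sum>l\<in>L. x j l * g l) + s * (c j * (g (\<alpha> j) - g (\<beta> j)))"
    if "j \<in> J" for j and g :: "'l \<Rightarrow> real"
  proof -
    have "(\<Sum>l\<in>L. w j l * g l) = (\<Sum>l\<in>L. x j l * g l
        + (if l = \<alpha> j then s * c j * g l else 0) - (if l = \<beta> j then s * c j * g l else 0))"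
      by (rule sum.cong) (auto simp: w_def algebra_simps)
    also have "\<dots> = (\<Sum>l\<in>L. x j l * g l) + s * c j * g (\<alpha> j) - s * c j * g (\<beta> j)"
      using \<alpha>\<beta>[OF that] L by (simp add: sum.distrib sum_subtractf)
    finally show ?thesis by (simp add: algebra_simps)
  qed
  show ?thesis
  proof (rule that[of j0 "lose j0" w])
    show "j0 \<in> J" using j0(1) by (simp add: K_def)
    then show "lose j0 \<in> L" "x j0 (lose j0) > 0" using \<alpha>\<beta>[of j0] by (auto simp: lose_def)
    show "w j0 (lose j0) = 0"
      using j0(1) \<alpha>\<beta>[OF \<open>j0 \<in> J\<close>] by (auto simp: w_def s_def R_def lose_def K_def field_simps split: if_splits)
  next
    fix j l assume j: "j \<in> J" and l: "l \<in> L"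
    consider "l = lose j" | "l \<noteq> lose j" "l = \<alpha> j \<or> l = \<beta> j" | "l \<noteq> \<alpha> j" "l \<noteq> \<beta> j" by blast
    then show "w j l \<ge> 0"
    proof cases
      case 1
      then show ?thesis using step[OF j] \<alpha>\<beta>[OF j]
        by (cases "c j > 0") (auto simp: w_def lose_def algebra_simps)
    next
      case 2
      have "w j l \<ge> x j l"
      proof (cases "c j > 0")
        case True
        then show ?thesis using 2 \<alpha>\<beta>[OF j] s by (auto simp: w_def lose_def)
      next
        case False
        then have "s * c j \<le> 0" using s by (simp add: mult_nonneg_nonpos)
        then show ?thesis using 2 \<alpha>\<beta>[OF j] False by (auto simp: w_def lose_def)
      qed
      then show ?thesis using nonneg[OF j l] by linarith
    next
      case 3
      then show ?thesis using nonneg[OF j l] by (simp add: w_def)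
    qed
    show "w j l = 0" if "x j l = 0"
      using that \<alpha>\<beta>[OF j] by (auto simp: w_def)
  next
    fix j assume j: "j \<in> J"
    show "(\<Sum>l\<in>L. w j l) = 1" using sums[OF j, of "\<lambda>_. 1"] sum1[OF j] by simp
  next
    fix e assume e: "e \<in> E"
    have "(\<Sum>j\<in>J. \<Sum>l\<in>L. w j l * v j l e)
        = (\<Sum>j\<in>J. (\<Sum>l\<in>L. x j l * v j l e) + s * (c j * (v j (\<alpha> j) e - v j (\<beta> j) e)))"
      by (rule sum.cong) (auto simp: sums)
    also have "\<dots> = (\<Sum>j\<in>J. \<Sum>l\<in>L. x j l * v j l e)"
      using c(2)[OF e] by (simp add: sum.distrib flip: sum_distrib_left)
    finally show "(\<Sum>j\<in>J. \<Sum>l\<in>L. w j l * v j l e) = (\<Sum>j\<in>J. \<Sum>l\<in>L. x j l * v j l e)" .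
  qed
qed

text \<open>The residual is never positively correlated with the greedy choice, because some convex
  combination of the choices hits the target exactly; hence its square grows only linearly.\<close>

lemma greedy_residual:
  fixes r :: "nat \<Rightarrow> 'e \<Rightarrow> real" and v :: "'j \<Rightarrow> 'l \<Rightarrow> 'e \<Rightarrow> real"
  assumes "finite E" "finite J" "finite L"
    and w: "\<And>j l. j \<in> J \<Longrightarrow> l \<in> L \<Longrightarrow> w j l \<ge> 0" "\<And>j. j \<in> J \<Longrightarrow> (\<Sum>l\<in>L. w j l) = 1"
      "\<And>j l. j \<in> J \<Longrightarrow> l \<in> L \<Longrightarrow> l \<notin> Opt j \<Longrightarrow> w j l = 0"
      "\<And>e. e \<in> E \<Longrightarrow> (\<Sum>j\<in>J. \<Sum>l\<in>L. w j l * v j l e) = \<mu> e"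
    and r0: "\<And>e. e \<in> E \<Longrightarrow> r 0 e = 0"
    and r_Suc: "\<And>t e. e \<in> E \<Longrightarrow> r (Suc t) e = r t e + ((\<Sum>j\<in>J. v j (c t j) e) - \<mu> e)"
    and best: "\<And>t j l. j \<in> J \<Longrightarrow> l \<in> Opt j \<Longrightarrow>
      (\<Sum>e\<in>E. r t e * v j (c t j) e) \<le> (\<Sum>e\<in>E. r t e * v j l e)"
    and B: "\<And>t e. e \<in> E \<Longrightarrow> \<bar>(\<Sum>j\<in>J. v j (c t j) e) - \<mu> e\<bar> \<le> B"
  shows "(\<Sum>e\<in>E. (r t e)\<^sup>2) \<le> real t * (real (card E) * B\<^sup>2)"
proof (induction t)
  case (Suc t)
  define d where "d = (\<lambda>e. (\<Sum>j\<in>J. v j (c t j) e) - \<mu> e)"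
  \<comment> \<open>The correlation with the residual splits into a sum over elements, so all of
    them may choose simultaneously.\<close>
  have "(\<Sum>e\<in>E. r t e * (\<Sum>j\<in>J. v j (c t j) e)) = (\<Sum>j\<in>J. \<Sum>e\<in>E. r t e * v j (c t j) e)"
    by (subst sum.swap) (simp add: sum_distrib_left)
  also have "\<dots> \<le> (\<Sum>j\<in>J. \<Sum>l\<in>L. w j l * (\<Sum>e\<in>E. r t e * v j l e))"
  proof (rule sum_mono)
    fix j assume j: "j \<in> J"
    have "(\<Sum>e\<in>E. r t e * v j (c t j) e) = (\<Sum>l\<in>L. w j l * (\<Sum>e\<in>E. r t e * v j (c t j) e))"
      using w(2)[OF j] by (simp flip: sum_distrib_right)
    also have "\<dots> \<le> (\<Sum>l\<in>L. w j l * (\<Sum>e\<in>E. r t e * v j l e))"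
    proof (rule sum_mono)
      fix l assume l: "l \<in> L"
      show "w j l * (\<Sum>e\<in>E. r t e * v j (c t j) e) \<le> w j l * (\<Sum>e\<in>E. r t e * v j l e)"
        by (cases "l \<in> Opt j") (use w(1)[OF j l] w(3)[OF j l] best[OF j] in \<open>auto intro!: mult_left_mono\<close>)
    qed
    finally show "(\<Sum>e\<in>E. r t e * v j (c t j) e) \<le> (\<Sum>l\<in>L. w j l * (\<Sum>e\<in>E. r t e * v j l e))" .
  qed
  also have "\<dots> = (\<Sum>j\<in>J. \<Sum>l\<in>L. \<Sum>e\<in>E. r t e * (w j l * v j l e))"
    by (simp add: sum_distrib_left mult_ac)
  also have "\<dots> = (\<Sum>j\<in>J. \<Sum>e\<in>E. \<Sum>l\<in>L. r t e * (w j l * v j l e))"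
    by (intro sum.cong refl sum.swap)
  also have "\<dots> = (\<Sum>e\<in>E. \<Sum>j\<in>J. \<Sum>l\<in>L. r t e * (w j l * v j l e))"
    by (rule sum.swap)
  also have "\<dots> = (\<Sum>e\<in>E. r t e * \<mu> e)"
    by (rule sum.cong) (simp_all add: w(4)[symmetric] sum_distrib_left)
  finally have corr: "(\<Sum>e\<in>E. r t e * d e) \<le> 0"
    by (simp add: d_def algebra_simps sum_subtractf)
  have "(\<Sum>e\<in>E. (d e)\<^sup>2) \<le> (\<Sum>e\<in>E. B\<^sup>2)"
  proof (rule sum_mono)
    fix e assume "e \<in> E"
    then have "\<bar>d e\<bar> \<le> B" using B by (simp add: d_def)
    then show "(d e)\<^sup>2 \<le> B\<^sup>2" by (metis abs_ge_zero power2_abs power_mono)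
  qed
  moreover have "(\<Sum>e\<in>E. (r (Suc t) e)\<^sup>2) = (\<Sum>e\<in>E. (r t e)\<^sup>2) + 2 * (\<Sum>e\<in>E. r t e * d e) + (\<Sum>e\<in>E. (d e)\<^sup>2)"
  proof -
    have "(\<Sum>e\<in>E. (r (Suc t) e)\<^sup>2) = (\<Sum>e\<in>E. (r t e + d e)\<^sup>2)"
      by (rule sum.cong) (simp_all add: r_Suc d_def)
    then show ?thesis by (simp add: power2_sum sum.distrib sum_distrib_left algebra_simps)
  qed
  ultimately show ?case using Suc.IH corr by (simp add: algebra_simps)
qed (simp add: r0)

section \<open>Multilinear extension\<close>

text \<open>The expected coverage when every \<open>j\<close> is present independently with
  probability \<open>p j\<close>.\<close>

definition ext :: "'a set set \<Rightarrow> ('a \<Rightarrow> real) \<Rightarrow> real" where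
  "ext \<C> p = (\<Sum>S\<in>\<C>. 1 - (\<Prod>j\<in>S. 1 - p j))"

definition grad :: "'a set set \<Rightarrow> ('a \<Rightarrow> real) \<Rightarrow> 'a \<Rightarrow> real" where
  "grad \<C> p j = (\<Sum>S\<in>{S \<in> \<C>. j \<in> S}. \<Prod>i\<in>S - {j}. 1 - p i)"

text \<open>Each dual set contains at most one element of \<open>I\<close>, so a single factor of
  its product changes and the increment is exactly linear.\<close>

lemma ext_affine:
  assumes "finite \<C>" "\<And>S. S \<in> \<C> \<Longrightarrow> finite S" "finite I"
    and indep: "\<And>S i j. S \<in> \<C> \<Longrightarrow> i \<in> I \<Longrightarrow> j \<in> I \<Longrightarrow> i \<in> S \<Longrightarrow> j \<in> S \<Longrightarrow> i = j"
    and eq: "\<And>j. j \<notin> I \<Longrightarrow> p' j = p j"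
  shows "ext \<C> p' - ext \<C> p = (\<Sum>j\<in>I. grad \<C> p j * (p' j - p j))"
proof -
  have "(\<Sum>j\<in>I. grad \<C> p j * (p' j - p j))
      = (\<Sum>j\<in>I. \<Sum>S\<in>\<C>. if j \<in> S then (\<Prod>i\<in>S - {j}. 1 - p i) * (p' j - p j) else 0)"
    using assms(1) by (simp add: grad_def sum_distrib_right sum.If_cases Int_def cong: conj_cong)
  also have "\<dots> = (\<Sum>S\<in>\<C>. \<Sum>j\<in>I. if j \<in> S then (\<Prod>i\<in>S - {j}. 1 - p i) * (p' j - p j) else 0)"
    by (rule sum.swap)
  also have "\<dots> = (\<Sum>S\<in>\<C>. (\<Prod>j\<in>S. 1 - p j) - (\<Prod>j\<in>S. 1 - p' j))"
  proof (rule sum.cong)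
    fix S assume S: "S \<in> \<C>"
    show "(\<Sum>j\<in>I. if j \<in> S then (\<Prod>i\<in>S - {j}. 1 - p i) * (p' j - p j) else 0)
        = (\<Prod>j\<in>S. 1 - p j) - (\<Prod>j\<in>S. 1 - p' j)"
    proof (cases "I \<inter> S = {}")
      case True
      then have "(\<Prod>j\<in>S. 1 - p' j) = (\<Prod>j\<in>S. 1 - p j)"
        using eq by (intro prod.cong) auto
      moreover have "(\<Sum>j\<in>I. if j \<in> S then (\<Prod>i\<in>S - {j}. 1 - p i) * (p' j - p j) else 0) = 0"
        using True by (intro sum.neutral) auto
      ultimately show ?thesis by simp
    next
      case False
      then obtain j where j: "j \<in> I" "j \<in> S" by blast
      have "(\<Sum>j\<in>I. if j \<in> S then (\<Prod>i\<in>S - {j}. 1 - p i) * (p' j - p j) else 0)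
          = (\<Sum>i\<in>{j}. if i \<in> S then (\<Prod>i'\<in>S - {i}. 1 - p i') * (p' i - p i) else 0)"
        using j indep[OF S] assms(3) by (intro sum.mono_neutral_right) auto
      also have "\<dots> = (\<Prod>i\<in>S - {j}. 1 - p i) * (p' j - p j)" using j by simp
      also have "(\<Prod>i\<in>S - {j}. 1 - p i) = (\<Prod>i\<in>S - {j}. 1 - p' i)"
      proof (rule prod.cong)
        fix i assume "i \<in> S - {j}"
        then have "i \<notin> I" using indep[OF S j(1) _ j(2)] by auto
        then show "1 - p i = 1 - p' i" by (simp add: eq)
      qed simp
      then have "(\<Prod>i\<in>S - {j}. 1 - p i) * (p' j - p j)
          = (1 - p j) * (\<Prod>i\<in>S - {j}. 1 - p i) - (1 - p' j) * (\<Prod>i\<in>S - {j}. 1 - p' i)"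
        by (simp add: algebra_simps)
      also have "\<dots> = (\<Prod>j\<in>S. 1 - p j) - (\<Prod>j\<in>S. 1 - p' j)"
        using j(2) assms(2)[OF S] by (simp add: prod.remove)
      finally show ?thesis .
    qed
  qed simp
  finally show ?thesis by (simp add: ext_def sum_subtractf)
qed

lemma grad_bounds:
  assumes "\<And>i. 0 \<le> p i" "\<And>i. p i \<le> 1"
  shows "0 \<le> grad \<C> p j" "grad \<C> p j \<le> real (card {S \<in> \<C>. j \<in> S})"
proof -
  show "0 \<le> grad \<C> p j" unfolding grad_def
    using assms by (intro sum_nonneg prod_nonneg) auto
  have "grad \<C> p j \<le> (\<Sum>S\<in>{S \<in> \<C>. j \<in> S}. 1)" unfolding grad_def
    using assms by (intro sum_mono prod_le_1) auto
  then show "grad \<C> p j \<le> real (card {S \<in> \<C>. j \<in> S})" by simp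
qed

text \<open>Distinct elements of \<open>I\<close> lie in disjoint groups of dual sets, and each
  gradient is at most the size of its group. This bounds a step independently of
  \<open>card I\<close>.\<close>

lemma sum_grad_le:
  assumes "finite \<C>" "finite I" "\<And>i. 0 \<le> p i" "\<And>i. p i \<le> 1"
    and indep: "\<And>S i j. S \<in> \<C> \<Longrightarrow> i \<in> I \<Longrightarrow> j \<in> I \<Longrightarrow> i \<in> S \<Longrightarrow> j \<in> S \<Longrightarrow> i = j"
  shows "(\<Sum>j\<in>I. grad \<C> p j) \<le> real (card \<C>)"
proof -
  have "(\<Sum>j\<in>I. grad \<C> p j) \<le> (\<Sum>j\<in>I. real (card {S \<in> \<C>. j \<in> S}))"
    by (intro sum_mono grad_bounds assms)
  also have "\<dots> = real (\<Sum>j\<in>I. card {S \<in> \<C>. j \<in> S})" by simp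
  also have "(\<Sum>j\<in>I. card {S \<in> \<C>. j \<in> S}) = card (\<Union>j\<in>I. {S \<in> \<C>. j \<in> S})"
    using assms(1,2) indep by (subst card_UN_disjoint) auto
  also have "\<dots> \<le> card \<C>" using assms(1) by (intro card_mono) auto
  finally show ?thesis by simp
qed

text \<open>A crude bound through the difference of two products; it serves the starting point,
  where colours have almost equal weights.\<close>

lemma ext_lipschitz:
  assumes "\<And>i. 0 \<le> p i" "\<And>i. p i \<le> 1" "\<And>i. 0 \<le> q i" "\<And>i. q i \<le> 1"
  shows "\<bar>ext \<C> p - ext \<C> q\<bar> \<le> (\<Sum>S\<in>\<C>. \<Sum>j\<in>S. \<bar>p j - q j\<bar>)"
proof -
  have "ext \<C> p - ext \<C> q = (\<Sum>S\<in>\<C>. (\<Prod>j\<in>S. 1 - q j) - (\<Prod>j\<in>S. 1 - p j))"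
    by (simp add: ext_def sum_subtractf[symmetric] algebra_simps)
  also have "\<bar>\<dots>\<bar> \<le> (\<Sum>S\<in>\<C>. \<bar>(\<Prod>j\<in>S. 1 - q j) - (\<Prod>j\<in>S. 1 - p j)\<bar>)" by (rule sum_abs)
  also have "\<dots> \<le> (\<Sum>S\<in>\<C>. \<Sum>j\<in>S. \<bar>p j - q j\<bar>)"
  proof (rule sum_mono)
    fix S
    have "norm ((\<Prod>j\<in>S. 1 - q j) - (\<Prod>j\<in>S. 1 - p j)) \<le> (\<Sum>j\<in>S. norm ((1 - q j) - (1 - p j)))"
      using assms by (intro norm_prod_diff) auto
    then show "\<bar>(\<Prod>j\<in>S. 1 - q j) - (\<Prod>j\<in>S. 1 - p j)\<bar> \<le> (\<Sum>j\<in>S. \<bar>p j - q j\<bar>)" by simp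
  qed
  finally show ?thesis .
qed

lemma coverage_eq_ext:
  assumes "\<And>S. S \<in> \<C> \<Longrightarrow> finite S"
  shows "coverage \<C> T = ext \<C> (indicator T)"
  unfolding coverage_def ext_def
proof (rule sum.cong)
  fix S assume "S \<in> \<C>"
  then have fin: "finite S" by (rule assms)
  show "min (real (card (S \<inter> T))) 1 = 1 - (\<Prod>j\<in>S. 1 - indicator T j)"
  proof (cases "S \<inter> T = {}")
    case True
    then have "(\<Prod>j\<in>S. 1 - indicator T j) = (\<Prod>j\<in>S. 1 :: real)"
      by (intro prod.cong) (auto simp: indicator_def)
    then show ?thesis using True by simp
  next
    case False
    then have "(\<Prod>j\<in>S. 1 - indicator T j) = (0 :: real)"
      using fin by (intro prod_zero) (auto simp: indicator_def)
    moreover have "card (S \<inter> T) \<ge> 1" using False fin by (simp add: Suc_le_eq card_gt_0_iff)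
    ultimately show ?thesis by simp
  qed
qed simp

section \<open>Randomized rounding\<close>

lemma mset_split: "mset (fst (split cs)) + mset (snd (split cs)) = mset cs"
  by (induction cs rule: rev_induct) (auto simp: split_def add.commute)

lemma length_split:
  "length (fst (split cs)) = length cs div 2" "length (snd (split cs)) = (length cs + 1) div 2"
  by (induction cs rule: rev_induct) (auto simp: split_def)

lemma foldl_halve_singleton: "length cs \<le> 1 \<Longrightarrow> foldl halve cs bs = cs"
  by (induction bs) (auto simp: halve_def)

lemma length_halve: "length cs = 2 ^ Suc L \<Longrightarrow> length (halve cs b) = 2 ^ L"
proof -
  assume cs: "length cs = 2 ^ Suc L"
  have "(1::nat) < 2 ^ Suc L" by (rule one_less_power) auto
  then have "\<not> length cs \<le> 1" using cs by linarith
  with cs show ?thesis by (auto simp: halve_def length_split)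
qed

text \<open>After \<open>L\<close> halvings a single entry is left, which later coins cannot
  change.\<close>

lemma pick_append: "length cs = 2 ^ L \<Longrightarrow> L \<le> length us \<Longrightarrow> pick cs (us @ vs) = pick cs us"
proof -
  assume "length cs = 2 ^ L" "L \<le> length us"
  then have "length (foldl halve cs us) \<le> 1"
  proof (induction us arbitrary: cs L)
    case (Cons b us)
    show ?case
    proof (cases L)
      case 0
      with Cons.prems have "length cs \<le> 1" by simp
      then show ?thesis by (simp only: foldl_halve_singleton)
    next
      case (Suc L')
      then show ?thesis using Cons.IH[of "halve cs b" L'] Cons.prems length_halve by simp
    qed
  qed simp
  then show ?thesis by (simp add: pick_def foldl_halve_singleton)
qed

lemma pick_in: "length cs = 2 ^ L \<Longrightarrow> pick cs bs \<in> set cs"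
proof -
  have "foldl halve cs bs \<noteq> [] \<and> set (foldl halve cs bs) \<subseteq> set cs" if "cs \<noteq> []"
    using that
  proof (induction bs arbitrary: cs)
    case (Cons b bs)
    have "set (fst (split cs)) \<subseteq> set cs" "set (snd (split cs)) \<subseteq> set cs"
      using mset_split[of cs] by (metis mset_subset_eq_add_left mset_subset_eq_add_right set_mset_mono set_mset_mset)+
    then have "set (halve cs b) \<subseteq> set cs" by (simp add: halve_def)
    moreover have "halve cs b \<noteq> []"
    proof
      assume h: "halve cs b = []"
      have "length (halve cs b) \<ge> 1"
      proof (cases "length cs \<le> 1")
        case True
        then show ?thesis using Cons.prems by (simp add: halve_def Suc_le_eq)
      next
        case False
        then have "length cs div 2 \<ge> 1" "(length cs + 1) div 2 \<ge> 1" by linarith+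
        then show ?thesis using False by (auto simp: halve_def length_split)
      qed
      with h show False by simp
    qed
    ultimately show ?case using Cons.IH[of "halve cs b"] by auto
  qed simp
  moreover assume "length cs = 2 ^ L"
  then have "cs \<noteq> []" by auto
  ultimately show ?thesis unfolding pick_def by (cases "foldl halve cs bs") auto
qed

text \<open>Each coin keeps exactly half of a list of even length, so every position is equally
  likely and a colour is picked with its weight.\<close>

lemma avg_pick:
  "length cs = 2 ^ L \<Longrightarrow> L \<le> B \<Longrightarrow> avg B (\<lambda>bs. h (pick cs bs)) = sum_list (map h cs) / 2 ^ L"
proof (induction L arbitrary: cs B)
  case 0
  then obtain c where "cs = [c]" by (auto simp: length_Suc_conv)
  then show ?case by (simp add: pick_def foldl_halve_singleton)
next
  case (Suc L)
  then obtain B' where B: "B = Suc B'" "L \<le> B'" by (cases B) auto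
  have IH: "avg B' (\<lambda>bs. h (pick (halve cs b) bs)) = sum_list (map h (halve cs b)) / 2 ^ L" for b
    by (rule Suc.IH) (use length_halve[OF Suc.prems(1)] B in auto)
  have "(1::nat) < 2 ^ Suc L" by (rule one_less_power) auto
  then have "\<not> length cs \<le> 1" using Suc.prems(1) by linarith
  then have halve: "halve cs True = fst (split cs)" "halve cs False = snd (split cs)"
    by (auto simp: halve_def)
  have "sum_list (map h (fst (split cs))) + sum_list (map h (snd (split cs)))
      = sum_mset (image_mset h (mset (fst (split cs)) + mset (snd (split cs))))"
    by (simp add: sum_mset_sum_list flip: mset_map)
  also have "\<dots> = sum_list (map h cs)"
    unfolding mset_split by (simp add: sum_mset_sum_list flip: mset_map)
  finally have sum: "sum_list (map h (fst (split cs))) + sum_list (map h (snd (split cs))) = sum_list (map h cs)" .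
  have "avg B (\<lambda>bs. h (pick cs bs))
      = (avg B' (\<lambda>bs. h (pick (halve cs True) bs)) + avg B' (\<lambda>bs. h (pick (halve cs False) bs))) / 2"
    by (simp add: B pick_def)
  also have "\<dots> = sum_list (map h cs) / 2 ^ Suc L"
    by (simp only: IH) (simp add: halve sum[symmetric] add_divide_distrib)
  finally show ?case .
qed

text \<open>The moment generating function of a centred Bernoulli variable. The known inequality
  covers \<open>s \<ge> 0\<close>; a negative \<open>s\<close> is handled by exchanging success and
  failure.\<close>

lemma hoeffding_two_point:
  fixes p s :: real
  assumes "0 \<le> p" "p \<le> 1"
  shows "p * exp (s * (1 - p)) + (1 - p) * exp (- s * p) \<le> exp (s\<^sup>2 / 8)"
proof -
  have *: "p * exp (s * (1 - p)) + (1 - p) * exp (- s * p) \<le> exp (s\<^sup>2 / 8)"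
    if "s \<ge> 0" "0 \<le> p" for s p :: real
  proof -
    have pos: "1 + p * (exp s - 1) > 0"
      using that by (intro add_pos_nonneg mult_nonneg_nonneg) auto
    have "p * exp (s * (1 - p)) + (1 - p) * exp (- s * p) = exp (- s * p) * (1 + p * (exp s - 1))"
      by (simp add: algebra_simps flip: exp_add)
    also have "\<dots> = exp (- s * p + ln (1 + p * (exp s - 1)))"
      by (simp only: exp_add exp_ln[OF pos])
    also have "\<dots> \<le> exp (s\<^sup>2 / 8)"
      using Hoeffdings_lemma_aux[of s p] that by simp
    finally show ?thesis .
  qed
  show ?thesis
  proof (cases "s \<ge> 0")
    case False
    then show ?thesis using *[of "- s" "1 - p"] assms by (simp add: algebra_simps)
  qed (use * assms in auto)
qed

definition weight :: "nat list \<Rightarrow> nat \<Rightarrow> real" where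
  "weight cs l = real (count_list cs l) / real (length cs)"

lemma weight_bounds: "0 \<le> weight cs l" "weight cs l \<le> 1"
  using count_le_length[of cs l] by (auto simp: weight_def divide_le_eq_1)

lemma weight_not_fractional:
  assumes "\<not> fractional e"
  shows "weight (snd e) l = 0 \<or> weight (snd e) l = 1"
proof (cases "snd e = []")
  case False
  with assms obtain c where "\<forall>c'\<in>set (snd e). c' = c" by (auto simp: fractional_def)
  then have "snd e = replicate (length (snd e)) c" by (metis replicate_eqI)
  moreover have "count_list (replicate r c) l = (if l = c then r else 0)" for r by (induction r) auto
  ultimately show ?thesis using False unfolding weight_def by (metis div_0 divide_self_if length_greater_0_conv of_nat_0 of_nat_0_eq_iff)
qed (simp add: weight_def)

text \<open>The vector of probabilities for colour \<open>l\<close> after the coins have been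
  exposed: elements are fixed one after the other, each by its own block of \<open>T\<close>
  coins.\<close>

fun rounded :: "nat \<Rightarrow> nat \<Rightarrow> frac_col \<Rightarrow> bool list \<Rightarrow> (nat \<Rightarrow> real) \<Rightarrow> nat \<Rightarrow> real" where
  "rounded T l [] bs q = q"
| "rounded T l (e # x) bs q = rounded T l x (drop T bs) (q(fst e := of_bool (pick (snd e) bs = l)))"

lemma sum_list_two_values:
  "sum_list (map (\<lambda>c. if c = l then a else b) cs)
     = real (count_list cs l) * a + (real (length cs) - real (count_list cs l)) * b" for a b :: real
  by (induction cs) (auto simp: algebra_simps)

text \<open>With the other coordinates frozen, \<open>ext\<close> is affine in coordinate
  \<open>j\<close> with slope in \<open>[0, t]\<close>. Rounding therefore adds a centred two-point
  variable of range at most \<open>t\<close>, and nothing at all if the coordinate is already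
  \<open>0\<close> or \<open>1\<close>.\<close>

lemma mgf_one_step:
  assumes "finite \<C>" "\<And>S. S \<in> \<C> \<Longrightarrow> finite S"
    and q: "\<And>i. 0 \<le> q i" "\<And>i. q i \<le> 1" "q j = weight cs l"
    and cs: "length cs = 2 ^ L" "L \<le> T"
    and t: "real (card {S \<in> \<C>. j \<in> S}) \<le> t"
  shows "avg T (\<lambda>us. exp (\<theta> * (ext \<C> (q(j := of_bool (pick cs us = l))) - ext \<C> q))) \<le> exp (\<theta>\<^sup>2 * t\<^sup>2 / 8)"
    and "q j = 0 \<or> q j = 1 \<Longrightarrow>
      avg T (\<lambda>us. exp (\<theta> * (ext \<C> (q(j := of_bool (pick cs us = l))) - ext \<C> q))) = 1"
proof -
  define p where "p = weight cs l"
  define g where "g = grad \<C> q j"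
  have p: "0 \<le> p" "p \<le> 1" using weight_bounds by (auto simp: p_def)
  have diff: "ext \<C> (q(j := a)) - ext \<C> q = g * (a - p)" for a
    using ext_affine[OF assms(1,2), of "{j}" "q(j := a)" q] q(3) by (simp add: g_def p_def)
  have len: "real (length cs) > 0" using cs(1) by simp
  have "avg T (\<lambda>us. exp (\<theta> * (ext \<C> (q(j := of_bool (pick cs us = l))) - ext \<C> q)))
      = avg T (\<lambda>us. (\<lambda>c. if c = l then exp (\<theta> * g * (1 - p)) else exp (- (\<theta> * g) * p)) (pick cs us))"
    by (intro avg_cong) (auto simp: diff)
  also have "\<dots> = sum_list (map (\<lambda>c. if c = l then exp (\<theta> * g * (1 - p)) else exp (- (\<theta> * g) * p)) cs) / 2 ^ L"
    by (rule avg_pick[OF cs])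
  also have "(2 :: real) ^ L = real (length cs)" using cs(1) by simp
  also have "sum_list (map (\<lambda>c. if c = l then exp (\<theta> * g * (1 - p)) else exp (- (\<theta> * g) * p)) cs) / real (length cs)
      = p * exp (\<theta> * g * (1 - p)) + (1 - p) * exp (- (\<theta> * g) * p)"
    using len unfolding sum_list_two_values by (simp add: p_def weight_def field_simps)
  finally have eq: "avg T (\<lambda>us. exp (\<theta> * (ext \<C> (q(j := of_bool (pick cs us = l))) - ext \<C> q)))
      = p * exp (\<theta> * g * (1 - p)) + (1 - p) * exp (- (\<theta> * g) * p)" .
  have "0 \<le> g" "g \<le> t" using grad_bounds[of q \<C> j, OF q(1,2)] t by (auto simp: g_def)
  then have "\<theta>\<^sup>2 * g\<^sup>2 \<le> \<theta>\<^sup>2 * t\<^sup>2" by (intro mult_left_mono power_mono) auto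
  then have "exp ((\<theta> * g)\<^sup>2 / 8) \<le> exp (\<theta>\<^sup>2 * t\<^sup>2 / 8)" by (simp add: power_mult_distrib)
  with hoeffding_two_point[OF p, of "\<theta> * g"]
  show "avg T (\<lambda>us. exp (\<theta> * (ext \<C> (q(j := of_bool (pick cs us = l))) - ext \<C> q))) \<le> exp (\<theta>\<^sup>2 * t\<^sup>2 / 8)"
    unfolding eq by linarith
  show "q j = 0 \<or> q j = 1 \<Longrightarrow>
      avg T (\<lambda>us. exp (\<theta> * (ext \<C> (q(j := of_bool (pick cs us = l))) - ext \<C> q))) = 1"
    unfolding eq q(3) p_def[symmetric] by auto
qed

text \<open>The argument of McDiarmid without martingales: by multilinearity \<open>ext\<close> at
  the partially rounded vector is the conditional mean, so the one-step bounds multiply. Only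
  fractional elements contribute a factor above \<open>1\<close>.\<close>

lemma mgf_rounded:
  assumes C: "finite \<C>" "\<And>S. S \<in> \<C> \<Longrightarrow> finite S"
    and t: "\<And>e. e \<in> set x \<Longrightarrow> real (card {S \<in> \<C>. fst e \<in> S}) \<le> t"
    and x: "distinct (map fst x)" "\<And>e. e \<in> set x \<Longrightarrow> length (snd e) = 2 ^ L" "L \<le> T"
    and q: "\<And>i. 0 \<le> q i" "\<And>i. q i \<le> 1" "\<And>e. e \<in> set x \<Longrightarrow> q (fst e) = weight (snd e) l"
  shows "avg (length x * T) (\<lambda>bs. exp (\<theta> * (ext \<C> (rounded T l x bs q) - ext \<C> q)))
    \<le> exp (\<theta>\<^sup>2 * t\<^sup>2 / 8 * real (length (filter fractional x)))"
  using t x q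
proof (induction x arbitrary: q)
  case (Cons e x)
  define q1 where "q1 = (\<lambda>us. q(fst e := of_bool (pick (snd e) us = l)))"
  define N where "N = real (length (filter fractional x))"
  have len: "length (snd e) = 2 ^ L" and le: "L \<le> T" using Cons.prems by auto
  have IH: "avg (length x * T) (\<lambda>bs. exp (\<theta> * (ext \<C> (rounded T l x bs (q1 us)) - ext \<C> (q1 us))))
      \<le> exp (\<theta>\<^sup>2 * t\<^sup>2 / 8 * N)" for us
    unfolding N_def
  proof (rule Cons.IH)
    fix e' assume e': "e' \<in> set x"
    then have "fst e' \<in> fst ` set x" by simp
    then have "fst e' \<noteq> fst e" using Cons.prems(2) by (metis distinct.simps(2) list.simps(9) set_map)
    then show "q1 us (fst e') = weight (snd e') l"
      using Cons.prems(7)[of e'] e' by (simp add: q1_def)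
  qed (use Cons.prems in \<open>auto simp: q1_def\<close>)
  have "avg (length (e # x) * T) (\<lambda>bs. exp (\<theta> * (ext \<C> (rounded T l (e # x) bs q) - ext \<C> q)))
      = avg T (\<lambda>us. avg (length x * T) (\<lambda>vs. exp (\<theta> * (ext \<C> (rounded T l (e # x) (us @ vs) q) - ext \<C> q))))"
    by (simp add: avg_add)
  also have "\<dots> = avg T (\<lambda>us. exp (\<theta> * (ext \<C> (q1 us) - ext \<C> q)) *
      avg (length x * T) (\<lambda>vs. exp (\<theta> * (ext \<C> (rounded T l x vs (q1 us)) - ext \<C> (q1 us)))))"
  proof (rule avg_cong)
    fix us :: "bool list" assume us: "length us = T"
    have "rounded T l (e # x) (us @ vs) q = rounded T l x vs (q1 us)" for vs
      using us pick_append[OF len] le by (simp add: q1_def)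
    then show "avg (length x * T) (\<lambda>vs. exp (\<theta> * (ext \<C> (rounded T l (e # x) (us @ vs) q) - ext \<C> q)))
        = exp (\<theta> * (ext \<C> (q1 us) - ext \<C> q)) *
          avg (length x * T) (\<lambda>vs. exp (\<theta> * (ext \<C> (rounded T l x vs (q1 us)) - ext \<C> (q1 us))))"
      by (simp only: avg_mult_left[symmetric]) (simp add: algebra_simps flip: exp_add)
  qed
  also have "\<dots> \<le> avg T (\<lambda>us. exp (\<theta> * (ext \<C> (q1 us) - ext \<C> q)) * exp (\<theta>\<^sup>2 * t\<^sup>2 / 8 * N))"
    by (intro avg_mono mult_left_mono IH) auto
  also have "\<dots> = avg T (\<lambda>us. exp (\<theta> * (ext \<C> (q1 us) - ext \<C> q))) * exp (\<theta>\<^sup>2 * t\<^sup>2 / 8 * N)"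
    by (rule avg_mult_right)
  also have "\<dots> \<le> exp (\<theta>\<^sup>2 * t\<^sup>2 / 8 * real (length (filter fractional (e # x))))"
  proof (cases "fractional e")
    case True
    have "avg T (\<lambda>us. exp (\<theta> * (ext \<C> (q1 us) - ext \<C> q))) \<le> exp (\<theta>\<^sup>2 * t\<^sup>2 / 8)"
      unfolding q1_def
      by (rule mgf_one_step(1)[OF C Cons.prems(5,6) _ len le]) (use Cons.prems(1,7) in auto)
    then have "avg T (\<lambda>us. exp (\<theta> * (ext \<C> (q1 us) - ext \<C> q))) * exp (\<theta>\<^sup>2 * t\<^sup>2 / 8 * N)
        \<le> exp (\<theta>\<^sup>2 * t\<^sup>2 / 8) * exp (\<theta>\<^sup>2 * t\<^sup>2 / 8 * N)" by (intro mult_right_mono) auto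
    also have "\<dots> = exp (\<theta>\<^sup>2 * t\<^sup>2 / 8 * real (length (filter fractional (e # x))))"
      using True by (simp add: N_def algebra_simps flip: exp_add)
    finally show ?thesis .
  next
    case False
    have "avg T (\<lambda>us. exp (\<theta> * (ext \<C> (q1 us) - ext \<C> q))) = 1"
      unfolding q1_def
      by (rule mgf_one_step(2)[OF C Cons.prems(5,6) _ len le, where j = "fst e" and l = l and t = t])
         (use Cons.prems(1,7) weight_not_fractional[OF False] in auto)
    then show ?thesis using False by (simp add: N_def)
  qed
  finally show ?case .
qed simp

lemma deviation_rounded:
  assumes C: "finite \<C>" "\<And>S. S \<in> \<C> \<Longrightarrow> finite S"
    and t: "\<And>e. e \<in> set x \<Longrightarrow> real (card {S \<in> \<C>. fst e \<in> S}) \<le> t" "t > 0"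
    and x: "distinct (map fst x)" "\<And>e. e \<in> set x \<Longrightarrow> length (snd e) = 2 ^ L" "L \<le> T"
    and q: "\<And>i. 0 \<le> q i" "\<And>i. q i \<le> 1" "\<And>e. e \<in> set x \<Longrightarrow> q (fst e) = weight (snd e) l"
    and N: "real (length (filter fractional x)) \<le> N" "N > 0" and \<mu>: "\<mu> \<ge> 0"
  shows "avg (length x * T) (\<lambda>bs. of_bool (\<bar>ext \<C> (rounded T l x bs q) - ext \<C> q\<bar> \<ge> \<mu>))
    \<le> 2 * exp (- 2 * \<mu>\<^sup>2 / (N * t\<^sup>2))"
proof -
  \<comment> \<open>The minimiser of the exponent
    \<open>\<theta>\<^sup>2 * t\<^sup>2 / 8 * N - \<theta> * \<mu>\<close>.\<close>
  define \<theta> where "\<theta> = 4 * \<mu> / (N * t\<^sup>2)"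
  define d where "d = (\<lambda>bs. ext \<C> (rounded T l x bs q) - ext \<C> q)"
  have \<theta>: "\<theta> \<ge> 0" using N t(2) \<mu> by (simp add: \<theta>_def)
  have mgf: "avg (length x * T) (\<lambda>bs. exp (\<theta>' * d bs)) \<le> exp (\<theta>\<^sup>2 * t\<^sup>2 / 8 * N)" if "\<theta>'\<^sup>2 = \<theta>\<^sup>2" for \<theta>'
  proof -
    have "avg (length x * T) (\<lambda>bs. exp (\<theta>' * d bs)) \<le> exp (\<theta>'\<^sup>2 * t\<^sup>2 / 8 * real (length (filter fractional x)))"
      unfolding d_def by (rule mgf_rounded[OF C t(1) x q])
    also have "\<dots> \<le> exp (\<theta>\<^sup>2 * t\<^sup>2 / 8 * N)" using N that by (simp add: mult_left_mono)
    finally show ?thesis .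
  qed
  have "avg (length x * T) (\<lambda>bs. of_bool (\<bar>d bs\<bar> \<ge> \<mu>))
      \<le> avg (length x * T) (\<lambda>bs. exp (- \<theta> * \<mu>) * exp (\<theta> * d bs) + exp (- \<theta> * \<mu>) * exp (- \<theta> * d bs))"
  proof (rule avg_mono)
    fix bs :: "bool list"
    show "of_bool (\<bar>d bs\<bar> \<ge> \<mu>) \<le> exp (- \<theta> * \<mu>) * exp (\<theta> * d bs) + exp (- \<theta> * \<mu>) * exp (- \<theta> * d bs)"
    proof (cases "\<bar>d bs\<bar> \<ge> \<mu>")
      case True
      then consider "\<theta> * \<mu> \<le> \<theta> * d bs" | "\<theta> * \<mu> \<le> \<theta> * (- d bs)"
        using mult_left_mono[of \<mu> "d bs" \<theta>] mult_left_mono[of \<mu> "- d bs" \<theta>] \<theta>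
        by (cases "d bs \<ge> 0") auto
      then show ?thesis
      proof cases
        case 1
        then have "1 \<le> exp (- \<theta> * \<mu>) * exp (\<theta> * d bs)" by (simp flip: exp_add)
        moreover have "0 \<le> exp (- \<theta> * \<mu>) * exp (- \<theta> * d bs)" by simp
        ultimately show ?thesis unfolding of_bool_eq_1_iff[THEN iffD2, OF True] by linarith
      next
        case 2
        then have "1 \<le> exp (- \<theta> * \<mu>) * exp (- \<theta> * d bs)" by (simp flip: exp_add)
        moreover have "0 \<le> exp (- \<theta> * \<mu>) * exp (\<theta> * d bs)" by simp
        ultimately show ?thesis unfolding of_bool_eq_1_iff[THEN iffD2, OF True] by linarith
      qed
    qed simp
  qed
  also have "\<dots> = exp (- \<theta> * \<mu>) * (avg (length x * T) (\<lambda>bs. exp (\<theta> * d bs)) + avg (length x * T) (\<lambda>bs. exp (- \<theta> * d bs)))"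
    by (simp only: avg_plus avg_mult_left distrib_left)
  also have "\<dots> \<le> exp (- \<theta> * \<mu>) * (exp (\<theta>\<^sup>2 * t\<^sup>2 / 8 * N) + exp (\<theta>\<^sup>2 * t\<^sup>2 / 8 * N))"
    by (intro mult_left_mono add_mono mgf) auto
  also have "\<dots> = 2 * exp (\<theta>\<^sup>2 * t\<^sup>2 / 8 * N - \<theta> * \<mu>)"
  proof -
    have "exp (\<theta>\<^sup>2 * t\<^sup>2 / 8 * N - \<theta> * \<mu>) = exp (- \<theta> * \<mu>) * exp (\<theta>\<^sup>2 * t\<^sup>2 / 8 * N)"
      unfolding exp_add[symmetric] by (simp add: algebra_simps)
    then show ?thesis by simp
  qed
  also have "\<theta>\<^sup>2 * t\<^sup>2 / 8 * N - \<theta> * \<mu> = - 2 * \<mu>\<^sup>2 / (N * t\<^sup>2)"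
    using N t(2) by (simp add: \<theta>_def power2_eq_square field_simps)
  finally show ?thesis unfolding d_def .
qed

lemma rounded_nth:
  assumes "distinct (map fst x)" "i < length x"
  shows "rounded T l x bs q (fst (x ! i)) = of_bool (pick (snd (x ! i)) (drop (i * T) bs) = l)"
  using assms
proof (induction x arbitrary: i bs q)
  case (Cons e x)
  show ?case
  proof (cases i)
    case 0
    have "rounded T l x bs q j = q j" if "j \<notin> fst ` set x" for bs q j
      using that by (induction x arbitrary: bs q) auto
    then show ?thesis using 0 Cons.prems by simp
  next
    case (Suc i')
    then show ?thesis using Cons by (simp add: add.commute)
  qed
qed simp

section \<open>Correctness of the relaxation\<close>

text \<open>The third claim is maximality: a rejected element conflicts with one chosen earlier, and
  conflicts persist while the set grows.\<close>

lemma indep_properties: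
  defines "keys \<equiv> \<lambda>x :: frac_col. {fst e | e. e \<in> set x \<and> fractional e}"
  shows "set (indep Ss x) \<subseteq> keys x"
    "S \<in> set Ss \<Longrightarrow> i \<in> set (indep Ss x) \<Longrightarrow> j \<in> set (indep Ss x) \<Longrightarrow> i \<in> set S \<Longrightarrow> j \<in> set S \<Longrightarrow> i = j"
    "e \<in> set x \<Longrightarrow> fractional e \<Longrightarrow> fst e \<in> set (indep Ss x) \<or> conflict Ss (indep Ss x) (fst e)"
proof -
  have "set (indep Ss x) \<subseteq> keys x \<and>
    (\<forall>S\<in>set Ss. \<forall>i\<in>set (indep Ss x). \<forall>j\<in>set (indep Ss x). i \<in> set S \<longrightarrow> j \<in> set S \<longrightarrow> i = j) \<and>
    (\<forall>e\<in>set x. fractional e \<longrightarrow> fst e \<in> set (indep Ss x) \<or> conflict Ss (indep Ss x) (fst e))"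
  proof (induction x rule: rev_induct)
    case (snoc e x)
    have eq: "indep Ss (x @ [e]) = indep_add Ss (indep Ss x) e" by (simp add: indep_def)
    show ?case
    proof (cases "fractional e \<and> \<not> conflict Ss (indep Ss x) (fst e)")
      case True
      then have "indep Ss (x @ [e]) = fst e # indep Ss x" by (simp add: eq indep_add_def)
      then have I: "set (indep Ss (x @ [e])) = insert (fst e) (set (indep Ss x))" by simp
      have new: False if "S \<in> set Ss" "i \<in> set (indep Ss x)" "i \<in> set S" "fst e \<in> set S" for S i
        using True that unfolding conflict_def by blast
      have mono: "conflict Ss (indep Ss (x @ [e])) a" if "conflict Ss (indep Ss x) a" for a
        using that unfolding conflict_def I by blast
      have "set (indep Ss (x @ [e])) \<subseteq> keys (x @ [e])"
      proof -
        have "fst e \<in> keys (x @ [e])" unfolding keys_def using True by (intro CollectI exI[of _ e]) simp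
        moreover have "keys x \<subseteq> keys (x @ [e])" unfolding keys_def by auto
        ultimately show ?thesis using conjunct1[OF snoc.IH] unfolding I by blast
      qed
      moreover have "\<forall>S\<in>set Ss. \<forall>i\<in>set (indep Ss (x @ [e])). \<forall>j\<in>set (indep Ss (x @ [e])).
          i \<in> set S \<longrightarrow> j \<in> set S \<longrightarrow> i = j"
        unfolding I using conjunct1[OF conjunct2[OF snoc.IH]] new by (metis insert_iff)
      moreover have "\<forall>e'\<in>set (x @ [e]). fractional e' \<longrightarrow> fst e' \<in> set (indep Ss (x @ [e])) \<or>
          conflict Ss (indep Ss (x @ [e])) (fst e')"
      proof (intro ballI impI)
        fix e' assume e': "e' \<in> set (x @ [e])" "fractional e'"
        then consider "e' = e" | "e' \<in> set x" by auto
        then show "fst e' \<in> set (indep Ss (x @ [e])) \<or> conflict Ss (indep Ss (x @ [e])) (fst e')"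
        proof cases
          case 2
          then have "fst e' \<in> set (indep Ss x) \<or> conflict Ss (indep Ss x) (fst e')"
            using conjunct2[OF conjunct2[OF snoc.IH]] e'(2) by blast
          then show ?thesis using mono unfolding I by blast
        qed (simp add: I)
      qed
      ultimately show ?thesis by blast
    next
      case False
      then have I: "indep Ss (x @ [e]) = indep Ss x" by (simp only: eq indep_add_def if_False)
      have "keys x \<subseteq> keys (x @ [e])" unfolding keys_def by auto
      moreover have "\<forall>e'\<in>set (x @ [e]). fractional e' \<longrightarrow> fst e' \<in> set (indep Ss x) \<or>
          conflict Ss (indep Ss x) (fst e')"
        using conjunct2[OF conjunct2[OF snoc.IH]] False by simp
      ultimately show ?thesis unfolding I using snoc.IH by blast
    qed
  qed (simp add: indep_def keys_def)
  then show "set (indep Ss x) \<subseteq> keys x"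
    "S \<in> set Ss \<Longrightarrow> i \<in> set (indep Ss x) \<Longrightarrow> j \<in> set (indep Ss x) \<Longrightarrow> i \<in> set S \<Longrightarrow> j \<in> set S \<Longrightarrow> i = j"
    "e \<in> set x \<Longrightarrow> fractional e \<Longrightarrow> fst e \<in> set (indep Ss x) \<or> conflict Ss (indep Ss x) (fst e)"
    by blast+
qed

lemma count_list_map_Pair:
  "distinct js \<Longrightarrow> count_list (map (\<lambda>j. (j, c j)) js) (j, l) = of_bool (j \<in> set js \<and> c j = l)"
  by (induction js) auto

lemma map_of_map_Pair: "map_of (map (\<lambda>j. (j, f j)) js) j = (if j \<in> set js then Some (f j) else None)"
  by (induction js) auto

lemma count_list_distinct: "distinct js \<Longrightarrow> count_list js j = of_bool (j \<in> set js)"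
  by (induction js) auto

lemma count_list_append: "count_list (xs @ ys) a = count_list xs a + count_list ys a"
  by (induction xs) auto

lemma count_list_select: "count_list (map snd (filter (\<lambda>d. fst d = j) D)) l = count_list D (j, l)"
  by (induction D) auto

text \<open>The right-hand side is \<open>(T - r) / k\<close> rounded up, the number of
  \<open>i < T\<close> with remainder \<open>r\<close>; it grows precisely when
  \<open>T mod k = r\<close>.\<close>

lemma count_mod:
  assumes "r < k"
  shows "count_list (map (\<lambda>i. i mod k + 1) [0..<T]) (Suc r) = (T + k - 1 - r) div k"
proof (induction T)
  case 0
  then show ?case using assms by simp
next
  case (Suc T)
  have mod: "Suc (T + k - 1 - r) mod k = 0 \<longleftrightarrow> T mod k = r"
  proof -
    have "Suc (T + k - 1 - r) = T + (k - r)" using assms by simp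
    moreover have "(T + (k - r)) mod k = (T mod k + (k - r)) mod k" by (simp add: mod_add_left_eq)
    moreover have "(T mod k + (k - r)) mod k = 0 \<longleftrightarrow> T mod k = r"
    proof -
      define b where "b = T mod k"
      have b: "b < k" using assms by (simp add: b_def)
      consider "b < r" | "b = r" | "b > r" by linarith
      then have "(b + (k - r)) mod k = 0 \<longleftrightarrow> b = r"
      proof cases
        case 1
        then have "b + (k - r) < k" "b + (k - r) > 0" using assms by auto
        then show ?thesis using 1 assms by simp
      next
        case 3
        then have e: "b + (k - r) = (b - r) + k" and "b - r < k" using assms b by auto
        then have "(b + (k - r)) mod k = b - r" unfolding e by simp
        then show ?thesis using 3 by simp
      qed (use assms in auto)
      then show ?thesis by (simp add: b_def)
    qed
    ultimately show ?thesis by simp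
  qed
  have suc: "Suc T + k - 1 - r = Suc (T + k - 1 - r)" using assms by simp
  have "count_list (map (\<lambda>i. i mod k + 1) [0..<Suc T]) (Suc r)
      = count_list (map (\<lambda>i. i mod k + 1) [0..<T]) (Suc r) + (if T mod k = r then 1 else 0)"
    by (simp add: count_list_append)
  also have "\<dots> = (if Suc (T + k - 1 - r) mod k = 0 then Suc ((T + k - 1 - r) div k) else (T + k - 1 - r) div k)"
    unfolding mod Suc.IH by simp
  also have "\<dots> = (Suc T + k - 1 - r) div k"
    by (simp only: suc div_Suc)
  finally show ?case .
qed

declare upt_Suc [simp del] One_nat_def [simp del]

lemma ivl_plus_one [simp]: "{a..<b + 1} = {a..b :: nat}"
  by auto

text \<open>The parameters of the algorithm in the case \<open>k < n\<close>, with \<open>u\<close>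
  dominating every measure of the input that the error analysis meets, including the total size of
  the dual sets of one function.\<close>

locale relaxation =
  fixes n k T L u :: nat and Fs :: "nat list list list"
  assumes Fs: "\<And>F. F \<in> set Fs \<Longrightarrow> distinct (map set F)"
      "\<And>F S. F \<in> set Fs \<Longrightarrow> S \<in> set F \<Longrightarrow> distinct S \<and> set S \<subseteq> {1..n}"
    and k: "1 \<le> k" "k < n"
    and T: "T = 2 ^ L" "u ^ 16 \<le> T"
    and u: "4 \<le> u" "n \<le> u" "length Fs \<le> u" "\<And>F. F \<in> set Fs \<Longrightarrow> length F \<le> u"
      "\<And>F. F \<in> set Fs \<Longrightarrow> sum_list (map length F) \<le> u"
begin

definition w :: params where "w = ([0..<T], [1..<k + 1], u, Fs)"

definition fam :: "nat \<Rightarrow> nat set set" where "fam i = set ` set (Fs ! i)"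

definition valid :: "frac_col \<Rightarrow> bool" where
  "valid x \<longleftrightarrow> map fst x = [1..<n + 1] \<and> (\<forall>e\<in>set x. length (snd e) = T \<and> set (snd e) \<subseteq> {1..k})"

definition cols :: "frac_col \<Rightarrow> nat \<Rightarrow> nat list" where "cols x j = the (map_of x j)"

text \<open>Extended by \<open>0\<close> outside the ground set because the lemmas on
  \<open>ext\<close> and \<open>grad\<close> ask for values in the unit interval at every
  index.\<close>

definition pr :: "frac_col \<Rightarrow> nat \<Rightarrow> nat \<Rightarrow> real" where
  "pr x l j = (if j \<in> {1..n} then weight (cols x j) l else 0)"

lemma T_pos: "T > 0" using T by simp

lemma valid_eq:
  assumes "valid x"
  shows "x = map (\<lambda>j. (j, cols x j)) [1..<n + 1]"
proof -
  have d: "distinct (map fst x)" using assms by (simp add: valid_def)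
  have keys: "map fst x = [1..<n + 1]" using assms by (simp add: valid_def)
  have "map (\<lambda>j. (j, cols x j)) (map fst x) = map (\<lambda>e. e) x"
    unfolding map_map comp_def by (rule map_cong) (use d in \<open>auto simp: cols_def\<close>)
  then show ?thesis unfolding keys by simp
qed

lemma cols_eq:
  assumes "valid x" "e \<in> set x"
  shows "snd e = cols x (fst e)" "fst e \<in> {1..n}"
proof -
  have "e \<in> set (map (\<lambda>j. (j, cols x j)) [1..<n + 1])"
    using assms(2) valid_eq[OF assms(1)] by simp
  then show "snd e = cols x (fst e)" "fst e \<in> {1..n}" by auto
qed

lemma cols_mem:
  assumes "valid x" "j \<in> {1..n}"
  shows "(j, cols x j) \<in> set x"
proof -
  have "(j, cols x j) \<in> set (map (\<lambda>j. (j, cols x j)) [1..<n + 1])" using assms(2) by auto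
  then show ?thesis using valid_eq[OF assms(1)] by simp
qed

lemma cols_valid:
  assumes "valid x" "j \<in> {1..n}"
  shows "length (cols x j) = T \<and> set (cols x j) \<subseteq> {1..k}"
proof -
  have "\<forall>e\<in>set x. length (snd e) = T \<and> set (snd e) \<subseteq> {1..k}" using assms(1) by (simp add: valid_def)
  from bspec[OF this cols_mem[OF assms]] show ?thesis unfolding snd_conv .
qed

lemma pr_bounds: "0 \<le> pr x l j" "pr x l j \<le> 1"
  using weight_bounds by (auto simp: pr_def)

lemma pr_count: "valid x \<Longrightarrow> j \<in> {1..n} \<Longrightarrow> real (count_list (cols x j) l) = real T * pr x l j"
  using cols_valid[of x j] T_pos by (simp add: pr_def weight_def)

lemma sum_pr:
  assumes "valid x" "j \<in> {1..n}"
  shows "(\<Sum>l\<in>{1..k}. pr x l j) = 1"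
proof -
  have "(\<Sum>l\<in>{1..k}. count_list (cols x j) l) = (\<Sum>l\<in>set (cols x j). count_list (cols x j) l)"
    using cols_valid[OF assms] by (intro sum.mono_neutral_right) (auto simp: count_list_0_iff)
  also have "\<dots> = T" using cols_valid[OF assms] by (simp add: sum_count_set)
  finally have "(\<Sum>l\<in>{1..k}. real (count_list (cols x j) l)) = real T"
    by (simp only: of_nat_sum[symmetric])
  then show ?thesis using T_pos by (simp add: pr_count[OF assms] flip: sum_distrib_left)
qed

lemma pr_pos_iff:
  assumes "valid x" "j \<in> {1..n}"
  shows "pr x l j > 0 \<longleftrightarrow> l \<in> set (cols x j)"
proof -
  have "pr x l j > 0 \<longleftrightarrow> real (count_list (cols x j) l) > 0"
    unfolding pr_count[OF assms] using T_pos by (simp add: zero_less_mult_iff)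
  also have "\<dots> \<longleftrightarrow> count_list (cols x j) l \<noteq> 0" by simp
  also have "\<dots> \<longleftrightarrow> l \<in> set (cols x j)" by (simp only: count_list_0_iff) simp
  finally show ?thesis .
qed

lemma fam_finite: "finite (fam i)" by (simp add: fam_def)

lemma fam_sub: "i < length Fs \<Longrightarrow> S \<in> fam i \<Longrightarrow> finite S \<and> S \<subseteq> {1..n}"
  using Fs(2)[of "Fs ! i"] by (auto simp: fam_def)

lemma card_fam_le: "i < length Fs \<Longrightarrow> card (fam i) \<le> u"
  using u(4)[of "Fs ! i"] card_image_le[of "set (Fs ! i)" set] card_length[of "Fs ! i"]
  by (simp add: fam_def)

text \<open>Elements outside \<open>S\<close> contribute a full factor \<open>T\<close>, which makes
  the scale \<open>T ^ n\<close> common to all dual sets.\<close>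

lemma real_prodw:
  assumes "valid x" "set S \<subseteq> {1..n}"
  shows "real_of_int (prodw T x l S) = real T ^ n * (\<Prod>j\<in>set S. 1 - pr x l j)"
proof -
  have "real_of_int (prodw T x l S) = prod_list (map (\<lambda>e. if fst e \<in> set S then real T - real (count_list (snd e) l) else real T) x)"
  proof -
    have "real_of_int (prod_list ys) = prod_list (map real_of_int ys)" for ys by (induction ys) auto
    then show ?thesis by (simp add: prodw_def comp_def if_distrib cong: if_cong)
  qed
  also have "\<dots> = prod_list (map (\<lambda>j. if j \<in> set S then real T - real (count_list (cols x j) l) else real T) [1..<n + 1])"
    by (subst (1) valid_eq[OF assms(1)]) (simp add: comp_def cong: if_cong)
  also have "\<dots> = (\<Prod>j\<in>set [1..<n + 1]. if j \<in> set S then real T - real (count_list (cols x j) l) else real T)"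
    by (subst prod.distinct_set_conv_list) simp_all
  also have "\<dots> = (\<Prod>j\<in>{1..n}. real T * (if j \<in> set S then 1 - pr x l j else 1))"
  proof (rule prod.cong)
    fix j assume "j \<in> {1..n}"
    then have "real (count_list (cols x j) l) = real T * pr x l j" by (rule pr_count[OF assms(1)])
    then show "(if j \<in> set S then real T - real (count_list (cols x j) l) else real T)
        = real T * (if j \<in> set S then 1 - pr x l j else 1)"
      by (simp add: right_diff_distrib)
  qed simp
  also have "\<dots> = real T ^ n * (\<Prod>j\<in>{1..n}. if j \<in> set S then 1 - pr x l j else 1)"
    by (simp add: prod.distrib)
  also have "(\<Prod>j\<in>{1..n}. if j \<in> set S then 1 - pr x l j else 1) = (\<Prod>j\<in>set S. 1 - pr x l j)"
    using assms(2) by (simp add: prod.If_cases Int_absorb1)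
  finally show ?thesis .
qed

lemma real_coef:
  assumes "valid x" "i < length Fs"
  shows "real_of_int (coef T x (Fs ! i) j l) = real T ^ n * grad (fam i) (pr x l) j"
proof -
  define F where "F = Fs ! i"
  have F: "distinct (map set F)" "\<And>S. S \<in> set F \<Longrightarrow> set S \<subseteq> {1..n}"
    using Fs[of F] assms(2) by (auto simp: F_def)
  define G where "G = (\<lambda>S. real T ^ n * (\<Prod>i\<in>S - {j}. 1 - pr x l i))"
  have "real_of_int (sum_list ys) = sum_list (map real_of_int ys)" for ys by (induction ys) auto
  then have "real_of_int (coef T x F j l) =
      sum_list (map (\<lambda>S. real_of_int (prodw T x l (filter (\<lambda>i. \<not> i = j) S))) (filter (\<lambda>S. j \<in> set S) F))"
    by (simp add: coef_def comp_def)
  also have "\<dots> = sum_list (map (\<lambda>S. G (set S)) (filter (\<lambda>S. j \<in> set S) F))"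
  proof (intro arg_cong[where f = sum_list] map_cong refl)
    fix S assume "S \<in> set (filter (\<lambda>S. j \<in> set S) F)"
    then have "set (filter (\<lambda>i. \<not> i = j) S) \<subseteq> {1..n}" using F(2)[of S] by auto
    moreover have "set (filter (\<lambda>i. \<not> i = j) S) = set S - {j}" by auto
    ultimately show "real_of_int (prodw T x l (filter (\<lambda>i. \<not> i = j) S)) = G (set S)"
      using real_prodw[OF assms(1)] by (simp add: G_def)
  qed
  also have "\<dots> = sum_list (map G (map set (filter (\<lambda>S. j \<in> set S) F)))" by (simp add: comp_def)
  also have "\<dots> = sum G (set (map set (filter (\<lambda>S. j \<in> set S) F)))"
    by (rule sum.distinct_set_conv_list[symmetric]) (rule distinct_map_filter[OF F(1)])
  also have "set (map set (filter (\<lambda>S. j \<in> set S) F)) = {S \<in> fam i. j \<in> S}"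
    by (auto simp: fam_def F_def)
  finally show ?thesis by (simp add: F_def G_def grad_def sum_distrib_left)
qed

end

section \<open>One attempt to reach the face given by a candidate\<close>

locale attempt_step = relaxation +
  fixes x :: frac_col and c :: "nat \<times> nat"
  assumes valid: "valid x" and c: "c \<in> set (candidates (indep (concat Fs) x) x)"
begin

definition J where "J = set (indep (concat Fs) x)"

definition Jl where "Jl = filter (\<lambda>j. j \<in> J) [1..<n + 1]"

definition opts where "opts j = filter (\<lambda>l. \<not> (j = fst c \<and> l = snd c)) (cols x j)"

definition q where "q = problem_of w x c"

definition D where "D \<tau> = greedy_rounds q Fs [0..<\<tau>]"

definition choice where "choice \<tau> j = argmin (\<lambda>l. score q (D \<tau>, \<tau>) Fs j l) 0 (opts j)"

definition r :: "nat \<Rightarrow> nat \<times> nat \<Rightarrow> real" where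
  "r \<tau> e = (\<Sum>j\<in>J. grad (fam (fst e)) (pr x (snd e)) j *
     (real (count_list (D \<tau>) (j, snd e)) - real \<tau> * pr x (snd e) j))"

abbreviation E where "E \<equiv> {..<length Fs} \<times> {1..k}"

text \<open>The contribution of giving \<open>j\<close> the colour \<open>l\<close>, as a vector
  indexed by pairs of a function and a colour. The values to be preserved are linear in these
  vectors.\<close>

definition v :: "nat \<Rightarrow> nat \<Rightarrow> nat \<times> nat \<Rightarrow> real" where
  "v j l e = (if l = snd e then grad (fam (fst e)) (pr x l) j else 0)"

lemma J_sub: "J \<subseteq> {1..n}"
proof
  fix j assume "j \<in> J"
  then obtain e where "e \<in> set x" "fst e = j"
    using indep_properties(1)[of "concat Fs" x] unfolding J_def by blast
  then show "j \<in> {1..n}" using cols_eq(2)[OF valid] by metis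
qed

lemma finite_J: "finite J" by (simp add: J_def)

lemma set_Jl: "set Jl = J" "distinct Jl"
  using J_sub by (auto simp: Jl_def)

lemma J_two: "j \<in> J \<Longrightarrow> \<exists>a\<in>set (cols x j). \<exists>b\<in>set (cols x j). a \<noteq> b"
proof -
  assume "j \<in> J"
  then obtain e where e: "e \<in> set x" "fractional e" "fst e = j"
    using indep_properties(1)[of "concat Fs" x] by (auto simp: J_def)
  then have "snd e = cols x j" using cols_eq(1)[OF valid e(1)] by simp
  then show ?thesis using e(2) by (cases "cols x j") (auto simp: fractional_def)
qed

lemma J_indep: "i < length Fs \<Longrightarrow> S \<in> fam i \<Longrightarrow> a \<in> J \<Longrightarrow> b \<in> J \<Longrightarrow> a \<in> S \<Longrightarrow> b \<in> S \<Longrightarrow> a = b"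
proof -
  assume "i < length Fs" "S \<in> fam i" and ab: "a \<in> J" "b \<in> J" "a \<in> S" "b \<in> S"
  then obtain S' where S': "S' \<in> set (concat Fs)" "S = set S'"
    by (auto simp: fam_def) (metis nth_mem)
  show "a = b"
    by (rule indep_properties(2)[OF S'(1), of a x b]) (use ab S'(2) in \<open>simp_all add: J_def\<close>)
qed

lemma c_mem: "fst c \<in> J" "snd c \<in> set (cols x (fst c))"
proof -
  obtain e where "e \<in> set x" "fst e \<in> J" "fst c = fst e" "snd c \<in> set (snd e)"
    using c by (auto simp: candidates_def J_def)
  then show "fst c \<in> J" "snd c \<in> set (cols x (fst c))" using cols_eq(1)[OF valid] by simp_all
qed

lemma opts_nonempty: "j \<in> J \<Longrightarrow> opts j \<noteq> []"
proof -
  assume "j \<in> J"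
  then obtain a b where "a \<in> set (cols x j)" "b \<in> set (cols x j)" "a \<noteq> b" using J_two by blast
  moreover then have "a \<noteq> snd c \<or> b \<noteq> snd c" by auto
  ultimately show ?thesis unfolding opts_def filter_empty_conv by blast
qed

lemma q_eq: "q = (T, x, map (\<lambda>j. (j, cols x j, opts j)) Jl)"
proof -
  define g where "g = (\<lambda>y :: frac_col. map (\<lambda>e. (fst e, snd e, filter (\<lambda>l. \<not> (fst e = fst c \<and> l = snd c)) (snd e)))
       (filter (\<lambda>e. fst e \<in> J) y))"
  have "entries (indep (concat Fs) x) x c = g x"
    by (simp add: entries_def g_def J_def)
  also have "g x = g (map (\<lambda>j. (j, cols x j)) [1..<n + 1])"
    by (rule arg_cong[OF valid_eq[OF valid]])
  also have "\<dots> = map (\<lambda>j. (j, cols x j, opts j)) Jl"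
    by (simp add: g_def filter_map comp_def opts_def Jl_def)
  finally have "entries (indep (concat Fs) x) x c = map (\<lambda>j. (j, cols x j, opts j)) Jl" .
  then show ?thesis by (simp add: q_def problem_of_def w_def)
qed

lemma D_0: "D 0 = []" by (simp add: D_def)

lemma D_Suc: "D (Suc \<tau>) = map (\<lambda>j. (j, choice \<tau> j)) Jl @ D \<tau>"
proof -
  have "[0..<Suc \<tau>] = [0..<\<tau>] @ [\<tau>]" by (simp add: upt_Suc)
  then show ?thesis by (simp add: D_def greedy_round_def choice_def q_eq comp_def)
qed

lemma choice_in: "j \<in> J \<Longrightarrow> choice \<tau> j \<in> set (opts j)"
  unfolding choice_def by (intro argmin_in opts_nonempty)

lemma count_D_Suc: "j \<in> J \<Longrightarrow>
    real (count_list (D (Suc \<tau>)) (j, l)) = real (count_list (D \<tau>) (j, l)) + of_bool (choice \<tau> j = l)"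
  using set_Jl by (simp add: D_Suc count_list_append count_list_map_Pair)

lemma real_resid:
  assumes "i < length Fs"
  shows "real_of_int (resid q (D \<tau>, \<tau>) (Fs ! i) l) = real T ^ (n + 1) * r \<tau> (i, l)"
proof -
  have "real_of_int (sum_list ys) = sum_list (map real_of_int ys)" for ys by (induction ys) auto
  then have "real_of_int (resid q (D \<tau>, \<tau>) (Fs ! i) l) = sum_list (map (\<lambda>j. real_of_int (coef T x (Fs ! i) j l) *
      (real T * real (count_list (D \<tau>) (j, l)) - real \<tau> * real (count_list (cols x j) l))) Jl)"
    by (simp add: resid_def q_eq comp_def)
  also have "\<dots> = (\<Sum>j\<in>J. real_of_int (coef T x (Fs ! i) j l) *
      (real T * real (count_list (D \<tau>) (j, l)) - real \<tau> * real (count_list (cols x j) l)))"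
    using set_Jl by (simp flip: sum.distinct_set_conv_list)
  also have "\<dots> = (\<Sum>j\<in>J. real T ^ (n + 1) * (grad (fam i) (pr x l) j *
      (real (count_list (D \<tau>) (j, l)) - real \<tau> * pr x l j)))"
  proof (rule sum.cong)
    fix j assume "j \<in> J"
    then have "j \<in> {1..n}" using J_sub by auto
    then show "real_of_int (coef T x (Fs ! i) j l) *
        (real T * real (count_list (D \<tau>) (j, l)) - real \<tau> * real (count_list (cols x j) l))
      = real T ^ (n + 1) * (grad (fam i) (pr x l) j * (real (count_list (D \<tau>) (j, l)) - real \<tau> * pr x l j))"
      by (simp add: real_coef[OF valid assms] pr_count[OF valid] power_add algebra_simps)
  qed simp
  finally show ?thesis by (simp add: r_def sum_distrib_left)
qed

lemma sum_list_nth: "sum_list (map f Fs) = (\<Sum>i<length Fs. f (Fs ! i))"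
  by (simp add: sum_list_sum_nth atLeast0LessThan)

lemma real_score:
  assumes "l \<in> {1..k}"
  shows "real_of_int (score q (D \<tau>, \<tau>) Fs j l) = real T ^ (2 * n + 1) * (\<Sum>e\<in>E. r \<tau> e * v j l e)"
proof -
  have "real_of_int (score q (D \<tau>, \<tau>) Fs j l) = (\<Sum>i<length Fs. real_of_int (resid q (D \<tau>, \<tau>) (Fs ! i) l) * real_of_int (coef T x (Fs ! i) j l))"
    by (simp add: score_def q_eq sum_list_nth)
  also have "\<dots> = (\<Sum>i<length Fs. real T ^ (2 * n + 1) * (r \<tau> (i, l) * grad (fam i) (pr x l) j))"
  proof (rule sum.cong)
    have T2: "real T ^ (2 * n + 1) = real T ^ (n + 1) * real T ^ n" by (simp add: power_add mult_2)
    fix i assume "i \<in> {..<length Fs}"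
    then have i: "i < length Fs" by simp
    show "real_of_int (resid q (D \<tau>, \<tau>) (Fs ! i) l) * real_of_int (coef T x (Fs ! i) j l)
        = real T ^ (2 * n + 1) * (r \<tau> (i, l) * grad (fam i) (pr x l) j)"
      unfolding real_resid[OF i] real_coef[OF valid i] T2 by simp
  qed simp
  also have "\<dots> = real T ^ (2 * n + 1) * (\<Sum>i<length Fs. r \<tau> (i, l) * grad (fam i) (pr x l) j)"
    by (simp add: sum_distrib_left)
  also have "(\<Sum>i<length Fs. r \<tau> (i, l) * grad (fam i) (pr x l) j)
      = (\<Sum>i<length Fs. \<Sum>l'\<in>{1..k}. r \<tau> (i, l') * v j l (i, l'))"
  proof (rule sum.cong)
    fix i
    have "(\<Sum>l'\<in>{1..k}. r \<tau> (i, l') * v j l (i, l'))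
        = (\<Sum>l'\<in>{1..k}. if l = l' then r \<tau> (i, l) * grad (fam i) (pr x l) j else 0)"
      by (rule sum.cong) (auto simp: v_def)
    then show "r \<tau> (i, l) * grad (fam i) (pr x l) j = (\<Sum>l'\<in>{1..k}. r \<tau> (i, l') * v j l (i, l'))"
      using assms by simp
  qed simp
  also have "\<dots> = (\<Sum>e\<in>E. r \<tau> e * v j l e)" by (simp add: sum.cartesian_product)
  finally show ?thesis .
qed

lemma opts_sub: "j \<in> J \<Longrightarrow> set (opts j) \<subseteq> {1..k}"
proof -
  assume "j \<in> J"
  then have "set (cols x j) \<subseteq> {1..k}" using cols_valid[OF valid] J_sub by blast
  then show ?thesis by (auto simp: opts_def)
qed

lemma choice_best:
  assumes "j \<in> J" "l \<in> set (opts j)"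
  shows "(\<Sum>e\<in>E. r \<tau> e * v j (choice \<tau> j) e) \<le> (\<Sum>e\<in>E. r \<tau> e * v j l e)"
proof -
  have "score q (D \<tau>, \<tau>) Fs j (choice \<tau> j) \<le> score q (D \<tau>, \<tau>) Fs j l"
    unfolding choice_def by (rule argmin_le[OF assms(2)])
  then have "real_of_int (score q (D \<tau>, \<tau>) Fs j (choice \<tau> j)) \<le> real_of_int (score q (D \<tau>, \<tau>) Fs j l)"
    by (simp only: of_int_le_iff)
  moreover have l: "choice \<tau> j \<in> {1..k}" "l \<in> {1..k}"
    using choice_in[OF assms(1)] opts_sub[OF assms(1)] assms(2) by blast+
  ultimately show ?thesis unfolding real_score[OF l(1)] real_score[OF l(2)] using T_pos by simp
qed

lemma real_sq_resid:
  "real_of_int (sq_resid q (D \<tau>, \<tau>) Fs [1..<k + 1]) = real T ^ (2 * n + 2) * (\<Sum>e\<in>E. (r \<tau> e)\<^sup>2)"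
proof -
  have "real_of_int (sum_list ys) = sum_list (map real_of_int ys)" for ys by (induction ys) auto
  then have "real_of_int (sq_resid q (D \<tau>, \<tau>) Fs [1..<k + 1])
      = (\<Sum>i<length Fs. sum_list (map (\<lambda>l. (real_of_int (resid q (D \<tau>, \<tau>) (Fs ! i) l))\<^sup>2) [1..<k + 1]))"
    by (simp add: sq_resid_def sum_list_nth comp_def power2_eq_square)
  also have "\<dots> = (\<Sum>i<length Fs. \<Sum>l\<in>{1..k}. (real_of_int (resid q (D \<tau>, \<tau>) (Fs ! i) l))\<^sup>2)"
  proof (rule sum.cong)
    fix i
    have "sum_list (map (\<lambda>l. (real_of_int (resid q (D \<tau>, \<tau>) (Fs ! i) l))\<^sup>2) [1..<k + 1])
        = (\<Sum>l\<in>set [1..<k + 1]. (real_of_int (resid q (D \<tau>, \<tau>) (Fs ! i) l))\<^sup>2)"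
      by (rule sum.distinct_set_conv_list[symmetric]) simp
    then show "sum_list (map (\<lambda>l. (real_of_int (resid q (D \<tau>, \<tau>) (Fs ! i) l))\<^sup>2) [1..<k + 1])
        = (\<Sum>l\<in>{1..k}. (real_of_int (resid q (D \<tau>, \<tau>) (Fs ! i) l))\<^sup>2)"
      by (simp add: atLeastLessThanSuc_atLeastAtMost)
  qed simp
  also have "\<dots> = (\<Sum>i<length Fs. \<Sum>l\<in>{1..k}. real T ^ (2 * n + 2) * (r \<tau> (i, l))\<^sup>2)"
  proof (intro sum.cong refl)
    fix i l assume "i \<in> {..<length Fs}"
    then have i: "i < length Fs" by simp
    have T2: "real T ^ (2 * n + 2) = (real T ^ (n + 1))\<^sup>2"
      unfolding power_mult[symmetric] by (simp add: algebra_simps)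
    show "(real_of_int (resid q (D \<tau>, \<tau>) (Fs ! i) l))\<^sup>2 = real T ^ (2 * n + 2) * (r \<tau> (i, l))\<^sup>2"
      unfolding real_resid[OF i] T2 power_mult_distrib ..
  qed
  also have "\<dots> = real T ^ (2 * n + 2) * (\<Sum>e\<in>E. (r \<tau> e)\<^sup>2)"
    by (simp add: sum_distrib_left sum.cartesian_product split_def)
  finally show ?thesis .
qed

lemma accept_iff: "accept w q (D T) \<longleftrightarrow> (\<Sum>e\<in>E. (r T e)\<^sup>2) \<le> real T * real u ^ 4"
proof -
  have len: "length x = n" using arg_cong[OF valid_eq[OF valid], of length] by simp
  have fst: "fst q = T" "fst (snd q) = x" "snd (snd (snd w)) = Fs" "fst (snd w) = [1..<k + 1]" "fst (snd (snd w)) = u"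
    by (simp_all add: q_eq w_def)
  have "prod_list (map (\<lambda>e. int T * int T) ys) = (int T * int T) ^ length ys" for ys :: frac_col
    by (induction ys) auto
  then have "accept w q (D T) \<longleftrightarrow> sq_resid q (D T, T) Fs [1..<k + 1]
      \<le> (int T * int T) ^ n * (int T * int T) * int T * (int u * int u * int u * int u)"
    unfolding accept_def fst len[symmetric] by simp
  also have "\<dots> \<longleftrightarrow> real_of_int (sq_resid q (D T, T) Fs [1..<k + 1])
      \<le> real_of_int ((int T * int T) ^ n * (int T * int T) * int T * (int u * int u * int u * int u))"
    by (simp only: of_int_le_iff)
  also have "real_of_int ((int T * int T) ^ n * (int T * int T) * int T * (int u * int u * int u * int u))
      = real T ^ (2 * n + 2) * (real T * real u ^ 4)"
    by (simp add: power_add power_mult power2_eq_square power4_eq_xxxx)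
  finally show ?thesis unfolding real_sq_resid using T_pos by simp
qed

definition \<mu> :: "nat \<times> nat \<Rightarrow> real" where
  "\<mu> e = (\<Sum>j\<in>J. grad (fam (fst e)) (pr x (snd e)) j * pr x (snd e) j)"

lemma grad_J_bounds:
  assumes "i < length Fs" "\<And>j. j \<in> J \<Longrightarrow> 0 \<le> a j \<and> a j \<le> 1"
  shows "0 \<le> (\<Sum>j\<in>J. grad (fam i) (pr x l) j * a j)" "(\<Sum>j\<in>J. grad (fam i) (pr x l) j * a j) \<le> real u"
proof -
  note g = grad_bounds[of "pr x l", OF pr_bounds]
  show "0 \<le> (\<Sum>j\<in>J. grad (fam i) (pr x l) j * a j)"
    by (intro sum_nonneg mult_nonneg_nonneg g) (use assms(2) in auto)
  have "(\<Sum>j\<in>J. grad (fam i) (pr x l) j * a j) \<le> (\<Sum>j\<in>J. grad (fam i) (pr x l) j)"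
    by (intro sum_mono mult_left_le g) (use assms(2) in auto)
  also have "\<dots> \<le> real (card (fam i))"
    by (rule sum_grad_le[OF fam_finite finite_J pr_bounds]) (use J_indep[OF assms(1)] in blast)
  also have "\<dots> \<le> real u" using card_fam_le[OF assms(1)] by simp
  finally show "(\<Sum>j\<in>J. grad (fam i) (pr x l) j * a j) \<le> real u" .
qed

text \<open>A face point with the same values is a convex combination of allowed choices that hits
  the target \<open>\<mu>\<close>. Its mere existence keeps the greedy residual small, so the
  program passes its own test without ever computing the point.\<close>

lemma accept_of_face_point:
  assumes wt: "\<And>j l. j \<in> J \<Longrightarrow> l \<in> {1..k} \<Longrightarrow> wt j l \<ge> 0" "\<And>j. j \<in> J \<Longrightarrow> (\<Sum>l\<in>{1..k}. wt j l) = 1"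
      "\<And>j l. j \<in> J \<Longrightarrow> l \<in> {1..k} \<Longrightarrow> pr x l j = 0 \<Longrightarrow> wt j l = 0" "wt (fst c) (snd c) = 0"
      "\<And>e. e \<in> E \<Longrightarrow> (\<Sum>j\<in>J. \<Sum>l\<in>{1..k}. wt j l * v j l e) = (\<Sum>j\<in>J. \<Sum>l\<in>{1..k}. pr x l j * v j l e)"
  shows "accept w q (D T)"
proof -
  have v: "v j l e = grad (fam (fst e)) (pr x (snd e)) j * of_bool (l = snd e)" for j l e
    by (simp add: v_def)
  have mean: "(\<Sum>j\<in>J. \<Sum>l\<in>{1..k}. wt j l * v j l e) = \<mu> e" if e: "e \<in> E" for e
  proof -
    have "(\<Sum>l\<in>{1..k}. pr x l j * v j l e) = grad (fam (fst e)) (pr x (snd e)) j * pr x (snd e) j" for j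
    proof -
      have "(\<Sum>l\<in>{1..k}. pr x l j * v j l e)
          = (\<Sum>l\<in>{1..k}. if l = snd e then grad (fam (fst e)) (pr x (snd e)) j * pr x (snd e) j else 0)"
        by (rule sum.cong) (auto simp: v_def)
      then show ?thesis using e by auto
    qed
    then show ?thesis using wt(5)[OF e] by (simp add: \<mu>_def)
  qed
  have r0: "r 0 e = 0" for e by (simp add: r_def D_0)
  have r_Suc: "r (Suc t) e = r t e + ((\<Sum>j\<in>J. v j (choice t j) e) - \<mu> e)" for t e
  proof -
    have "r (Suc t) e = (\<Sum>j\<in>J. grad (fam (fst e)) (pr x (snd e)) j *
        (real (count_list (D t) (j, snd e)) - real t * pr x (snd e) j)
        + v j (choice t j) e - grad (fam (fst e)) (pr x (snd e)) j * pr x (snd e) j)"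
      unfolding r_def by (rule sum.cong) (auto simp: count_D_Suc v algebra_simps)
    then show ?thesis by (simp add: r_def \<mu>_def sum.distrib sum_subtractf)
  qed
  have B: "\<bar>(\<Sum>j\<in>J. v j (choice t j) e) - \<mu> e\<bar> \<le> real u" if "e \<in> E" for t e
  proof -
    have i: "fst e < length Fs" using that by auto
    have "0 \<le> (\<Sum>j\<in>J. v j (choice t j) e)" "(\<Sum>j\<in>J. v j (choice t j) e) \<le> real u"
      unfolding v by (rule grad_J_bounds[OF i]; simp)+
    moreover have "0 \<le> \<mu> e" "\<mu> e \<le> real u"
      unfolding \<mu>_def by (rule grad_J_bounds[OF i]; simp add: pr_bounds)+
    ultimately show ?thesis by linarith
  qed
  \<comment> \<open>A colour is no option either because its current weight is \<open>0\<close> or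
    because it is the candidate; the face point gives weight \<open>0\<close> in both cases.\<close>
  have outside: "wt j l = 0" if "j \<in> J" "l \<in> {1..k}" "l \<notin> set (opts j)" for j l
  proof -
    have jl: "j \<in> {1..n}" "l \<notin> set (cols x j) \<or> (j = fst c \<and> l = snd c)"
      using J_sub that by (auto simp: opts_def)
    from jl(2) show "wt j l = 0"
    proof
      assume "l \<notin> set (cols x j)"
      then have "\<not> pr x l j > 0" using pr_pos_iff[OF valid jl(1)] by blast
      then have "pr x l j = 0" using pr_bounds(1)[of x l j] by linarith
      then show ?thesis by (rule wt(3)[OF that(1,2)])
    qed (use wt(4) in simp)
  qed
  have "(\<Sum>e\<in>E. (r T e)\<^sup>2) \<le> real T * (real (card E) * (real u)\<^sup>2)"
    by (rule greedy_residual[where J = J and L = "{1..k}" and w = wt and v = v and \<mu> = \<mu>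
          and Opt = "\<lambda>j. set (opts j)" and c = choice and r = r])
       ((rule wt(1) wt(2) finite_J outside mean r0 r_Suc choice_best B; assumption) | simp)+
  also have "real (card E) * (real u)\<^sup>2 \<le> real u ^ 4"
  proof -
    have "card E \<le> u * u" using u k by (simp add: card_cartesian_product mult_le_mono)
    then have "real (card E) \<le> real u * real u" by (simp flip: of_nat_mult)
    then have "real (card E) * (real u)\<^sup>2 \<le> real u * real u * (real u)\<^sup>2" by (intro mult_right_mono) auto
    then show ?thesis by (simp add: power2_eq_square power4_eq_xxxx)
  qed
  then have "real T * (real (card E) * (real u)\<^sup>2) \<le> real T * real u ^ 4" by (intro mult_left_mono) auto
  finally show ?thesis unfolding accept_iff .
qed

abbreviation y where "y \<equiv> snd (attempt w x c)"

lemma y_eq: "y = map (\<lambda>j. (j, if j \<in> J then map snd (filter (\<lambda>d. fst d = j) (D T)) else cols x j)) [1..<n + 1]"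
proof -
  have "picks w x c = D T" by (simp add: picks_def D_def q_def w_def)
  then show ?thesis
    by (simp add: attempt_def replace_def w_def J_def[symmetric])
       (subst valid_eq[OF valid], simp add: comp_def)
qed

lemma length_select: "j \<in> J \<Longrightarrow> length (filter (\<lambda>d. fst d = j) (D \<tau>)) = \<tau>"
proof (induction \<tau>)
  case (Suc \<tau>)
  have "length (filter (\<lambda>d. fst d = j) (map (\<lambda>j. (j, choice \<tau> j)) js)) = count_list js j" for js
    by (induction js) auto
  moreover have "count_list Jl j = 1" using Suc.prems set_Jl by (simp add: count_list_distinct)
  ultimately show ?case using Suc by (simp add: D_Suc)
qed (simp add: D_0)

lemma select_sub: "d \<in> set (D \<tau>) \<Longrightarrow> snd d \<in> set (opts (fst d))"
  by (induction \<tau>) (use choice_in set_Jl in \<open>auto simp: D_0 D_Suc\<close>)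

lemma cols_y: "j \<in> {1..n} \<Longrightarrow> cols y j = (if j \<in> J then map snd (filter (\<lambda>d. fst d = j) (D T)) else cols x j)"
  by (subst y_eq) (simp add: cols_def map_of_map_Pair)

lemma y_sub: "j \<in> J \<Longrightarrow> set (cols y j) \<subseteq> set (opts j)"
  using cols_y[of j] J_sub select_sub by fastforce

lemma y_valid: "valid y"
proof -
  have "length (cols y j) = T \<and> set (cols y j) \<subseteq> {1..k}" if j: "j \<in> {1..n}" for j
  proof (cases "j \<in> J")
    case True
    then show ?thesis using cols_y[OF j] length_select[OF True, of T] y_sub[OF True] opts_sub[OF True] by simp
  next
    case False
    then show ?thesis using cols_y[OF j] cols_valid[OF valid j] by simp
  qed
  note cols = this
  have y: "y = map (\<lambda>j. (j, cols y j)) [1..<n + 1]"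
    by (subst y_eq, rule map_cong) (auto simp: cols_y)
  have "length (snd e) = T \<and> set (snd e) \<subseteq> {1..k}" if "e \<in> set y" for e
  proof -
    have "e \<in> set (map (\<lambda>j. (j, cols y j)) [1..<n + 1])" using that by (simp only: y[symmetric])
    then obtain j where "j \<in> {1..n}" "e = (j, cols y j)" by auto
    then show ?thesis using cols by simp
  qed
  moreover have "map fst y = [1..<n + 1]" by (subst y_eq) (simp add: comp_def)
  ultimately show ?thesis unfolding valid_def by blast
qed

text \<open>The potential counts the element-colour pairs of positive weight. Picks come from
  allowed colours, so none is added, and the candidate itself disappears.\<close>

lemma potential_decreases:
  "(\<Sum>j\<in>{1..n}. card (set (cols y j))) < (\<Sum>j\<in>{1..n}. card (set (cols x j)))"
proof (rule sum_strict_mono_ex1)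
  have "set (cols y j) \<subseteq> set (cols x j)" if "j \<in> {1..n}" for j
    using y_sub[of j] cols_y[OF that] by (cases "j \<in> J") (auto simp: opts_def)
  then show "\<forall>j\<in>{1..n}. card (set (cols y j)) \<le> card (set (cols x j))"
    by (intro ballI card_mono) auto
  have "set (cols y (fst c)) \<subset> set (cols x (fst c))"
    using y_sub[OF c_mem(1)] c_mem(2) by (auto simp: opts_def)
  then have "card (set (cols y (fst c))) < card (set (cols x (fst c)))" by (intro psubset_card_mono) auto
  then show "\<exists>j\<in>{1..n}. card (set (cols y j)) < card (set (cols x j))"
    using c_mem(1) J_sub by blast
qed simp

text \<open>As \<open>ext\<close> is affine on the independent set, its change is exactly the
  residual divided by \<open>T\<close>, hence at most \<open>u ^ 2 / sqrt T\<close> by the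
  acceptance test.\<close>

lemma ext_change:
  assumes "accept w q (D T)" "i < length Fs" "l \<in> {1..k}"
  shows "\<bar>ext (fam i) (pr y l) - ext (fam i) (pr x l)\<bar> \<le> 1 / real u ^ 6"
proof -
  have "pr y l j - pr x l j = (real (count_list (D T) (j, l)) - real T * pr x l j) / real T" if "j \<in> J" for j
  proof -
    have j: "j \<in> {1..n}" using that J_sub by auto
    have "real T * pr y l j = real (count_list (D T) (j, l))"
      using pr_count[OF y_valid j, of l] cols_y[OF j] that by (simp add: count_list_select)
    then show ?thesis using T_pos by (simp add: field_simps)
  qed
  then have "ext (fam i) (pr y l) - ext (fam i) (pr x l)
      = (\<Sum>j\<in>J. grad (fam i) (pr x l) j * ((real (count_list (D T) (j, l)) - real T * pr x l j) / real T))"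
    by (subst ext_affine[OF fam_finite _ finite_J])
       (use fam_sub[OF assms(2)] J_indep[OF assms(2)] cols_y in \<open>auto simp: pr_def\<close>)
  also have "\<dots> = r T (i, l) / real T" by (simp add: r_def sum_divide_distrib)
  finally have eq: "ext (fam i) (pr y l) - ext (fam i) (pr x l) = r T (i, l) / real T" .
  have "(r T (i, l))\<^sup>2 \<le> (\<Sum>e\<in>E. (r T e)\<^sup>2)"
    by (rule member_le_sum[of "(i, l)" E "\<lambda>e. (r T e)\<^sup>2"]) (use assms in auto)
  also have "\<dots> \<le> real T * real u ^ 4" using assms(1) by (simp add: accept_iff)
  finally have "(r T (i, l))\<^sup>2 \<le> real T * real u ^ 4" .
  then have "(r T (i, l) / real T)\<^sup>2 \<le> real u ^ 4 / real T"
    using T_pos by (simp add: power_divide field_simps power2_eq_square)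
  also have "\<dots> \<le> real u ^ 4 / real u ^ 16"
  proof (rule divide_left_mono)
    show "real u ^ 16 \<le> real T" using T(2) by (metis of_nat_le_iff of_nat_power)
    show "0 < real T * real u ^ 16" using T_pos u by simp
  qed simp
  also have "\<dots> = (1 / real u ^ 6)\<^sup>2"
    using u by (simp add: field_simps power_divide flip: power_mult power_add)
  finally show ?thesis unfolding eq using u by (simp add: abs_le_square_iff[symmetric])
qed

end

section \<open>Iterating until every face is refused\<close>

lemma candidatesI: "e \<in> set x \<Longrightarrow> fst e \<in> set I \<Longrightarrow> l \<in> set (snd e) \<Longrightarrow> (fst e, l) \<in> set (candidates I x)"
  by (cases e) (auto simp: candidates_def)

context relaxation
begin

definition stuck :: "frac_col \<Rightarrow> bool" where
  "stuck x \<longleftrightarrow> (\<forall>c\<in>set (candidates (indep (concat Fs) x) x). \<not> accept w (problem_of w x c) (picks w x c))"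

definition pot :: "frac_col \<Rightarrow> nat" where
  "pot x = (\<Sum>j\<in>{1..n}. card (set (cols x j)))"

lemma improve_cases:
  assumes "valid x"
  obtains "stuck x" "improve w x = x"
  | "valid (improve w x)" "pot (improve w x) < pot x"
    "\<And>i l. i < length Fs \<Longrightarrow> l \<in> {1..k} \<Longrightarrow>
      \<bar>ext (fam i) (pr (improve w x) l) - ext (fam i) (pr x l)\<bar> \<le> 1 / real u ^ 6"
proof -
  define cs where "cs = candidates (indep (concat Fs) x) x"
  have imp: "improve w x = head x (map snd (filter fst (map (attempt w x) cs)))"
    by (simp add: improve_def cs_def w_def)
  show ?thesis
  proof (cases "filter fst (map (attempt w x) cs)")
    case Nil
    have "\<not> accept w (problem_of w x c) (picks w x c)" if "c \<in> set cs" for c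
    proof -
      have "\<not> fst (attempt w x c)" using Nil that by (simp add: filter_empty_conv)
      then show ?thesis by (simp add: attempt_def)
    qed
    then have "stuck x" by (simp add: stuck_def cs_def)
    moreover have "improve w x = x" by (simp add: imp Nil)
    ultimately show ?thesis by (rule that(1))
  next
    case (Cons e es)
    have "e \<in> set (filter fst (map (attempt w x) cs))" unfolding Cons by simp
    then obtain c where hc: "c \<in> set cs" "e = attempt w x c" "fst e" by auto
    interpret attempt_step n k T L u Fs x c
      by unfold_locales (use assms hc(1) in \<open>simp_all add: cs_def\<close>)
    have "improve w x = y" using hc(2) by (simp add: imp Cons)
    moreover have "accept w q (D T)"
      using hc(2,3) by (simp add: attempt_def q_def D_def picks_def) (simp add: w_def)
    ultimately show ?thesis
      using that(2) y_valid potential_decreases ext_change by (simp add: pot_def)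
  qed
qed

text \<open>A stuck point is a fixed point of \<open>improve\<close>, and otherwise the potential
  drops; more iterations than the potential must therefore end at a stuck point.\<close>

lemma iterate:
  assumes "valid x"
  defines "z \<equiv> \<lambda>ys x. foldl (\<lambda>x _. improve w x) x ys"
  shows "valid (z ys x) \<and>
    (\<forall>i<length Fs. \<forall>l\<in>{1..k}. \<bar>ext (fam i) (pr (z ys x) l) - ext (fam i) (pr x l)\<bar>
        \<le> real (length ys) * (1 / real u ^ 6)) \<and>
    (pot x < length ys \<longrightarrow> stuck (z ys x))"
  using assms(1)
proof (induction ys arbitrary: x)
  case (Cons a ys)
  from improve_cases[OF Cons.prems] show ?case
  proof cases
    case 1
    have "z ys x = x" for ys using 1(2) by (induction ys) (simp_all add: z_def)
    then show ?thesis using Cons.prems 1(1) by simp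
  next
    case 2
    have z: "z (a # ys) x = z ys (improve w x)" by (simp add: z_def)
    have IH: "valid (z ys (improve w x))"
      "\<And>i l. i < length Fs \<Longrightarrow> l \<in> {1..k} \<Longrightarrow> \<bar>ext (fam i) (pr (z ys (improve w x)) l) - ext (fam i) (pr (improve w x) l)\<bar>
        \<le> real (length ys) * (1 / real u ^ 6)"
      "pot (improve w x) < length ys \<Longrightarrow> stuck (z ys (improve w x))"
      using Cons.IH[OF 2(1)] by blast+
    have "\<bar>ext (fam i) (pr (z (a # ys) x) l) - ext (fam i) (pr x l)\<bar> \<le> real (length (a # ys)) * (1 / real u ^ 6)"
      if "i < length Fs" "l \<in> {1..k}" for i l
    proof -
      have "real (length (a # ys)) * (1 / real u ^ 6) = real (length ys) * (1 / real u ^ 6) + 1 / real u ^ 6"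
        by (simp add: add_divide_distrib)
      then show ?thesis unfolding z using IH(2)[OF that] 2(3)[OF that] by linarith
    qed
    then show ?thesis using IH(1,3) 2(2) unfolding z by simp
  qed
qed (simp add: z_def)

text \<open>With more than \<open>m k\<close> independent elements, \<open>face_point\<close>
  supplies a face point for some candidate, and that candidate would have been accepted.\<close>

lemma card_indep_le:
  assumes "valid x" "stuck x"
  shows "card (set (indep (concat Fs) x)) \<le> length Fs * k"
proof (rule ccontr)
  define J where "J = set (indep (concat Fs) x)"
  define E where "E = {..<length Fs} \<times> {1..k}"
  assume "\<not> card (set (indep (concat Fs) x)) \<le> length Fs * k"
  then have card: "card E < card J" by (simp add: E_def J_def card_cartesian_product)
  define v where "v = (\<lambda>j l e. if l = snd e then grad (fam (fst e)) (pr x l) j else (0 :: real))"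
  have keys: "\<exists>e\<in>set x. fst e = j \<and> fractional e" if "j \<in> J" for j
    using indep_properties(1)[of "concat Fs" x] that unfolding J_def by blast
  have J: "j \<in> {1..n}" if "j \<in> J" for j
    using keys[OF that] cols_eq(2)[OF assms(1)] by blast
  have two: "\<exists>a\<in>{1..k}. \<exists>b\<in>{1..k}. a \<noteq> b \<and> pr x a j > 0 \<and> pr x b j > 0" if j: "j \<in> J" for j
  proof -
    obtain e where e: "e \<in> set x" "fst e = j" "fractional e" using keys[OF j] by blast
    then have "fractional (j, cols x j)" using cols_eq(1)[OF assms(1) e(1)] by (metis prod.collapse)
    then obtain a b where ab: "a \<in> set (cols x j)" "b \<in> set (cols x j)" "a \<noteq> b"
      by (cases "cols x j") (auto simp: fractional_def)
    moreover have "set (cols x j) \<subseteq> {1..k}" using cols_valid[OF assms(1) J[OF j]] by blast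
    ultimately show ?thesis using pr_pos_iff[OF assms(1) J[OF j]] by blast
  qed
  have fin: "finite E" "finite J" "finite {1..k}" by (simp_all add: E_def J_def)
  have f1: "pr x l j \<ge> 0" if "j \<in> J" "l \<in> {1..k}" for j l by (rule pr_bounds)
  have f2: "(\<Sum>l\<in>{1..k}. pr x l j) = 1" if "j \<in> J" for j by (rule sum_pr[OF assms(1) J[OF that]])
  show False
  proof (rule face_point[OF fin(1,2) card fin(3) f1 f2 two, where v = v])
    fix wt j0 l0
    assume wt: "j0 \<in> J" "l0 \<in> {1..k}" "pr x l0 j0 > 0" "wt j0 l0 = 0"
      "\<And>j l. j \<in> J \<Longrightarrow> l \<in> {1..k} \<Longrightarrow> wt j l \<ge> 0"
      "\<And>j l. j \<in> J \<Longrightarrow> l \<in> {1..k} \<Longrightarrow> pr x l j = 0 \<Longrightarrow> wt j l = 0"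
      "\<And>j. j \<in> J \<Longrightarrow> (\<Sum>l\<in>{1..k}. wt j l) = 1"
      "\<And>e. e \<in> E \<Longrightarrow> (\<Sum>j\<in>J. \<Sum>l\<in>{1..k}. wt j l * v j l e) = (\<Sum>j\<in>J. \<Sum>l\<in>{1..k}. pr x l j * v j l e)"
    define c where "c = (j0, l0)"
    have l0: "l0 \<in> set (cols x j0)" using wt(3) pr_pos_iff[OF assms(1) J[OF wt(1)]] by blast
    have hc: "c \<in> set (candidates (indep (concat Fs) x) x)"
      using candidatesI[OF cols_mem[OF assms(1) J[OF wt(1)]], of "indep (concat Fs) x" l0] l0 wt(1)
      by (simp add: c_def J_def)
    interpret A: attempt_step n k T L u Fs x c
      by unfold_locales (fact assms(1) hc)+
    have Aeq: "A.J = J" "A.v = v" by (auto simp: A.J_def J_def A.v_def v_def fun_eq_iff)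
    have "accept w A.q (A.D T)"
    proof (rule A.accept_of_face_point[of wt, unfolded Aeq])
      show "wt (fst c) (snd c) = 0" using wt(4) by (simp add: c_def)
    qed (use wt in \<open>simp_all add: E_def\<close>)
    then have "accept w (problem_of w x c) (picks w x c)"
      by (simp add: A.q_def A.D_def picks_def) (simp add: w_def)
    with assms(2) hc show False by (auto simp: stuck_def)
  qed
qed

text \<open>By maximality every fractional element is independent or shares a dual set with an
  independent one, and an independent element has at most \<open>t * s\<close> such neighbours,
  itself included.\<close>

lemma card_fractional_le:
  assumes "valid x" "stuck x"
    and t: "\<And>j. j \<in> {1..n} \<Longrightarrow> card {S \<in> (\<Union>i<length Fs. fam i). j \<in> S} \<le> t" "t \<ge> 1"
    and s: "\<And>S. S \<in> (\<Union>i<length Fs. fam i) \<Longrightarrow> card S \<le> s" "s \<ge> 1"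
  shows "length (filter fractional x) \<le> length Fs * k * t * s"
proof -
  define J where "J = set (indep (concat Fs) x)"
  define U where "U = (\<Union>i<length Fs. fam i)"
  define R where "R = (\<lambda>i. insert i (\<Union>{S \<in> U. i \<in> S}))"
  have U_fin: "finite U" "\<And>S. S \<in> U \<Longrightarrow> finite S" using fam_finite fam_sub by (auto simp: U_def)
  have concat: "set S \<in> U" if S: "S \<in> set (concat Fs)" for S
  proof -
    obtain F where F: "F \<in> set Fs" "S \<in> set F" using S by auto
    obtain i where "i < length Fs" "F = Fs ! i" using F(1) by (metis in_set_conv_nth)
    then show ?thesis using F(2) by (auto simp: U_def fam_def)
  qed
  have J: "J \<subseteq> {1..n}"
    using indep_properties(1)[of "concat Fs" x] cols_eq(2)[OF assms(1)] unfolding J_def by blast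
  have R: "card (R i) \<le> t * s" if "i \<in> J" for i
  proof (cases "{S \<in> U. i \<in> S} = {}")
    \<comment> \<open>An element in no dual set still counts for itself; here
      \<open>t \<ge> 1\<close> and \<open>s \<ge> 1\<close> enter.\<close>
    case True
    have "R i = {i}" unfolding R_def True by simp
    then show ?thesis using t(2) s(2) mult_le_mono[of 1 t 1 s] by simp
  next
    case False
    then have "R i = (\<Union>S\<in>{S \<in> U. i \<in> S}. S)" by (auto simp: R_def)
    also have "card \<dots> \<le> (\<Sum>S\<in>{S \<in> U. i \<in> S}. card S)" using U_fin(1) by (intro card_UN_le) auto
    also have "\<dots> \<le> (\<Sum>S\<in>{S \<in> U. i \<in> S}. s)" using s(1) by (intro sum_mono) (auto simp: U_def)
    also have "\<dots> \<le> t * s" using t(1)[of i] that J by (auto simp: U_def)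
    finally show ?thesis .
  qed
  have fin: "finite (R i)" for i using U_fin by (auto simp: R_def)
  have "length (filter fractional x) = card (set (map fst (filter fractional x)))"
  proof -
    have "distinct (map fst (filter fractional x))"
      using assms(1) by (intro distinct_map_filter) (simp add: valid_def)
    from distinct_card[OF this] show ?thesis by simp
  qed
  also have "set (map fst (filter fractional x)) \<subseteq> (\<Union>i\<in>J. R i)"
  proof
    fix j assume "j \<in> set (map fst (filter fractional x))"
    then obtain e where e: "e \<in> set x" "fractional e" "fst e = j" by auto
    from indep_properties(3)[OF e(1,2), of "concat Fs"]
    show "j \<in> (\<Union>i\<in>J. R i)"
    proof
      assume "fst e \<in> set (indep (concat Fs) x)"
      then show ?thesis using e(3) by (auto simp: J_def R_def)
    next
      assume "conflict (concat Fs) (indep (concat Fs) x) (fst e)"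
      then obtain S i where "S \<in> set (concat Fs)" "j \<in> set S" "i \<in> J" "i \<in> set S"
        unfolding conflict_def J_def e(3) by blast
      then show ?thesis using concat[of S] by (auto simp: R_def)
    qed
  qed
  then have "card (set (map fst (filter fractional x))) \<le> card (\<Union>i\<in>J. R i)"
    using fin by (intro card_mono) (auto simp: J_def)
  also have "\<dots> \<le> (\<Sum>i\<in>J. card (R i))" by (intro card_UN_le) (simp add: J_def)
  also have "\<dots> \<le> (\<Sum>i\<in>J. t * s)" by (intro sum_mono R)
  also have "\<dots> = card J * (t * s)" by simp
  also have "\<dots> \<le> (length Fs * k) * (t * s)"
    using card_indep_le[OF assms(1,2)] by (intro mult_right_mono) (simp_all add: J_def)
  finally show ?thesis by (simp add: mult.assoc)
qed

section \<open>The starting point and the accuracy of the relaxation\<close>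

abbreviation "x0 \<equiv> initial w [1..<n + 1]"

lemma x0_eq: "x0 = map (\<lambda>j. (j, map (\<lambda>i. i mod k + 1) [0..<T])) [1..<n + 1]"
  by (simp add: initial_def w_def)

lemma cols_x0: "j \<in> {1..n} \<Longrightarrow> cols x0 j = map (\<lambda>i. i mod k + 1) [0..<T]"
  unfolding cols_def x0_eq by (subst map_of_map_Pair) simp

lemma x0_valid: "valid x0"
proof -
  have "a mod k + 1 \<le> k" for a using mod_less_divisor[of k a] k(1) by linarith
  then show ?thesis unfolding valid_def x0_eq by (auto simp: comp_def)
qed

lemma pr_x0_close:
  assumes "l \<in> {1..k}" "l' \<in> {1..k}"
  shows "\<bar>pr x0 l j - pr x0 l' j\<bar> \<le> 1 / real T"
proof (cases "j \<in> {1..n}")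
  case True
  have c: "T div k \<le> count_list (cols x0 j) l \<and> count_list (cols x0 j) l \<le> T div k + 1" if l: "l \<in> {1..k}" for l
  proof -
    obtain r where r: "l = Suc r" "r < k" using l by (cases l) auto
    have "count_list (cols x0 j) l = (T + k - 1 - r) div k"
      unfolding cols_x0[OF True] r(1) by (rule count_mod[OF r(2)])
    moreover have "T div k \<le> (T + k - 1 - r) div k" using r(2) by (intro div_le_mono) simp
    moreover have "(T + k - 1 - r) div k \<le> (T + k) div k" by (intro div_le_mono) simp
    moreover have "(T + k) div k = T div k + 1" using k by simp
    ultimately show ?thesis by simp
  qed
  have "\<bar>real (count_list (cols x0 j) l) - real (count_list (cols x0 j) l')\<bar> \<le> 1"
    using c[OF assms(1)] c[OF assms(2)] by linarith
  then have "real T * \<bar>pr x0 l j - pr x0 l' j\<bar> \<le> 1"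
    unfolding pr_count[OF x0_valid True] by (simp add: abs_mult flip: right_diff_distrib)
  then show ?thesis using T_pos by (simp add: field_simps)
next
  case False
  then have "pr x0 l j = 0" for l by (simp only: pr_def if_False)
  then show ?thesis by simp
qed

lemma ext_x0_close:
  assumes "i < length Fs" "l \<in> {1..k}" "l' \<in> {1..k}"
  shows "\<bar>ext (fam i) (pr x0 l) - ext (fam i) (pr x0 l')\<bar> \<le> real u / real T"
proof -
  have "\<bar>ext (fam i) (pr x0 l) - ext (fam i) (pr x0 l')\<bar>
      \<le> (\<Sum>S\<in>fam i. \<Sum>j\<in>S. \<bar>pr x0 l j - pr x0 l' j\<bar>)"
    by (rule ext_lipschitz) (rule pr_bounds)+
  also have "\<dots> \<le> (\<Sum>S\<in>fam i. \<Sum>j\<in>S. 1 / real T)"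
    by (intro sum_mono pr_x0_close assms)
  also have "\<dots> = real (\<Sum>S\<in>fam i. card S) / real T" by (simp add: sum_divide_distrib)
  also have "(\<Sum>S\<in>fam i. card S) = sum_list (map card (map set (Fs ! i)))"
    using Fs(1)[of "Fs ! i"] assms(1) by (simp only: fam_def set_map[symmetric] sum.distinct_set_conv_list nth_mem)
  also have "\<dots> \<le> sum_list (map length (Fs ! i))"
    unfolding map_map comp_def by (intro sum_list_mono card_length)
  also have "\<dots> \<le> u" using u(5)[of "Fs ! i"] assms(1) by simp
  finally show ?thesis by (simp add: divide_right_mono)
qed

abbreviation "z \<equiv> relaxed w [1..<n + 1]"

lemma relaxed_properties:
  shows "valid z" "stuck z"
    "\<And>i l l'. i < length Fs \<Longrightarrow> l \<in> {1..k} \<Longrightarrow> l' \<in> {1..k} \<Longrightarrow>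
      \<bar>ext (fam i) (pr z l) - ext (fam i) (pr z l')\<bar> \<le> 1 / 8"
proof -
  define ys where "ys = 0 # concat (map (\<lambda>_. [1..<k + 1]) [1..<n + 1])"
  have z: "z = foldl (\<lambda>x _. improve w x) x0 ys" by (simp add: relaxed_def ys_def w_def)
  have len: "length ys = 1 + n * k"
    by (simp add: ys_def length_concat comp_def sum_list_triv)
  have "pot x0 \<le> (\<Sum>j\<in>{1..n}. k)" unfolding pot_def
  proof (rule sum_mono)
    fix j assume "j \<in> {1..n}"
    then have "set (cols x0 j) \<subseteq> {1..k}" using cols_valid[OF x0_valid] by blast
    from card_mono[OF _ this] show "card (set (cols x0 j)) \<le> k" by simp
  qed
  then have "pot x0 < length ys" by (simp add: len)
  with iterate[OF x0_valid, of ys] show "valid z" "stuck z" unfolding z by blast+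
  have "n * k + 1 \<le> u * u"
  proof -
    have "n * k + 1 \<le> n * k + n" using k by simp
    also have "\<dots> = n * (k + 1)" by (simp add: distrib_left)
    also have "\<dots> \<le> u * u" using k u(2) by (intro mult_le_mono) auto
    finally show ?thesis .
  qed
  then have "real (length ys) \<le> real u ^ 2"
    unfolding len by (simp add: power2_eq_square flip: of_nat_mult)
  then have "real (length ys) * (1 / real u ^ 6) \<le> real u ^ 2 * (1 / real u ^ 6)"
    by (intro mult_right_mono) auto
  also have "\<dots> = 1 / real u ^ 4" using u(1) by (simp add: field_simps flip: power_add)
  finally have err: "real (length ys) * (1 / real u ^ 6) \<le> 1 / real u ^ 4" .
  have "real u / real T \<le> real u / real u ^ 16"
  proof (rule divide_left_mono)
    show "real u ^ 16 \<le> real T" using T(2) by (metis of_nat_le_iff of_nat_power)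
    show "0 < real T * real u ^ 16" using T_pos u by simp
  qed simp
  also have "\<dots> = 1 / real u ^ 15" using u(1) by (simp add: field_simps flip: power_Suc)
  also have "\<dots> \<le> 1 / real u ^ 4"
    using u(1) by (intro divide_left_mono power_increasing) auto
  finally have ini: "real u / real T \<le> 1 / real u ^ 4" .
  \<comment> \<open>The errors are one drift of \<open>u ^ (- 4)\<close> for each of the two colours
    and one initial gap of at most \<open>u ^ (- 4)\<close>; since \<open>u \<ge> 4\<close>, they
    add up to at most \<open>3 / 256\<close>.\<close>
  have "(4::real) ^ 4 \<le> real u ^ 4" using u(1) by (intro power_mono) auto
  then have "1 / real u ^ 4 \<le> 1 / 256" by (intro divide_left_mono) (use u(1) in auto)
  moreover fix i l l' assume il: "i < length Fs" "l \<in> {1..k}" "l' \<in> {1..k}"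
  have "\<bar>ext (fam i) (pr z l) - ext (fam i) (pr x0 l)\<bar> \<le> real (length ys) * (1 / real u ^ 6)"
    "\<bar>ext (fam i) (pr z l') - ext (fam i) (pr x0 l')\<bar> \<le> real (length ys) * (1 / real u ^ 6)"
    using iterate[OF x0_valid, of ys] il unfolding z by blast+
  ultimately show "\<bar>ext (fam i) (pr z l) - ext (fam i) (pr z l')\<bar> \<le> 1 / 8"
    using err ini ext_x0_close[OF il] by linarith
qed

end

section \<open>Success probability of one trial\<close>

lemma ln_2_le: "ln 2 \<le> (3 / 4 :: real)"
proof -
  have "2 \<le> 1 + 3 / 4 + (3 / 4)\<^sup>2 / (2 :: real)" by (simp add: power2_eq_square)
  also have "\<dots> \<le> exp (3 / 4)" by (rule exp_lower_Taylor_quadratic) simp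
  finally have "ln 2 \<le> ln (exp (3 / 4 :: real))" by (subst ln_le_cancel_iff) auto
  then show ?thesis by simp
qed

text \<open>Here \<open>M\<close> is the number of values in the union bound, \<open>N\<close>
  bounds the number of fractional elements, and \<open>1 / 16\<close> is half the tolerated gap
  between colours.\<close>

lemma failure_bound:
  fixes M N t :: real
  assumes "1 \<le> M" "M \<le> N" "1 \<le> t"
  defines "\<Lambda> \<equiv> sqrt (2 * N * t\<^sup>2 * (1 + ln (2 * M)))"
  shows "0 \<le> \<Lambda> / 2 - 1 / 16" "M * (2 * exp (- 2 * (\<Lambda> / 2 - 1 / 16)\<^sup>2 / (N * t\<^sup>2))) \<le> 1 / 2"
proof -
  define a where "a = N * t\<^sup>2"
  have "1 * 1 \<le> t * t" using assms(3) by (intro mult_mono) auto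
  then have "N * 1 \<le> N * t\<^sup>2" using assms by (intro mult_left_mono) (auto simp: power2_eq_square)
  then have a: "M \<le> a" "1 \<le> a" using assms(1,2) unfolding a_def by linarith+
  have ln: "0 \<le> ln (2 * M)" "ln (2 * M) \<le> 2 * M - 1"
    by (rule ln_ge_zero, use assms(1) in simp) (rule ln_le_minus_one, use assms(1) in simp)
  have "\<Lambda> = sqrt (2 * a * (1 + ln (2 * M)))" by (simp add: \<Lambda>_def a_def mult.assoc)
  moreover have nonneg: "0 \<le> 2 * a * (1 + ln (2 * M))" using a ln by simp
  ultimately have sq: "\<Lambda>\<^sup>2 = 2 * a * (1 + ln (2 * M))" and \<Lambda>0: "0 \<le> \<Lambda>" by simp_all
  have "1 * 1 \<le> 2 * a * (1 + ln (2 * M))" using a ln by (intro mult_mono) auto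
  then have "1\<^sup>2 \<le> \<Lambda>\<^sup>2" by (simp add: sq)
  then have "1 \<le> \<Lambda>" using \<Lambda>0 power2_le_imp_le by blast
  then show "0 \<le> \<Lambda> / 2 - 1 / 16" by simp
  have "2 * a * (1 + ln (2 * M)) \<le> 2 * a * (2 * a)" using a ln by (intro mult_left_mono) auto
  then have "\<Lambda>\<^sup>2 \<le> (2 * a)\<^sup>2" unfolding sq by (simp add: power2_eq_square)
  then have le: "\<Lambda> \<le> 2 * a" by (rule power2_le_imp_le) (use a in simp)
  \<comment> \<open>A failure probability of \<open>1 / 2\<close> needs \<open>ln (4 * M)\<close> in
    the exponent. The reserve \<open>a * (1 - ln 2)\<close> is at least \<open>a / 4\<close>, and
    \<open>\<Lambda> \<le> 2 * a\<close> lets it cover the loss \<open>\<Lambda> / 8\<close> from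
    the shift by \<open>1 / 16\<close>.\<close>
  have "a * (ln 2 + ln (2 * M)) \<le> a * (1 + ln (2 * M)) - \<Lambda> / 8"
  proof -
    have "a * ln 2 \<le> a * (3 / 4)" using a ln_2_le by (intro mult_left_mono) auto
    with le show ?thesis unfolding distrib_left by linarith
  qed
  also have "\<dots> \<le> 2 * (\<Lambda> / 2 - 1 / 16)\<^sup>2"
  proof -
    have "2 * (\<Lambda> / 2 - 1 / 16)\<^sup>2 = \<Lambda>\<^sup>2 / 2 - \<Lambda> / 8 + 1 / 128" by (simp add: power2_eq_square algebra_simps)
    then show ?thesis unfolding sq by simp
  qed
  finally have "ln 2 + ln (2 * M) \<le> 2 * (\<Lambda> / 2 - 1 / 16)\<^sup>2 / a" using a by (simp add: field_simps)
  moreover have "ln (2 * (2 * M)) = ln 2 + ln (2 * M)" by (rule ln_mult_pos) (use assms(1) in simp_all)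
  then have "ln 2 + ln (2 * M) = ln (4 * M)" by simp
  ultimately have "- 2 * (\<Lambda> / 2 - 1 / 16)\<^sup>2 / a \<le> - ln (4 * M)" by simp
  then have "exp (- 2 * (\<Lambda> / 2 - 1 / 16)\<^sup>2 / a) \<le> exp (- ln (4 * M))" by simp
  also have "\<dots> = 1 / (4 * M)" using assms(1) by (simp add: exp_minus inverse_eq_divide)
  finally have "M * (2 * exp (- 2 * (\<Lambda> / 2 - 1 / 16)\<^sup>2 / a)) \<le> M * (2 * (1 / (4 * M)))"
    using assms(1) by (intro mult_left_mono) auto
  then show "M * (2 * exp (- 2 * (\<Lambda> / 2 - 1 / 16)\<^sup>2 / (N * t\<^sup>2))) \<le> 1 / 2"
    using assms(1) by (simp add: a_def)
qed

lemma ext_cong: "(\<And>S j. S \<in> \<C> \<Longrightarrow> j \<in> S \<Longrightarrow> p j = q j) \<Longrightarrow> ext \<C> p = ext \<C> q"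
  unfolding ext_def by (intro sum.cong refl arg_cong2[where f = minus] prod.cong) auto

lemma disc_less_iff:
  assumes "1 \<le> m" "1 \<le> k"
  shows "disc n m k f \<kappa> < b \<longleftrightarrow> (\<forall>i\<in>{1..m}. \<forall>l\<in>{1..k}. \<forall>l'\<in>{1..k}.
    \<bar>f i (colour_class n \<kappa> l) - f i (colour_class n \<kappa> l')\<bar> < b)"
proof -
  have "{1..m} \<noteq> {}" "{1..k} \<times> {1..k} \<noteq> {}" using assms by auto
  then show ?thesis unfolding disc_def
    by (subst Max_less_iff, simp, simp, subst ball_simps, subst Max_less_iff) auto
qed

lemma disc_le_iff:
  assumes "1 \<le> m" "1 \<le> k"
  shows "disc n m k f \<kappa> \<le> b \<longleftrightarrow> (\<forall>i\<in>{1..m}. \<forall>l\<in>{1..k}. \<forall>l'\<in>{1..k}.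
    \<bar>f i (colour_class n \<kappa> l) - f i (colour_class n \<kappa> l')\<bar> \<le> b)"
proof -
  have "{1..m} \<noteq> {}" "{1..k} \<times> {1..k} \<noteq> {}" using assms by auto
  then show ?thesis unfolding disc_def
    by (subst Max_le_iff, simp, simp, subst ball_simps, subst Max_le_iff) auto
qed

text \<open>Independence of the trials: the event looks only at the first \<open>B\<close> bits, and
  trials read disjoint segments.\<close>

lemma avg_all_trials:
  assumes "\<And>us vs. length us = B \<Longrightarrow> P (us @ vs) = P us"
  shows "avg (Q * B) (\<lambda>bs. of_bool (\<forall>i<Q. P (drop (i * B) bs))) = avg B (\<lambda>us. of_bool (P us)) ^ Q"
proof (induction Q)
  case (Suc Q)
  have "avg (Suc Q * B) (\<lambda>bs. of_bool (\<forall>i<Suc Q. P (drop (i * B) bs)))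
      = avg B (\<lambda>us. avg (Q * B) (\<lambda>vs. of_bool (\<forall>i<Suc Q. P (drop (i * B) (us @ vs)))))"
    by (simp add: avg_add)
  also have "\<dots> = avg B (\<lambda>us. of_bool (P us) * avg (Q * B) (\<lambda>vs. of_bool (\<forall>i<Q. P (drop (i * B) vs))))"
  proof (rule avg_cong)
    fix us :: "bool list" assume us: "length us = B"
    have "of_bool (\<forall>i<Suc Q. P (drop (i * B) (us @ vs))) = (of_bool (P us) * of_bool (\<forall>i<Q. P (drop (i * B) vs)) :: real)" for vs
      using us assms[OF us, of vs] by (simp add: All_less_Suc2 del: All_less_Suc) 
    then show "avg (Q * B) (\<lambda>vs. of_bool (\<forall>i<Suc Q. P (drop (i * B) (us @ vs))))
        = of_bool (P us) * avg (Q * B) (\<lambda>vs. of_bool (\<forall>i<Q. P (drop (i * B) vs)))"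
      by (simp only: avg_mult_left)
  qed
  finally show ?case by (simp add: Suc.IH avg_mult_right)
qed simp

context relaxation
begin

definition round_col :: "bool list \<Rightarrow> nat \<Rightarrow> nat" where
  "round_col bs j = pick (cols z j) (drop (j * T) bs)"

lemma sample_eq: "sample T z bs = map (\<lambda>j. (j, round_col bs j)) [1..<n + 1]"
proof -
  have "sample T z bs = sample T (map (\<lambda>j. (j, cols z j)) [1..<n + 1]) bs"
    using valid_eq[OF relaxed_properties(1)] by simp
  then show ?thesis by (simp add: sample_def round_col_def comp_def)
qed

lemma length_cols_z: "j \<in> {1..n} \<Longrightarrow> length (cols z j) = 2 ^ L"
  using cols_valid[OF relaxed_properties(1)] T(1) by simp

lemma L_le_T: "L \<le> T"
  using less_exp[of L] T(1) by simp

lemma round_col_in: "j \<in> {1..n} \<Longrightarrow> round_col bs j \<in> {1..k}"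
  using pick_in[OF length_cols_z, of j] cols_valid[OF relaxed_properties(1), of j]
  unfolding round_col_def by blast

lemma round_col_append:
  assumes "length us = (n + 1) * T" "j \<in> {1..n}"
  shows "round_col (us @ vs) j = round_col us j"
proof -
  have "(j + 1) * T \<le> (n + 1) * T" using assms(2) by (intro mult_right_mono) auto
  then have "j * T + T \<le> length us" using assms(1) by (simp only: distrib_right mult_1)
  then show ?thesis unfolding round_col_def
    using L_le_T by (simp add: pick_append[OF length_cols_z[OF assms(2)]])
qed

lemma disc_round_col_append:
  assumes "length us = (n + 1) * T"
  shows "disc n m k f (round_col (us @ vs)) = disc n m k f (round_col us)"
proof -
  have "colour_class n (round_col (us @ vs)) = colour_class n (round_col us)"
    using round_col_append[OF assms] by (auto simp: colour_class_def fun_eq_iff)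
  then show ?thesis by (simp add: disc_def)
qed

text \<open>Element \<open>j\<close> stands at list position \<open>j - 1\<close> but reads block
  \<open>j\<close>; dropping the initial block aligns the sampler with
  \<open>rounded\<close>.\<close>

lemma coverage_round_col:
  assumes "i < length Fs"
  shows "coverage (fam i) (colour_class n (round_col bs) l) = ext (fam i) (rounded T l z (drop T bs) (pr z l))"
proof -
  have "indicator (colour_class n (round_col bs) l) j = rounded T l z (drop T bs) (pr z l) j"
    if "S \<in> fam i" "j \<in> S" for S j
  proof -
    have j: "j \<in> {1..n}" using fam_sub[OF assms that(1)] that(2) by blast
    have nth: "z ! (j - 1) = (j, cols z j)" "j - 1 < length z" "distinct (map fst z)"
    proof -
      have "z ! (j - 1) = map (\<lambda>j. (j, cols z j)) [1..<n + 1] ! (j - 1)"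
        using valid_eq[OF relaxed_properties(1)] by simp
      moreover have "j - 1 < n" "1 + (j - 1) = j" using j by auto
      ultimately show "z ! (j - 1) = (j, cols z j)" by (simp add: nth_upt)
      have "length (map fst z) = n" "distinct (map fst z)"
        using relaxed_properties(1) by (simp_all only: valid_def) simp_all
      then show "j - 1 < length z" "distinct (map fst z)" using j by auto
    qed
    have "rounded T l z (drop T bs) (pr z l) j = of_bool (pick (cols z j) (drop ((j - 1) * T) (drop T bs)) = l)"
      using rounded_nth[OF nth(3,2), of T l "drop T bs" "pr z l"] unfolding nth(1) by simp
    also have "drop ((j - 1) * T) (drop T bs) = drop (j * T) bs"
      using j by (cases j) (auto simp: add.commute)
    finally show ?thesis using j by (simp add: colour_class_def round_col_def indicator_def)
  qed
  then show ?thesis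
    using fam_sub[OF assms] by (subst coverage_eq_ext) (auto intro!: ext_cong)
qed

text \<open>The union bound runs over the \<open>m k\<close> single values and not over pairs of
  colours, which is why the logarithm contains \<open>k\<close> and not
  \<open>k ^ 2\<close>.\<close>

lemma trial_failure:
  assumes m: "1 \<le> length Fs" and f: "\<And>i. i < length Fs \<Longrightarrow> f (i + 1) = coverage (fam i)"
    and t: "\<And>j. j \<in> {1..n} \<Longrightarrow> card {S \<in> (\<Union>i<length Fs. fam i). j \<in> S} \<le> t" "t \<ge> 1"
    and s: "\<And>S. S \<in> (\<Union>i<length Fs. fam i) \<Longrightarrow> card S \<le> s" "s \<ge> 1"
  defines "\<Lambda> \<equiv> sqrt (2 * real (length Fs) * real t ^ 3 * real k * real s * (1 + ln (2 * real (length Fs) * real k)))"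
  shows "avg ((n + 1) * T) (\<lambda>bs. of_bool (\<not> disc n (length Fs) k f (round_col bs) < \<Lambda>)) \<le> 1 / 2"
proof -
  define M where "M = real (length Fs) * real k"
  define N where "N = M * real t * real s"
  define \<mu> where "\<mu> = \<Lambda> / 2 - 1 / 16"
  have M: "1 \<le> M" using mult_mono[of 1 "real (length Fs)" 1 "real k"] m k by (simp add: M_def)
  have "1 * 1 \<le> real t * real s" using t(2) s(2) by (intro mult_mono) auto
  then have "M * 1 \<le> M * (real t * real s)" using M by (intro mult_left_mono) auto
  then have N: "M \<le> N" by (simp add: N_def mult.assoc)
  have \<Lambda>: "\<Lambda> = sqrt (2 * N * (real t)\<^sup>2 * (1 + ln (2 * M)))"
    by (simp add: \<Lambda>_def N_def M_def power2_eq_square power3_eq_cube mult_ac)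
  have t1: "1 \<le> real t" using t(2) by simp
  note bound = failure_bound[OF M N t1, folded \<Lambda> \<mu>_def]
  define dev where "dev = (\<lambda>i l bs. \<bar>ext (fam i) (rounded T l z bs (pr z l)) - ext (fam i) (pr z l)\<bar> \<ge> \<mu>)"
  have len_z: "length z = n" "distinct (map fst z)"
  proof -
    have "map fst z = [1..<n + 1]" using relaxed_properties(1) by (simp only: valid_def)
    then have "length (map fst z) = n" "distinct (map fst z)" by (simp_all only: length_upt distinct_upt)
    then show "length z = n" "distinct (map fst z)" by simp_all
  qed
  have single: "avg (n * T) (\<lambda>bs. of_bool (dev i l bs)) \<le> 2 * exp (- 2 * \<mu>\<^sup>2 / (N * (real t)\<^sup>2))"
    if i: "i < length Fs" and l: "l \<in> {1..k}" for i l
  proof -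
    have "avg (length z * T) (\<lambda>bs. of_bool (\<bar>ext (fam i) (rounded T l z bs (pr z l)) - ext (fam i) (pr z l)\<bar> \<ge> \<mu>))
        \<le> 2 * exp (- 2 * \<mu>\<^sup>2 / (N * (real t)\<^sup>2))"
    proof (rule deviation_rounded)
      show "finite (fam i)" by (rule fam_finite)
      show "finite S" if "S \<in> fam i" for S using fam_sub[OF i that] by blast
      show "real (card {S \<in> fam i. fst e \<in> S}) \<le> real t" if "e \<in> set z" for e
      proof -
        have "fst e \<in> {1..n}" using cols_eq(2)[OF relaxed_properties(1) that] .
        from t(1)[OF this] have "card {S \<in> (\<Union>i<length Fs. fam i). fst e \<in> S} \<le> t" .
        moreover have "card {S \<in> fam i. fst e \<in> S} \<le> card {S \<in> (\<Union>i<length Fs. fam i). fst e \<in> S}"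
          using i fam_finite by (intro card_mono) auto
        ultimately show ?thesis by simp
      qed
      show "real t > 0" using t(2) by simp
      show "distinct (map fst z)" by (rule len_z(2))
      show "length (snd e) = 2 ^ L" if "e \<in> set z" for e
        using cols_eq[OF relaxed_properties(1) that] length_cols_z by simp
      show "L \<le> T" by (rule L_le_T)
      show "0 \<le> pr z l j" "pr z l j \<le> 1" for j by (rule pr_bounds)+
      show "pr z l (fst e) = weight (snd e) l" if "e \<in> set z" for e
        using cols_eq[OF relaxed_properties(1) that] by (simp add: pr_def)
      have "length (filter fractional z) \<le> length Fs * k * t * s"
        by (rule card_fractional_le[OF relaxed_properties(1,2) t s])
      then have "real (length (filter fractional z)) \<le> real (length Fs * k * t * s)" by (simp only: of_nat_le_iff)
      then show "real (length (filter fractional z)) \<le> N" by (simp add: N_def M_def)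
      show "N > 0" using M N by simp
      show "\<mu> \<ge> 0" by (rule bound(1))
    qed
    then show ?thesis by (simp add: dev_def len_z)
  qed
  \<comment> \<open>Two deviations below \<open>\<mu>\<close> and a gap of at most
    \<open>1 / 8\<close> stay below \<open>2 * \<mu> + 1 / 8 = \<Lambda>\<close>.\<close>
  have good: "disc n (length Fs) k f (round_col bs) < \<Lambda>"
    if "\<And>i l. i < length Fs \<Longrightarrow> l \<in> {1..k} \<Longrightarrow> \<not> dev i l (drop T bs)" for bs
    unfolding disc_less_iff[OF m k(1)]
  proof (intro ballI)
    fix i' l l' assume i': "i' \<in> {1..length Fs}" and l: "l \<in> {1..k}" "l' \<in> {1..k}"
    define i where "i = i' - 1"
    have i: "i < length Fs" "i' = i + 1" using i' by (auto simp: i_def)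
    show "\<bar>f i' (colour_class n (round_col bs) l) - f i' (colour_class n (round_col bs) l')\<bar> < \<Lambda>"
      unfolding i(2) f[OF i(1)] coverage_round_col[OF i(1)]
      using that[OF i(1) l(1)] that[OF i(1) l(2)] relaxed_properties(3)[OF i(1) l]
      unfolding dev_def \<mu>_def by linarith
  qed
  have "avg ((n + 1) * T) (\<lambda>bs. of_bool (\<not> disc n (length Fs) k f (round_col bs) < \<Lambda>))
      \<le> avg ((n + 1) * T) (\<lambda>bs. \<Sum>i<length Fs. \<Sum>l\<in>{1..k}. of_bool (dev i l (drop T bs)))"
  proof (rule avg_mono)
    fix bs :: "bool list"
    show "of_bool (\<not> disc n (length Fs) k f (round_col bs) < \<Lambda>)
        \<le> (\<Sum>i<length Fs. \<Sum>l\<in>{1..k}. of_bool (dev i l (drop T bs)) :: real)"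
    proof (cases "disc n (length Fs) k f (round_col bs) < \<Lambda>")
      case True
      then show ?thesis by (simp add: sum_nonneg)
    next
      case False
      then obtain i l where il: "i < length Fs" "l \<in> {1..k}" "dev i l (drop T bs)" using good by blast
      have "of_bool (dev i l (drop T bs)) \<le> (\<Sum>l\<in>{1..k}. of_bool (dev i l (drop T bs)) :: real)"
        by (rule member_le_sum[OF il(2)]) auto
      also have "\<dots> \<le> (\<Sum>i<length Fs. \<Sum>l\<in>{1..k}. of_bool (dev i l (drop T bs)) :: real)"
        by (rule member_le_sum[of i "{..<length Fs}" "\<lambda>i. \<Sum>l\<in>{1..k}. of_bool (dev i l (drop T bs)) :: real"])
           (use il(1) in \<open>auto intro: sum_nonneg\<close>)
      finally show ?thesis using il(3) False by simp
    qed
  qed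
  also have "\<dots> = (\<Sum>i<length Fs. \<Sum>l\<in>{1..k}. avg ((n + 1) * T) (\<lambda>bs. of_bool (dev i l (drop T bs))))"
    by (simp only: avg_sum)
  also have "\<dots> \<le> (\<Sum>i<length Fs. \<Sum>l\<in>{1..k}. 2 * exp (- 2 * \<mu>\<^sup>2 / (N * (real t)\<^sup>2)))"
  proof (intro sum_mono)
    fix i l assume il: "i \<in> {..<length Fs}" "l \<in> {1..k}"
    \<comment> \<open>Averaging out the initial block leaves the \<open>n\<close> blocks read by
      \<open>rounded\<close>.\<close>
    have "avg ((n + 1) * T) (\<lambda>bs. of_bool (dev i l (drop T bs)))
        = avg T (\<lambda>us. avg (n * T) (\<lambda>vs. of_bool (dev i l (drop T (us @ vs)))))"
      unfolding distrib_right mult_1 add.commute[of "n * T"] by (rule avg_add)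
    also have "\<dots> = avg T (\<lambda>us. avg (n * T) (\<lambda>vs. of_bool (dev i l vs)))"
      by (rule avg_cong) simp
    also have "\<dots> = avg (n * T) (\<lambda>vs. of_bool (dev i l vs))" by simp
    also have "\<dots> \<le> 2 * exp (- 2 * \<mu>\<^sup>2 / (N * (real t)\<^sup>2))" using single il by simp
    finally show "avg ((n + 1) * T) (\<lambda>bs. of_bool (dev i l (drop T bs))) \<le> 2 * exp (- 2 * \<mu>\<^sup>2 / (N * (real t)\<^sup>2))" .
  qed
  also have "\<dots> = M * (2 * exp (- 2 * \<mu>\<^sup>2 / (N * (real t)\<^sup>2)))" by (simp add: M_def)
  also have "\<dots> \<le> 1 / 2" by (rule bound(2))
  finally show ?thesis .
qed

end

section \<open>Independent trials\<close>

text \<open>Lists of one function represent distinct sets, so counting lists counts sets.\<close>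

lemma sum_image_set:
  assumes "distinct (map set F)"
  shows "real (length (filter (\<lambda>S. R (set S)) F)) = (\<Sum>S\<in>set ` set F. of_bool (R S))"
  using assms by (induction F) auto

context relaxation
begin

lemma real_cov:
  assumes "i < length Fs"
  shows "real (cov (map (\<lambda>j. (j, \<kappa> j)) [1..<n + 1]) (Fs ! i) l) = coverage (fam i) (colour_class n \<kappa> l)"
proof -
  let ?F = "Fs ! i"
  define R where "R = (\<lambda>S. \<exists>j\<in>S. \<exists>e\<in>set (map (\<lambda>j. (j, \<kappa> j)) [1..<n + 1]). e = (j, l))"
  have "real (cov (map (\<lambda>j. (j, \<kappa> j)) [1..<n + 1]) ?F l) = real (length (filter (\<lambda>S. R (set S)) ?F))"
    by (simp only: cov_def R_def)
  also have "\<dots> = (\<Sum>S\<in>fam i. of_bool (R S))"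
    unfolding fam_def by (rule sum_image_set) (use Fs(1)[of ?F] assms in simp)
  also have "\<dots> = coverage (fam i) (colour_class n \<kappa> l)"
    unfolding coverage_def
  proof (rule sum.cong)
    fix S assume "S \<in> fam i"
    then have S: "finite S" "S \<subseteq> {1..n}" using fam_sub[OF assms] by blast+
    have R: "R S \<longleftrightarrow> S \<inter> colour_class n \<kappa> l \<noteq> {}"
      using S(2) by (auto simp: R_def colour_class_def)
    show "of_bool (R S) = min (real (card (S \<inter> colour_class n \<kappa> l))) 1"
    proof (cases "S \<inter> colour_class n \<kappa> l = {}")
      case False
      then have "0 < card (S \<inter> colour_class n \<kappa> l)" using S(1) by (simp add: card_gt_0_iff)
      then have "1 \<le> card (S \<inter> colour_class n \<kappa> l)" by linarith
      then show ?thesis using False by (simp add: R)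
    qed (simp add: R)
  qed simp
  finally show ?thesis .
qed

lemma real_discr:
  assumes m: "1 \<le> length Fs" and f: "\<And>i. i < length Fs \<Longrightarrow> f (i + 1) = coverage (fam i)"
  shows "real_of_int (discr Fs [1..<k + 1] (map (\<lambda>j. (j, \<kappa> j)) [1..<n + 1])) = disc n (length Fs) k f \<kappa>"
proof -
  define K where "K = map (\<lambda>j. (j, \<kappa> j)) [1..<n + 1]"
  define zs where "zs = concat (map (\<lambda>F. concat (map (\<lambda>l. map (\<lambda>l'. int (cov K F l) - int (cov K F l')) [1..<k + 1])
    [1..<k + 1])) Fs)"
  define F where "F = (\<lambda>i l. f i (colour_class n \<kappa> l))"
  have discr: "discr Fs [1..<k + 1] K = argmin (\<lambda>z. 0 - z) 0 zs" by (simp add: discr_def zs_def)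
  have val: "real_of_int (int (cov K (Fs ! i) l) - int (cov K (Fs ! i) l')) = F (i + 1) l - F (i + 1) l'"
    if "i < length Fs" for i l l'
    using that real_cov[OF that] f[OF that] by (simp add: K_def F_def)
  have zs: "set zs = (\<Union>F\<in>set Fs. \<Union>l\<in>{1..k}. (\<lambda>l'. int (cov K F l) - int (cov K F l')) ` {1..k})"
    by (simp add: zs_def)
  have zs_in: "int (cov K (Fs ! i) l) - int (cov K (Fs ! i) l') \<in> set zs"
    if "i < length Fs" "l \<in> {1..k}" "l' \<in> {1..k}" for i l l'
    unfolding zs by (intro UN_I[OF nth_mem[OF that(1)]] UN_I[OF that(2)] imageI that(3))
  have "zs \<noteq> []"
  proof -
    have "int (cov K (Fs ! 0) 1) - int (cov K (Fs ! 0) 1) \<in> set zs"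
      by (rule zs_in) (use m k in auto)
    then show ?thesis by auto
  qed
  then have "discr Fs [1..<k + 1] K \<in> set zs" unfolding discr by (rule argmin_in)
  then obtain F' l l' where F': "F' \<in> set Fs" and l: "l \<in> {1..k}" "l' \<in> {1..k}"
    "discr Fs [1..<k + 1] K = int (cov K F' l) - int (cov K F' l')"
    unfolding zs by blast
  obtain i where "i < length Fs" "F' = Fs ! i" using F' by (metis in_set_conv_nth)
  with l have il: "i < length Fs" "l \<in> {1..k}" "l' \<in> {1..k}"
    "discr Fs [1..<k + 1] K = int (cov K (Fs ! i) l) - int (cov K (Fs ! i) l')" by simp_all
  have "real_of_int (discr Fs [1..<k + 1] K) = F (i + 1) l - F (i + 1) l'"
    unfolding il(4) by (rule val[OF il(1)])
  also have "\<dots> \<le> \<bar>F (i + 1) l - F (i + 1) l'\<bar>" by simp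
  also have "\<dots> \<le> disc n (length Fs) k f \<kappa>"
    using iffD1[OF disc_le_iff[OF m k(1), where n = n and f = f and \<kappa> = \<kappa>] order_refl] il(1-3) unfolding F_def by auto
  finally have le: "real_of_int (discr Fs [1..<k + 1] K) \<le> disc n (length Fs) k f \<kappa>" .
  have ge: "F (i + 1) l - F (i + 1) l' \<le> real_of_int (discr Fs [1..<k + 1] K)"
    if "i < length Fs" "l \<in> {1..k}" "l' \<in> {1..k}" for i l l'
  proof -
    from argmin_le[OF zs_in[OF that], of "\<lambda>z. 0 - z" 0]
    have "int (cov K (Fs ! i) l) - int (cov K (Fs ! i) l') \<le> discr Fs [1..<k + 1] K" by (simp add: discr)
    then show ?thesis unfolding val[OF that(1), symmetric] by (simp only: of_int_le_iff)
  qed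
  have "disc n (length Fs) k f \<kappa> \<le> real_of_int (discr Fs [1..<k + 1] K)"
    unfolding disc_le_iff[OF m k(1)]
  proof (intro ballI)
    fix i' l l' assume i': "i' \<in> {1..length Fs}" and l: "l \<in> {1..k}" "l' \<in> {1..k}"
    have "i' - 1 < length Fs" "i' = (i' - 1) + 1" using i' by auto
    then show "\<bar>f i' (colour_class n \<kappa> l) - f i' (colour_class n \<kappa> l')\<bar> \<le> real_of_int (discr Fs [1..<k + 1] K)"
      using ge[of "i' - 1" l l'] ge[of "i' - 1" l' l] l unfolding F_def by (simp add: abs_le_iff)
  qed
  with le show ?thesis by (simp add: K_def)
qed

end

section \<open>Sizes of the unary parameters\<close>

lemma double_until_length:
  fixes us :: "'c list"
  assumes "length a = 2 ^ j"
  shows "\<exists>i. length (foldl (\<lambda>a _. if length a < N then a @ a else a) a us) = 2 ^ i \<and>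
    (N \<le> 2 ^ i \<or> i = j + length us)"
  using assms
proof (induction us arbitrary: a j)
  case (Cons x us)
  show ?case
  proof (cases "length a < N")
    case True
    have "length (a @ a) = 2 ^ (j + 1)" using Cons.prems by (simp add: power_add mult_2_right)
    from Cons.IH[OF this] True show ?thesis by auto
  next
    case False
    have "foldl (\<lambda>a _. if length a < N then a @ a else a) a us = a" for us :: "'c list"
      using False by (induction us) auto
    then show ?thesis using False Cons.prems by (intro exI[of _ j]) simp
  qed
qed auto

lemma length_sq_tokens: "length (sq_tokens l) = length l * length l"
  by (simp add: sq_tokens_def length_concat comp_def sum_list_triv)

lemma length_denominator:
  obtains L where "length (denominator z) = 2 ^ L" "length (size_tokens z) ^ 16 \<le> length (denominator z)"
proof -
  define us where "us = size_tokens z"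
  obtain i where i: "length (double_until (length us) us) = 2 ^ i"
    "length us \<le> 2 ^ i \<or> i = 0 + length us"
    using double_until_length[of "[0 :: nat]" 0 "length us" us] unfolding double_until_def by auto
  \<comment> \<open>If the threshold was never reached, every token caused a doubling, and
    \<open>2 ^ length us\<close> exceeds \<open>length us\<close> anyway.\<close>
  then have le: "length us \<le> 2 ^ i" using less_exp[of "length us"] by auto
  have len: "length (denominator z) = (2 ^ i) ^ 16"
    using i(1) by (simp add: denominator_def length_sq_tokens us_def flip: power_add power2_eq_square)
  have "length us ^ 16 \<le> (2 ^ i) ^ 16" using le by (rule power_mono) simp
  then show ?thesis using that[of "i * 16"] len by (simp add: us_def power_mult)
qed

lemma filter_upt_le: "k < n \<Longrightarrow> filter (\<lambda>j. j \<le> k) [1..<n + 1] = [1..<k + 1]"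
proof -
  assume "k < n"
  then have n: "n + 1 = k + 1 + (n - k)" by simp
  have "[1..<n + 1] = [1..<k + 1] @ [k + 1..<n + 1]"
    unfolding n by (rule upt_add_eq_append) simp
  moreover have "filter (\<lambda>j. j \<le> k) [1..<k + 1] = [1..<k + 1]" by (rule filter_True) auto
  moreover have "filter (\<lambda>j. j \<le> k) [k + 1..<n + 1] = []" by (rule filter_False) auto
  ultimately show ?thesis by (simp only: filter_append append_Nil2)
qed

lemma length_size_tokens:
  "length (size_tokens (ns, k, Fs)) = 4 + length ns + length Fs + sum_list (map length Fs)
     + sum_list (map (\<lambda>F. sum_list (map length F)) Fs)"
proof -
  have "length (concat (concat Fs)) = sum_list (map (\<lambda>F. sum_list (map length F)) Fs)"
    by (induction Fs) (simp_all add: length_concat)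
  then show ?thesis by (simp add: size_tokens_def length_concat)
qed

lemma relaxation_of_instance:
  assumes "k < n" "1 \<le> k" "lists_family n m \<S> Fs"
  defines "z \<equiv> ([1..<n + 1], k, Fs)"
  obtains L where "relaxation n k (length (denominator z)) L (length (size_tokens z)) Fs"
    "params_of z = relaxation.w k (length (denominator z)) (length (size_tokens z)) Fs"
proof -
  obtain L where L: "length (denominator z) = 2 ^ L" "length (size_tokens z) ^ 16 \<le> length (denominator z)"
    by (rule length_denominator)
  have u: "length (size_tokens z) = 4 + n + length Fs + sum_list (map length Fs)
     + sum_list (map (\<lambda>F. sum_list (map length F)) Fs)"
    unfolding z_def length_size_tokens by simp
  have rel: "relaxation n k (length (denominator z)) L (length (size_tokens z)) Fs"
  proof
    fix F assume F: "F \<in> set Fs"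
    then obtain i where i: "i < m" "F = Fs ! i"
      using assms(3) by (auto simp: lists_family_def in_set_conv_nth)
    then show "distinct (map set F)" "S \<in> set F \<Longrightarrow> distinct S \<and> set S \<subseteq> {1..n}" for S
      using assms(3) unfolding lists_family_def by blast+
    have "length F \<le> sum_list (map length Fs)" using F by (intro member_le_sum_list) auto
    then show "length F \<le> length (size_tokens z)" unfolding u by simp
    have "sum_list (map length F) \<le> sum_list (map (\<lambda>F. sum_list (map length F)) Fs)"
      using F by (intro member_le_sum_list) auto
    then show "sum_list (map length F) \<le> length (size_tokens z)" unfolding u by simp
  qed (use assms(1,2) L u in auto)
  have "params_of z = relaxation.w k (length (denominator z)) (length (size_tokens z)) Fs"
    unfolding relaxation.w_def[OF rel] using filter_upt_le[OF assms(1)]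
    by (simp add: params_of_def) (simp add: z_def)
  with rel show ?thesis by (rule that)
qed

lemma sz_nat_list_le:
  assumes "\<And>j. j \<in> set S \<Longrightarrow> j \<le> u"
  shows "sz (S :: nat list) \<le> 1 + length S * (2 + u)"
proof -
  have "sz S \<le> 1 + length S * (1 + (1 + u))"
  proof (rule sz_list_le)
    fix j assume "j \<in> set S"
    then show "sz j \<le> 1 + u" using assms[of j] bits_int_le[of j] by simp
  qed
  then show ?thesis by (simp add: algebra_simps)
qed

lemma sz_family_le:
  assumes "\<And>S j. S \<in> set F \<Longrightarrow> j \<in> set S \<Longrightarrow> j \<le> u"
  shows "sz (F :: nat list list) \<le> 1 + 2 * length F + (2 + u) * sum_list (map length F)"
  using assms
proof (induction F)
  case (Cons S F)
  have "sz S \<le> 1 + length S * (2 + u)" by (rule sz_nat_list_le) (use Cons.prems in auto)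
  moreover have "sz F \<le> 1 + 2 * length F + (2 + u) * sum_list (map length F)"
    by (rule Cons.IH) (use Cons.prems in auto)
  ultimately show ?case by (simp add: algebra_simps)
qed simp

lemma sz_families_le:
  assumes "\<And>F S j. F \<in> set Fs \<Longrightarrow> S \<in> set F \<Longrightarrow> j \<in> set S \<Longrightarrow> j \<le> u"
  shows "sz (Fs :: nat list list list) \<le> 1 + 2 * length Fs + 2 * sum_list (map length Fs)
    + (2 + u) * sum_list (map (\<lambda>F. sum_list (map length F)) Fs)"
  using assms
proof (induction Fs)
  case (Cons F Fs)
  have "sz F \<le> 1 + 2 * length F + (2 + u) * sum_list (map length F)"
    by (rule sz_family_le) (use Cons.prems in auto)
  moreover have "sz Fs \<le> 1 + 2 * length Fs + 2 * sum_list (map length Fs)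
    + (2 + u) * sum_list (map (\<lambda>F. sum_list (map length F)) Fs)"
    by (rule Cons.IH) (erule (2) Cons.prems[OF list.set_intros(2)])
  ultimately show ?case by (simp add: algebra_simps)
qed simp

text \<open>Relates the size in the theorem to the token count: \<open>2 ^ (- c' * u)\<close> then
  beats any required power of the input size. For \<open>k < n\<close> the binary \<open>k\<close>
  is short as well.\<close>

lemma sz_instance_le:
  assumes "k < n" "lists_family n m \<S> Fs"
  defines "u \<equiv> length (size_tokens ([1..<n + 1], k, Fs))"
  shows "sz ([1..<n + 1], k, Fs) \<le> u ^ 2"
proof -
  define A where "A = sum_list (map length Fs)"
  define B where "B = sum_list (map (\<lambda>F. sum_list (map length F)) Fs)"
  have u: "u = 4 + n + length Fs + A + B" unfolding u_def length_size_tokens A_def B_def by simp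
  have "sz [1..<n + 1] \<le> 1 + length [1..<n + 1] * (2 + u)"
    by (rule sz_nat_list_le) (use u in auto)
  then have 1: "sz [1..<n + 1] \<le> 1 + n * (2 + u)" by simp
  have "sz Fs \<le> 1 + 2 * length Fs + 2 * A + (2 + u) * B"
    unfolding A_def B_def
  proof (rule sz_families_le)
    fix F S j assume F: "F \<in> set Fs" "S \<in> set F" "j \<in> set S"
    then obtain i where "i < m" "F = Fs ! i"
      using assms(2) by (auto simp: lists_family_def in_set_conv_nth)
    then have "set S \<subseteq> {1..n}" using assms(2) F(2) unfolding lists_family_def by blast
    then have "j \<le> n" using F(3) by auto
    then show "j \<le> u" using u by simp
  qed
  also have "\<dots> \<le> 1 + (2 + u) * (length Fs + A + B)" by (simp add: algebra_simps)
  finally have 2: "sz Fs \<le> 1 + (2 + u) * (length Fs + A + B)" .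
  have 3: "sz k \<le> 1 + u" using bits_int_le[of k] assms(1) u by simp
  have "sz ([1..<n + 1], k, Fs) \<le> 5 + u + (2 + u) * (n + length Fs + A + B)"
    using 1 2 3 by (simp add: algebra_simps)
  also have "n + length Fs + A + B = u - 4" using u by simp
  \<comment> \<open>The four leading tokens ensure \<open>u \<ge> 4\<close>, so the subtraction is
    exact, and they absorb the constant overhead of the encoding.\<close>
  also have "5 + u + (2 + u) * (u - 4) \<le> u ^ 2"
  proof -
    obtain v where v: "u = v + 4" using u by (metis add.commute add.assoc)
    then show ?thesis by (simp add: power2_eq_square algebra_simps)
  qed
  finally show ?thesis .
qed

lemma lists_family_index:
  assumes "lists_family n m \<S> Fs"
  shows "length Fs = m" "i < m \<Longrightarrow> \<S> (i + 1) = set ` set (Fs ! i)" "\<forall>i\<in>{1..m}. finite (\<S> i)"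
    "(\<Union>i<m. set ` set (Fs ! i)) = (\<Union>i\<in>{1..m}. \<S> i)"
proof -
  show "length Fs = m" using assms by (simp add: lists_family_def)
  have S: "\<S> (i + 1) = set ` set (Fs ! i)" if "i < m" for i
    using assms that by (simp add: lists_family_def Suc_eq_plus1)
  then show "i < m \<Longrightarrow> \<S> (i + 1) = set ` set (Fs ! i)" by blast
  have idx: "\<S> i = set ` set (Fs ! (i - 1)) \<and> i - 1 < m" if "i \<in> {1..m}" for i
    using S[of "i - 1"] that by auto
  then show "\<forall>i\<in>{1..m}. finite (\<S> i)" by auto
  show "(\<Union>i<m. set ` set (Fs ! i)) = (\<Union>i\<in>{1..m}. \<S> i)"
  proof
    show "(\<Union>i<m. set ` set (Fs ! i)) \<subseteq> (\<Union>i\<in>{1..m}. \<S> i)"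
    proof (rule UN_least)
      fix i assume "i \<in> {..<m}"
      then have "set ` set (Fs ! i) = \<S> (i + 1)" "i + 1 \<in> {1..m}" using S by auto
      then show "set ` set (Fs ! i) \<subseteq> (\<Union>i\<in>{1..m}. \<S> i)" by blast
    qed
    show "(\<Union>i\<in>{1..m}. \<S> i) \<subseteq> (\<Union>i<m. set ` set (Fs ! i))"
      using idx by (intro UN_least) blast
  qed
qed

text \<open>Each class has at most one element, so by sparsity every value lies between
  \<open>0\<close> and \<open>t\<close>, and \<open>t ^ 2\<close> is less than the radicand.\<close>

lemma disc_identity_less:
  assumes "1 \<le> m" "1 \<le> k" "1 \<le> t" "1 \<le> s" and fin: "\<forall>i\<in>{1..m}. finite (\<S> i)"
    and sparse: "sparse_coverage_family n m t \<S>"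
  shows "disc n m k (\<lambda>i. coverage (\<S> i)) (\<lambda>j. j)
    < sqrt (2 * real m * real t ^ 3 * real k * real s * (1 + ln (2 * real m * real k)))"
  unfolding disc_less_iff[OF assms(1,2)]
proof (intro ballI)
  define U where "U = (\<Union>i\<in>{1..m}. \<S> i)"
  have bounds: "0 \<le> coverage (\<S> i) (colour_class n (\<lambda>j. j) l) \<and> coverage (\<S> i) (colour_class n (\<lambda>j. j) l) \<le> real t"
    if i: "i \<in> {1..m}" for i l
  proof
    show "0 \<le> coverage (\<S> i) (colour_class n (\<lambda>j. j) l)" by (simp add: coverage_def sum_nonneg)
    have "coverage (\<S> i) (colour_class n (\<lambda>j. j) l) \<le> (\<Sum>S\<in>\<S> i. of_bool (l \<in> S \<and> l \<in> {1..n}))"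
      unfolding coverage_def
    proof (rule sum_mono)
      fix S
      show "min (real (card (S \<inter> colour_class n (\<lambda>j. j) l))) 1 \<le> of_bool (l \<in> S \<and> l \<in> {1..n})"
      proof (cases "l \<in> S \<and> l \<in> {1..n}")
        case False
        then have "S \<inter> colour_class n (\<lambda>j. j) l = {}" by (auto simp: colour_class_def)
        then show ?thesis by simp
      qed simp
    qed
    also have "\<dots> \<le> real t"
    proof (cases "l \<in> {1..n}")
      case True
      have "(\<Sum>S\<in>\<S> i. of_bool (l \<in> S \<and> l \<in> {1..n})) = real (card {S \<in> \<S> i. l \<in> S})"
        using True fin i by (simp add: sum.If_cases of_bool_def Int_def)
      also have "\<dots> \<le> real (card {S \<in> U. l \<in> S})"
        using fin i by (intro of_nat_mono card_mono) (auto simp: U_def)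
      also have "\<dots> \<le> real t"
        using sparse True by (simp only: of_nat_le_iff sparse_coverage_family_def U_def)
      finally show ?thesis .
    next
      case False
      then show ?thesis by (simp del: atLeastAtMost_iff)
    qed
    finally show "coverage (\<S> i) (colour_class n (\<lambda>j. j) l) \<le> real t" .
  qed
  fix i l l' assume i: "i \<in> {1..m}"
  have "\<bar>coverage (\<S> i) (colour_class n (\<lambda>j. j) l) - coverage (\<S> i) (colour_class n (\<lambda>j. j) l')\<bar> \<le> real t"
    using bounds[OF i, of l] bounds[OF i, of l'] by linarith
  also have "real t < sqrt (2 * real m * real t ^ 3 * real k * real s * (1 + ln (2 * real m * real k)))"
  proof (rule real_less_rsqrt)
    have r: "1 \<le> real m" "1 \<le> real t" "1 \<le> real k" "1 \<le> real s" using assms by auto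
    have "1 * 1 \<le> real m * real k" using r by (intro mult_mono) auto
    then have ln: "0 \<le> ln (2 * real m * real k)" by (intro ln_ge_zero) simp
    have "1 * 1 * 1 * 1 * 1 \<le> real m * real t * real k * real s * (1 + ln (2 * real m * real k))"
      using r ln by (intro mult_mono) auto
    then have "(real t)\<^sup>2 * 2 * 1 \<le> (real t)\<^sup>2 * 2 * (real m * real t * real k * real s * (1 + ln (2 * real m * real k)))"
      by (intro mult_left_mono) auto
    moreover have "0 < (real t)\<^sup>2" using r by simp
    ultimately show "(real t)\<^sup>2 < 2 * real m * real t ^ 3 * real k * real s * (1 + ln (2 * real m * real k))"
      by (simp add: power2_eq_square power3_eq_cube mult_ac)
  qed
  finally show "\<bar>coverage (\<S> i) (colour_class n (\<lambda>j. j) l) - coverage (\<S> i) (colour_class n (\<lambda>j. j) l')\<bar>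
    < sqrt (2 * real m * real t ^ 3 * real k * real s * (1 + ln (2 * real m * real k)))" .
qed

section \<open>Assembling the algorithm\<close>

lemma length_coin_tokens:
  "length (coin_tokens c ([1..<n + 1], k, Fs)) = length (trials c ([1..<n + 1], k, Fs))
     * ((n + 1) * length (denominator ([1..<n + 1], k, Fs)))"
  by (simp add: coin_tokens_def length_concat comp_def sum_list_triv distrib_right)

lemma length_trials: "length (trials c z) = c * length (size_tokens z)"
  by (simp add: trials_def length_concat comp_def sum_list_replicate)

lemma solve_large: "n \<le> k \<Longrightarrow> solve c (([1..<n + 1], k, Fs), bs) = map (\<lambda>j. j) [1..<n + 1]"
  by (simp add: solve_def)

lemma solve_small:
  assumes kn: "k < n" and "1 \<le> k" "1 \<le> m" "1 \<le> c" and lf: "lists_family n m \<S> Fs"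
  defines "I \<equiv> ([1..<n + 1], k, Fs)"
  shows "\<exists>\<kappa>\<in>{1..n} \<rightarrow> {1..k}. solve c (I, bs) = map \<kappa> [1..<n + 1]"
    and "1 \<le> t \<Longrightarrow> 1 \<le> s \<Longrightarrow> sparse_coverage_family n m t \<S> \<Longrightarrow> \<forall>S\<in>(\<Union>i\<in>{1..m}. \<S> i). card S \<le> s \<Longrightarrow>
      1 - (1 / 2) ^ length (trials c I) \<le> avg (length (coin_tokens c I)) (\<lambda>bs. of_bool
        (\<exists>\<kappa>\<in>{1..n} \<rightarrow> {1..k}. solve c (I, bs) = map \<kappa> [1..<n + 1] \<and> disc n m k (\<lambda>i. coverage (\<S> i)) \<kappa>
          < sqrt (2 * real m * real t ^ 3 * real k * real s * (1 + ln (2 * real m * real k)))))"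
proof -
  define T where "T = length (denominator I)"
  define u where "u = length (size_tokens I)"
  obtain L where rel: "relaxation n k T L u Fs" and w: "params_of I = relaxation.w k T u Fs"
    using relaxation_of_instance[OF assms(1,2) lf] unfolding I_def T_def u_def by blast
  interpret R: relaxation n k T L u Fs by (rule rel)
  define f where "f = (\<lambda>i. coverage (\<S> i))"
  define B where "B = (n + 1) * T"
  define Q where "Q = length (trials c I)"
  define col where "col = (\<lambda>bs q. R.round_col (drop (q * B) bs))"
  note fam = lists_family_index[OF lf]
  have f: "f (i + 1) = coverage (R.fam i)" if "i < length Fs" for i
    using fam(2)[of i] that unfolding fam(1) by (simp add: f_def R.fam_def)
  have m: "1 \<le> length Fs" using assms(3) fam(1) by simp
  define K where "K = (\<lambda>bs q. map (\<lambda>j. (j, col bs q j)) [1..<n + 1])"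
  have solve: "solve c (I, bs) = map snd (argmin (discr Fs [1..<k + 1]) [] (map (K bs) [0..<Q]))" for bs
  proof -
    have K: "K bs = (\<lambda>q. sample T (relaxed R.w [1..<n + 1]) (drop (q * B) bs))"
      by (simp only: K_def col_def R.sample_eq)
    have cl: "fst (snd R.w) = [1..<k + 1]" by (simp only: R.w_def fst_conv snd_conv)
    have I: "fst I = [1..<n + 1]" "fst (snd I) = k" "snd (snd I) = Fs" by (simp_all add: I_def)
    have B': "Suc (length [1..<n + 1]) * T = B" by (simp add: B_def distrib_right)
    have large: "(length [1..<n + 1] \<le> k) = False" using kn by simp
    show ?thesis
      by (simp only: solve_def fst_conv snd_conv I w cl K large if_False T_def[symmetric] B' Q_def)
  qed
  have "0 < Q" using assms(4) by (simp add: Q_def length_trials size_tokens_def)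
  \<comment> \<open>\<open>discr\<close> is the discrepancy as an exact integer, so the selected
    trial is at least as good as any trial that meets the unknown bound.\<close>
  have best: "\<exists>q0<Q. solve c (I, bs) = map (col bs q0) [1..<n + 1] \<and>
      (\<forall>q<Q. disc n m k f (col bs q0) \<le> disc n m k f (col bs q))" for bs
  proof -
    define a where "a = argmin (discr Fs [1..<k + 1]) [] (map (K bs) [0..<Q])"
    have "a \<in> set (map (K bs) [0..<Q])" unfolding a_def using \<open>0 < Q\<close> by (intro argmin_in) auto
    then obtain q0 where q0: "q0 < Q" "a = K bs q0" by auto
    have d: "real_of_int (discr Fs [1..<k + 1] (K bs q)) = disc n m k f (col bs q)" for q
      using R.real_discr[where f = f and \<kappa> = "col bs q", OF m f] by (simp only: K_def fam(1))
    have "disc n m k f (col bs q0) \<le> disc n m k f (col bs q)" if "q < Q" for q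
    proof -
      have "discr Fs [1..<k + 1] a \<le> discr Fs [1..<k + 1] (K bs q)"
        unfolding a_def by (rule argmin_le) (use that in auto)
      then have "real_of_int (discr Fs [1..<k + 1] (K bs q0)) \<le> real_of_int (discr Fs [1..<k + 1] (K bs q))"
        unfolding q0(2) by (simp only: of_int_le_iff)
      then show ?thesis
        by (simp only: d)
    qed
    moreover have "solve c (I, bs) = map (col bs q0) [1..<n + 1]"
      unfolding solve a_def[symmetric] q0(2) by (simp add: K_def comp_def)
    ultimately show ?thesis using q0(1) by blast
  qed
  have col: "col bs q \<in> {1..n} \<rightarrow> {1..k}" for bs q
    using R.round_col_in unfolding col_def by blast
  show "\<exists>\<kappa>\<in>{1..n} \<rightarrow> {1..k}. solve c (I, bs) = map \<kappa> [1..<n + 1]"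
    using best[of bs] col by blast
  assume t: "1 \<le> t" and s: "1 \<le> s" and sparse: "sparse_coverage_family n m t \<S>"
    and card: "\<forall>S\<in>(\<Union>i\<in>{1..m}. \<S> i). card S \<le> s"
  define \<Lambda> where "\<Lambda> = sqrt (2 * real m * real t ^ 3 * real k * real s * (1 + ln (2 * real m * real k)))"
  define bad where "bad = (\<lambda>bs. \<not> disc n m k f (R.round_col bs) < \<Lambda>)"
  have U: "(\<Union>i<length Fs. R.fam i) = (\<Union>i\<in>{1..m}. \<S> i)"
    using fam(1,4) by (simp add: R.fam_def)
  have "avg ((n + 1) * T) (\<lambda>bs. of_bool (\<not> disc n (length Fs) k f (R.round_col bs)
      < sqrt (2 * real (length Fs) * real t ^ 3 * real k * real s * (1 + ln (2 * real (length Fs) * real k))))) \<le> 1 / 2"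
  proof (rule R.trial_failure[where f = f, OF m f _ t _ s])
    show "card {S \<in> (\<Union>i<length Fs. R.fam i). j \<in> S} \<le> t" if "j \<in> {1..n}" for j
      using sparse that unfolding U sparse_coverage_family_def by blast
    show "card S \<le> s" if "S \<in> (\<Union>i<length Fs. R.fam i)" for S
      using card that unfolding U by blast
  qed
  then have half: "avg B (\<lambda>bs. of_bool (bad bs)) \<le> 1 / 2" by (simp only: B_def bad_def \<Lambda>_def fam(1))
  have "avg (Q * B) (\<lambda>bs. of_bool (\<forall>q<Q. bad (drop (q * B) bs))) = avg B (\<lambda>bs. of_bool (bad bs)) ^ Q"
    by (rule avg_all_trials) (simp add: bad_def R.disc_round_col_append B_def)
  also have "\<dots> \<le> (1 / 2) ^ Q"
  proof (rule power_mono[OF half])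
    have "avg B (\<lambda>_. 0) \<le> avg B (\<lambda>bs. of_bool (bad bs))" by (rule avg_mono) simp
    then show "0 \<le> avg B (\<lambda>bs. of_bool (bad bs))" by simp
  qed
  finally have all_bad: "avg (Q * B) (\<lambda>bs. of_bool (\<forall>q<Q. bad (drop (q * B) bs))) \<le> (1 / 2) ^ Q" .
  have "1 - (1 / 2) ^ Q \<le> avg (Q * B) (\<lambda>bs. 1 - of_bool (\<forall>q<Q. bad (drop (q * B) bs)))"
    unfolding avg_diff_from using all_bad by simp
  also have "\<dots> \<le> avg (Q * B) (\<lambda>bs. of_bool (\<exists>\<kappa>\<in>{1..n} \<rightarrow> {1..k}.
      solve c (I, bs) = map \<kappa> [1..<n + 1] \<and> disc n m k f \<kappa> < \<Lambda>))"
  proof (rule avg_mono)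
    fix bs :: "bool list"
    show "1 - of_bool (\<forall>q<Q. bad (drop (q * B) bs)) \<le> (of_bool (\<exists>\<kappa>\<in>{1..n} \<rightarrow> {1..k}.
      solve c (I, bs) = map \<kappa> [1..<n + 1] \<and> disc n m k f \<kappa> < \<Lambda>) :: real)"
    proof (cases "\<forall>q<Q. bad (drop (q * B) bs)")
      case False
      then obtain q where q: "q < Q" "disc n m k f (col bs q) < \<Lambda>" by (auto simp: bad_def col_def)
      obtain q0 where q0: "solve c (I, bs) = map (col bs q0) [1..<n + 1]"
        "\<forall>q<Q. disc n m k f (col bs q0) \<le> disc n m k f (col bs q)" using best by blast
      have "disc n m k f (col bs q0) < \<Lambda>" using q0(2) q by (meson le_less_trans)
      then have "\<exists>\<kappa>\<in>{1..n} \<rightarrow> {1..k}. solve c (I, bs) = map \<kappa> [1..<n + 1] \<and> disc n m k f \<kappa> < \<Lambda>"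
        using q0(1) col by blast
      then show ?thesis by simp
    qed simp
  qed
  finally have "1 - (1 / 2) ^ Q \<le> avg (Q * B) (\<lambda>bs. of_bool (\<exists>\<kappa>\<in>{1..n} \<rightarrow> {1..k}.
      solve c (I, bs) = map \<kappa> [1..<n + 1] \<and> disc n m k f \<kappa> < \<Lambda>))" .
  moreover have "length (coin_tokens c I) = Q * B"
    unfolding I_def length_coin_tokens B_def Q_def T_def ..
  ultimately show "1 - (1 / 2) ^ length (trials c I) \<le> avg (length (coin_tokens c I)) (\<lambda>bs. of_bool
        (\<exists>\<kappa>\<in>{1..n} \<rightarrow> {1..k}. solve c (I, bs) = map \<kappa> [1..<n + 1] \<and> disc n m k (\<lambda>i. coverage (\<S> i)) \<kappa>
          < sqrt (2 * real m * real t ^ 3 * real k * real s * (1 + ln (2 * real m * real k)))))"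
    by (simp only: Q_def f_def \<Lambda>_def)
qed

lemma encode_instance_eq: "encode_instance n k Fs = enc ([1..<n + 1], k, Fs)"
  by (simp add: encode_instance_def enc_list_def enc_nat_def encode_nat_def)

lemma encode_colouring_eq: "encode_colouring n \<kappa> = enc (map \<kappa> [1..<n + 1])"
  by (simp add: encode_colouring_def enc_list_def enc_nat_def)

text \<open>High probability is read as failure at most the inverse of any prescribed power of the
  input size; the power is fixed before the program, which may use more trials for it.\<close>

theorem theorem1p5:
  shows "\<forall>c :: nat. \<exists>A. randomized_poly_time_on instances A \<and>
    (\<forall>(n::nat) (m::nat) (t::nat) (k::nat) (s::nat) (\<S> :: nat \<Rightarrow> nat set set) Fs.
       n \<ge> 1 \<longrightarrow> m \<ge> 1 \<longrightarrow> t \<ge> 1 \<longrightarrow> k \<ge> 1 \<longrightarrow> s \<ge> 1 \<longrightarrow>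
       sparse_coverage_family n m t \<S> \<longrightarrow>
       (\<forall>S \<in> (\<Union>i\<in>{1..m}. \<S> i). card S \<le> s) \<longrightarrow>
       lists_family n m \<S> Fs \<longrightarrow>
       (let x = encode_instance n k Fs in
          (\<forall>y \<in> set_spmf (result_of A x). \<exists>\<kappa> \<in> {1..n} \<rightarrow> {1..k}. y = encode_colouring n \<kappa>) \<and>
          measure (measure_spmf (result_of A x))
            {y. \<exists>\<kappa> \<in> {1..n} \<rightarrow> {1..k}. y = encode_colouring n \<kappa> \<and>
                 disc n m k (\<lambda>i. coverage (\<S> i)) \<kappa>
                   < sqrt (2 * real m * real t ^ 3 * real k * real s * (1 + ln (2 * real m * real k)))}
            \<ge> 1 - 1 / real (bit_size x) ^ c))"
proof (rule allI, goal_cases)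
  case (1 c)
  \<comment> \<open>\<open>2 * c\<close> matches the quadratic bound of the input size by tokens;
    the \<open>+ 1\<close> guarantees a trial even for \<open>c = 0\<close>.\<close>
  define c' where "c' = 2 * c + 1"
  obtain A G where G: "pb G" and A: "\<And>z. \<exists>Tm. (\<forall>bs. length bs = length (coin_tokens c' z) \<longrightarrow> Tm bs \<le> G z) \<and>
    run A (enc z) = map_spmf (\<lambda>bs. (enc (solve c' (z, bs)), Tm bs)) (flips (length (coin_tokens c' z)) [])"
    using random_bits_program[OF polyt_coin_tokens[OF polyt_ident, of c'] polyt_solve[of c']] by blast
  obtain p where p: "\<And>z. G z \<le> poly p (sz z)" using G unfolding pb_def by blast
  have result: "result_of A (enc z) = map_spmf (\<lambda>bs. enc (solve c' (z, bs))) (flips (length (coin_tokens c' z)) [])" for z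
    using A[of z] by (auto simp: result_of_def spmf.map_comp o_def)
  have "randomized_poly_time_on instances A"
    unfolding randomized_poly_time_on_def
  proof (intro exI[of _ p] ballI)
    fix x assume "x \<in> instances"
    then obtain n k Fs where "x = encode_instance n k Fs" unfolding instances_def by blast
    then obtain z :: inst where x: "x = enc z" unfolding encode_instance_eq by blast
    obtain Tm where Tm: "\<And>bs. length bs = length (coin_tokens c' z) \<Longrightarrow> Tm bs \<le> G z"
      and run: "run A x = map_spmf (\<lambda>bs. (enc (solve c' (z, bs)), Tm bs)) (flips (length (coin_tokens c' z)) [])"
      using A[of z] x by blast
    have "lossless_spmf (run A x)" unfolding run by (simp add: lossless_flips)
    moreover have "T \<le> poly p (bit_size x)" if yT: "(y, T) \<in> set_spmf (run A x)" for y T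
    proof -
      obtain bs where bs: "bs \<in> set_spmf (flips (length (coin_tokens c' z)) [])" "T = Tm bs"
        using yT unfolding run by auto
      have "length bs = length (coin_tokens c' z)" using length_flips[OF bs(1)] by simp
      from Tm[OF this] p[of z] show ?thesis unfolding bs(2) x sz_def by linarith
    qed
    ultimately show "lossless_spmf (run A x) \<and> (\<forall>(y, T)\<in>set_spmf (run A x). T \<le> poly p (bit_size x))"
      by blast
  qed
  moreover have "let x = encode_instance n k Fs in
          (\<forall>y \<in> set_spmf (result_of A x). \<exists>\<kappa> \<in> {1..n} \<rightarrow> {1..k}. y = encode_colouring n \<kappa>) \<and>
          measure (measure_spmf (result_of A x))
            {y. \<exists>\<kappa> \<in> {1..n} \<rightarrow> {1..k}. y = encode_colouring n \<kappa> \<and>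
                 disc n m k (\<lambda>i. coverage (\<S> i)) \<kappa>
                   < sqrt (2 * real m * real t ^ 3 * real k * real s * (1 + ln (2 * real m * real k)))}
            \<ge> 1 - 1 / real (bit_size x) ^ c"
    if ge: "n \<ge> 1" "m \<ge> 1" "t \<ge> 1" "k \<ge> 1" "s \<ge> 1" and sparse: "sparse_coverage_family n m t \<S>"
      and card: "\<forall>S \<in> (\<Union>i\<in>{1..m}. \<S> i). card S \<le> s" and lf: "lists_family n m \<S> Fs"
    for n m t k s :: nat and \<S> :: "nat \<Rightarrow> nat set set" and Fs
  proof -
    define I where "I = ([1..<n + 1], k, Fs)"
    define \<Lambda> where "\<Lambda> = sqrt (2 * real m * real t ^ 3 * real k * real s * (1 + ln (2 * real m * real k)))"
    define good where "good = (\<lambda>bs. \<exists>\<kappa>\<in>{1..n} \<rightarrow> {1..k}. solve c' (I, bs) = map \<kappa> [1..<n + 1] \<and>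
      disc n m k (\<lambda>i. coverage (\<S> i)) \<kappa> < \<Lambda>)"
    define Y where "Y = {y. \<exists>\<kappa> \<in> {1..n} \<rightarrow> {1..k}. y = encode_colouring n \<kappa> \<and> disc n m k (\<lambda>i. coverage (\<S> i)) \<kappa> < \<Lambda>}"
    have x: "encode_instance n k Fs = enc I" by (simp only: encode_instance_eq I_def)
    have all: "\<exists>\<kappa>\<in>{1..n} \<rightarrow> {1..k}. solve c' (I, bs) = map \<kappa> [1..<n + 1]" for bs
    proof (cases "k < n")
      case True
      show ?thesis unfolding I_def by (rule solve_small(1)[OF True ge(4,2) _ lf]) (simp add: c'_def)
    next
      case False
      then have "(\<lambda>j. j) \<in> {1..n} \<rightarrow> {1..k}" by auto
      with False show ?thesis unfolding I_def using solve_large[of n k c' Fs bs] by (metis not_less)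
    qed
    have prob: "1 - 1 / real (sz I) ^ c \<le> avg (length (coin_tokens c' I)) (\<lambda>bs. of_bool (good bs))"
    proof (cases "k < n")
      case True
      define u where "u = length (size_tokens I)"
      have sz: "sz I \<le> u ^ 2" unfolding I_def u_def by (rule sz_instance_le[OF True lf])
      have "sz I ^ c \<le> (u ^ 2) ^ c" by (rule power_mono[OF sz]) simp
      also have "\<dots> = u ^ (2 * c)" by (simp add: power_mult)
      \<comment> \<open>The crude \<open>u \<le> 2 ^ u\<close> suffices, because the number of
        trials is linear in \<open>u\<close>.\<close>
      also have "\<dots> \<le> (2 ^ u) ^ (2 * c)" by (rule power_mono) (use less_exp[of u] in simp_all)
      also have "\<dots> \<le> (2 :: nat) ^ (c' * u)"
        unfolding power_mult[symmetric] by (rule power_increasing) (simp_all add: c'_def algebra_simps)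
      finally have "real (sz I ^ c) \<le> real (2 ^ (c' * u))" by (simp only: of_nat_le_iff)
      then have le: "real (sz I) ^ c \<le> 2 ^ (c' * u)" by simp
      have "(1 / 2 :: real) ^ (c' * u) = 1 / 2 ^ (c' * u)" by (simp add: power_divide)
      also have "\<dots> \<le> 1 / real (sz I) ^ c"
        using le by (intro divide_left_mono) auto
      finally have "1 - 1 / real (sz I) ^ c \<le> 1 - (1 / 2) ^ length (trials c' I)"
        by (simp add: length_trials u_def)
      also have "\<dots> \<le> avg (length (coin_tokens c' I)) (\<lambda>bs. of_bool (good bs))"
        unfolding good_def \<Lambda>_def I_def
        by (rule solve_small(2)[OF True ge(4,2) _ lf ge(3,5) sparse card]) (simp add: c'_def)
      finally show ?thesis .
    next
      case False
      then have id: "(\<lambda>j. j) \<in> {1..n} \<rightarrow> {1..k}" by auto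
      have "disc n m k (\<lambda>i. coverage (\<S> i)) (\<lambda>j. j) < \<Lambda>"
        unfolding \<Lambda>_def by (rule disc_identity_less[OF ge(2,4,3,5) lists_family_index(3)[OF lf] sparse])
      then have "good bs" for bs
        unfolding good_def I_def using solve_large[of n k c' Fs bs] False id by (metis not_less)
      then show ?thesis by simp
    qed
    have "measure (measure_spmf (result_of A (enc I))) Y
        = avg (length (coin_tokens c' I)) (indicator ((\<lambda>bs. enc (solve c' (I, bs))) -` Y))"
      unfolding result measure_map_spmf measure_flips_Nil ..
    also have "\<dots> \<ge> avg (length (coin_tokens c' I)) (\<lambda>bs. of_bool (good bs))"
    proof (rule avg_mono)
      fix bs
      show "of_bool (good bs) \<le> (indicator ((\<lambda>bs. enc (solve c' (I, bs))) -` Y) bs :: real)"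
      proof (cases "good bs")
        case True
        then have "enc (solve c' (I, bs)) \<in> Y" unfolding good_def Y_def encode_colouring_eq by auto
        then show ?thesis by simp
      qed simp
    qed
    finally have "1 - 1 / real (sz I) ^ c \<le> measure (measure_spmf (result_of A (enc I))) Y" using prob by linarith
    moreover have "\<forall>y\<in>set_spmf (result_of A (enc I)). \<exists>\<kappa>\<in>{1..n} \<rightarrow> {1..k}. y = encode_colouring n \<kappa>"
    proof
      fix y assume "y \<in> set_spmf (result_of A (enc I))"
      then obtain bs where "y = enc (solve c' (I, bs))" unfolding result by auto
      with all[of bs] show "\<exists>\<kappa>\<in>{1..n} \<rightarrow> {1..k}. y = encode_colouring n \<kappa>"
        unfolding encode_colouring_eq by auto
    qed
    ultimately show ?thesis unfolding x Let_def Y_def \<Lambda>_def sz_def by blast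
  qed
  ultimately show ?case by blast
qed

end
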